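(* Let $X_1,X_2,\dots\in[0,1]$ be i.i.d. with mean $\theta^*$ and variance $\sigma^2>0$. Let $$W_n(\theta)=\prod_{t=1}^n(1+\lambda_t(\theta)(X_t-\theta)),\qquad w_n(\theta)=\sum_{t=1}^n\log(1+\lambda_t(\theta)(X_t-\theta)),$$ and let ME-estimators be defined as $\tilde\theta_n^{(E)}\in\arg\min_{\theta\in\Theta}w_n(\theta)$, where $\Theta=[0,1]$ contains $\theta^*$ in its interior $(0,1)$. Assume $\tilde\theta_n^{(E)}\xrightarrow{p}\theta^*$. Suppose furthermore that the predictable betting strategy $\lambda_t(\theta)$ is twice continuously differentiable with respect to $\theta$ almost surely, and satisfies the following conditions. (A1) There is a constant $\beta>0$ such that $\lambda_t'(\theta^* )\xrightarrow{L^2}-\beta$ as $t\to\infty$ and $\frac1n\sum_{t=1}^n|\lambda_t''(\theta^* )|=O_p(1)$. (A2) $\lambda_t(\theta^* )=\beta(\bar X_{t-1}-\theta^* )+r_t$, where $\bar X_{t-1}=\frac1{t-1}\sum_{i=1}^{t-1}X_i$ (with $\bar X_0:=\theta^*$), and the residual $r_t$ satisfies $n^{-1/2}\sum_{t=1}^n|r_t|\xrightarrow{p}0$. (A3) There exist a neighborhood $\Theta_0$ of $\theta^*$ and a constant $L<\infty$ such that $$\sup_{\theta\in\Theta_0}\big(|\lambda_t(\theta)|+|\lambda_t'(\theta)|+|\lambda_t''(\theta)|\big)\le L\quad\text{a.s. for all }t;$$ additionally, the bets are bounded away from $-1$ in this neighborhood, i.e. $1+\lambda_t(\theta)(X_t-\theta)\ge\epsilon>0$.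 Then, for $0<\beta<2/\sigma^2$, the ME-estimators are asymptotically normal: $$\sqrt n\,(\tilde\theta_n^{(E)}-\theta^* )\xrightarrow{d}\mathcal N(0,v_\beta),\qquad v_\beta=\sigma^2\,\frac{5-6\beta\sigma^2+2\beta^2\sigma^4}{(2-\beta\sigma^2)^2}.$$
   Context: For each $\theta\in[0,1]$ the bet fraction $\lambda_t(\theta)\in[-\frac1{1-\theta},\frac1\theta]$ (with $1/0=+\infty$) is real-valued and predictable, i.e. a (measurable) function of $X_1,\dots,X_{t-1}$. Primes denote derivatives with respect to $\theta$. An ME-estimator is any minimizer of $w_n$ over $[0,1]$ (assumed to exist). In (A3), $\epsilon>0$ is a constant, and the inequality $1+\lambda_t(\theta)(X_t-\theta)\ge\epsilon$ holds a.s. for all $t$ and all $\theta\in\Theta_0$. *)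

theory Defs
  imports "HOL-Probability.Probability"
begin

text \<open>
  Observations \<open>X t\<close> and bets \<open>lam t\<close> are indexed by \<open>t \<ge> 1\<close>; the value at index \<open>0\<close> is
  irrelevant. A betting strategy is written \<open>lam t \<theta> \<omega>\<close>, and only \<open>\<theta> \<in> {0..1}\<close> matters.
  The guards \<open>\<theta> < 1\<close> and \<open>0 < \<theta>\<close> express the convention \<open>1/0 = \<infinity>\<close>.
\<close>

definition betting_strategy ::
  "'a measure \<Rightarrow> (nat \<Rightarrow> 'a \<Rightarrow> real) \<Rightarrow> (nat \<Rightarrow> real \<Rightarrow> 'a \<Rightarrow> real) \<Rightarrow> bool" where
  "betting_strategy M X lam \<longleftrightarrow>
     (\<forall>t\<ge>1. \<forall>\<theta>\<in>{0..1}.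
        (\<exists>g \<in> borel_measurable (PiM {1..<t} (\<lambda>_. borel)).
           \<forall>\<omega>\<in>space M. lam t \<theta> \<omega> = g (\<lambda>i\<in>{1..<t}. X i \<omega>)) \<and>
        (\<forall>\<omega>\<in>space M. (\<theta> < 1 \<longrightarrow> - 1 / (1 - \<theta>) \<le> lam t \<theta> \<omega>) \<and>
                     (0 < \<theta> \<longrightarrow> lam t \<theta> \<omega> \<le> 1 / \<theta>)))"

definition wealth ::
  "(nat \<Rightarrow> 'a \<Rightarrow> real) \<Rightarrow> (nat \<Rightarrow> real \<Rightarrow> 'a \<Rightarrow> real) \<Rightarrow> nat \<Rightarrow> 'a \<Rightarrow> real \<Rightarrow> real" where
  "wealth X lam n \<omega> \<theta> = (\<Prod>t=1..n. 1 + lam t \<theta> \<omega> * (X t \<omega> - \<theta>))"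

text \<open>
  A factor of the wealth may vanish, and then \<open>log 0 = -\<infinity>\<close> is meant, whereas \<open>ln 0 = 0\<close> in HOL.
  The log-wealth is therefore extended-real valued.
\<close>

definition ext_ln :: "real \<Rightarrow> ereal" where
  "ext_ln x = (if 0 < x then ereal (ln x) else -\<infinity>)"

definition log_wealth ::
  "(nat \<Rightarrow> 'a \<Rightarrow> real) \<Rightarrow> (nat \<Rightarrow> real \<Rightarrow> 'a \<Rightarrow> real) \<Rightarrow> nat \<Rightarrow> 'a \<Rightarrow> real \<Rightarrow> ereal" where
  "log_wealth X lam n \<omega> \<theta> = (\<Sum>t=1..n. ext_ln (1 + lam t \<theta> \<omega> * (X t \<omega> - \<theta>)))"

lemma ext_ln_mult: "0 \<le> x \<Longrightarrow> 0 \<le> y \<Longrightarrow> ext_ln (x * y) = ext_ln x + ext_ln y"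
  by (auto simp: ext_ln_def ln_mult zero_less_mult_iff)

lemma log_wealth_eq_ext_ln_wealth:
  assumes "\<And>t. 1 \<le> t \<Longrightarrow> t \<le> n \<Longrightarrow> 0 \<le> 1 + lam t \<theta> \<omega> * (X t \<omega> - \<theta>)"
  shows "log_wealth X lam n \<omega> \<theta> = ext_ln (wealth X lam n \<omega> \<theta>)"
  using assms
proof (induction n)
  case 0
  then show ?case by (simp add: log_wealth_def wealth_def ext_ln_def)
next
  case (Suc n)
  have "0 \<le> wealth X lam n \<omega> \<theta>"
    unfolding wealth_def using Suc.prems by (intro prod_nonneg) auto
  with Suc show ?case
    by (simp add: log_wealth_def wealth_def ext_ln_mult)
qed

definition ME_estimator ::
  "'a measure \<Rightarrow> (nat \<Rightarrow> 'a \<Rightarrow> real) \<Rightarrow> (nat \<Rightarrow> real \<Rightarrow> 'a \<Rightarrow> real) \<Rightarrow> (nat \<Rightarrow> 'a \<Rightarrow> real) \<Rightarrow> bool" where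
  "ME_estimator M X lam est \<longleftrightarrow>
     (\<forall>n\<ge>1. est n \<in> borel_measurable M \<and>
        (AE \<omega> in M. is_arg_min (log_wealth X lam n \<omega>) (\<lambda>\<theta>. \<theta> \<in> {0..1}) (est n \<omega>)))"

text \<open>
  \<open>prev_mean X c t\<close> is the mean of the first \<open>t - 1\<close> observations, with value \<open>c\<close> if there are none.
\<close>

definition prev_mean :: "(nat \<Rightarrow> 'a \<Rightarrow> real) \<Rightarrow> real \<Rightarrow> nat \<Rightarrow> 'a \<Rightarrow> real" where
  "prev_mean X c t \<omega> = (if t \<le> 1 then c else (\<Sum>i=1..t-1. X i \<omega>) / real (t - 1))"

text \<open>Meant for open \<open>S\<close>, on which \<open>deriv\<close> is the derivative of a function given on \<open>S\<close> only.\<close>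

definition C2_on :: "(real \<Rightarrow> real) \<Rightarrow> real set \<Rightarrow> bool" where
  "C2_on f S \<longleftrightarrow>
     (\<forall>x\<in>S. f differentiable (at x)) \<and>
     (\<forall>x\<in>S. deriv f differentiable (at x)) \<and>
     continuous_on S (deriv (deriv f))"

definition tendsto_in_prob :: "'a measure \<Rightarrow> (nat \<Rightarrow> 'a \<Rightarrow> real) \<Rightarrow> real \<Rightarrow> bool" where
  "tendsto_in_prob M Y c \<longleftrightarrow>
     (\<forall>\<delta>>0. (\<lambda>n. measure M {\<omega>\<in>space M. \<bar>Y n \<omega> - c\<bar> > \<delta>}) \<longlonglongrightarrow> 0)"

text \<open>
  The derivatives of a strategy that is only almost surely smooth are defined, and hence
  measurable, only up to a null set. The next two notions tolerate this: the outer measure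
  and the nonnegative integral do not change if a function is modified on a null set,
  measurably or not, and for measurable functions they give the usual notions.
\<close>

definition bounded_in_prob :: "'a measure \<Rightarrow> (nat \<Rightarrow> 'a \<Rightarrow> real) \<Rightarrow> bool" where
  "bounded_in_prob M Y \<longleftrightarrow>
     (\<forall>\<delta>>0. \<exists>C. \<forall>\<^sub>F n in sequentially.
        outer_measure_of M {\<omega>\<in>space M. \<bar>Y n \<omega>\<bar> > C} \<le> ennreal \<delta>)"

definition tendsto_L2 :: "'a measure \<Rightarrow> (nat \<Rightarrow> 'a \<Rightarrow> real) \<Rightarrow> real \<Rightarrow> bool" where
  "tendsto_L2 M Y c \<longleftrightarrow> (\<lambda>n. \<integral>\<^sup>+\<omega>. ennreal ((Y n \<omega> - c)\<^sup>2) \<partial>M) \<longlonglongrightarrow> 0"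

end

theory Submission
  imports Defs "HOL-Real_Asymp.Real_Asymp"
begin

text \<open>
  Where the minimiser \<open>\<theta>\<close> is interior, the scores (the \<open>\<theta>\<close>-derivatives of the log-wealth increments)
  sum to zero. At the true mean the score sum is, up to \<open>o(sqrt n)\<close>, minus \<open>\<beta>\<close> times the sum of
  \<open>Y t + (1 - \<beta>\<sigma>\<^sup>2) m t\<close>, with \<open>Y t\<close> the centred observation and \<open>m t\<close> the centred mean of the previous
  ones; everything else is a martingale transform with small coefficients or quadratically small. This
  sum is a weighted sum of independent variables with logarithmic weights, so its characteristic function
  is a product and converges to a Gaussian one.

  The bound on the second derivative of the bets gives no equicontinuity of it in \<open>t\<close>, so the score
  cannot be expanded to second order at a random intermediate point. Instead the increment of
  the score between the true mean and \<open>\<theta>\<close> is split into a drift, linear in \<open>\<theta> - \<theta>s\<close> with slope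
  \<open>\<beta> (2 - \<beta>\<sigma>\<^sup>2)\<close> per observation, and the martingale with differences \<open>(lam' t \<theta> - lam' t \<theta>s) Y t\<close>.
  Since \<open>lam'\<close> is Lipschitz in \<open>\<theta>\<close>, Chebyshev's inequality on a grid of \<open>o(n)\<close> points with mesh
  \<open>o(1 / sqrt n)\<close> makes the latter negligible uniformly in \<open>\<theta>\<close>.
\<close>

section \<open>Convergence in probability to zero\<close>

text \<open>The two constants have a common origin. The score is \<open>N / E\<close> with
  \<open>E = 1 + \<lambda> (X - \<theta>)\<close>, and \<open>N\<close> is the \<theta>-derivative
  of \<open>E\<close>. At the true mean \<open>E\<close> is close to 1, the bet is close to
  \<open>\<beta> m\<close> and its derivative to \<open>-\<beta>\<close>. Expanding
  \<open>1 / E\<close> gives \<open>-\<beta> Y - \<beta> m + \<beta>^2 m Y^2\<close>; replacing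
  \<open>Y^2\<close> by its mean turns the coefficient of \<open>m\<close> into
  \<open>-\<beta> (1 - \<beta> \<sigma>^2)\<close>. Differentiating once more gives about
  \<open>\<lambda>'' Y - 2 \<lambda>' - N^2\<close>, that is
  \<open>\<lambda>'' Y + 2 \<beta> - \<beta>^2 Y^2\<close>, whose last two terms have mean
  \<open>\<beta> (2 - \<beta> \<sigma>^2)\<close>.

  Consistency provides no rate for the estimator. The errors are therefore arranged as
  \<open>kap * |U| + rho\<close> with \<open>U = sqrt n (\<theta> - \<theta>s)\<close> and both
  coefficients tending to 0 in probability. For \<open>\<beta> < 2 / \<sigma>^2\<close> the slope is
  positive and the first part is absorbed, so that the rate and the limit law come out
  together.\<close>

context prob_space
begin

text \<open>Measurability is part of the notion because \<open>measure\<close> is 0 on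
  non-measurable sets, so that the convergence alone could hold vacuously.\<close>

definition vanishing :: "(nat \<Rightarrow> 'a \<Rightarrow> real) \<Rightarrow> bool" where
  "vanishing Y \<longleftrightarrow> (\<forall>n. Y n \<in> borel_measurable M) \<and> tendsto_in_prob M Y 0"

lemma vanishing_measurable [measurable_dest]: "vanishing Y \<Longrightarrow> Y n \<in> borel_measurable M"
  by (simp add: vanishing_def)

lemma vanishingD:
  "vanishing Y \<Longrightarrow> \<delta> > 0 \<Longrightarrow> (\<lambda>n. prob {\<omega>\<in>space M. \<bar>Y n \<omega>\<bar> > \<delta>}) \<longlonglongrightarrow> 0"
  by (simp add: vanishing_def tendsto_in_prob_def)

lemma vanishingI:
  assumes "\<And>n. Y n \<in> borel_measurable M"
    and "\<And>\<delta>. \<delta> > 0 \<Longrightarrow> (\<lambda>n. prob {\<omega>\<in>space M. \<bar>Y n \<omega>\<bar> > \<delta>}) \<longlonglongrightarrow> 0"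
  shows "vanishing Y"
  using assms by (simp add: vanishing_def tendsto_in_prob_def)

text \<open>Localisation: the domination by \<open>B\<close> is required only on the event that
  \<open>A\<close> is at most \<open>\<delta>\<close>, whose complement has probability tending to
  0. It is needed because the estimates for the score hold only when the estimator is near the true
  mean.\<close>

lemma vanishing_bounded_on:
  assumes A: "vanishing A" and B: "vanishing B" and Z[measurable]: "\<And>n. Z n \<in> borel_measurable M"
    and \<delta>: "\<delta> > 0"
    and le: "\<forall>\<^sub>F n in sequentially. AE \<omega> in M. \<bar>A n \<omega>\<bar> \<le> \<delta> \<longrightarrow> \<bar>Z n \<omega>\<bar> \<le> \<bar>B n \<omega>\<bar>"
  shows "vanishing Z"
proof (rule vanishingI[OF Z])
  fix \<eta> :: real assume \<eta>: "\<eta> > 0"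
  note [measurable] = vanishing_measurable[OF A] vanishing_measurable[OF B]
  have "\<forall>\<^sub>F n in sequentially. prob {\<omega>\<in>space M. \<bar>Z n \<omega>\<bar> > \<eta>} \<le>
      prob {\<omega>\<in>space M. \<bar>A n \<omega>\<bar> > \<delta>} + prob {\<omega>\<in>space M. \<bar>B n \<omega>\<bar> > \<eta>}"
    using le
  proof eventually_elim
    case (elim n)
    have "prob {\<omega>\<in>space M. \<bar>Z n \<omega>\<bar> > \<eta>} \<le>
      prob ({\<omega>\<in>space M. \<bar>A n \<omega>\<bar> > \<delta>} \<union> {\<omega>\<in>space M. \<bar>B n \<omega>\<bar> > \<eta>})"
      using elim by (intro finite_measure_mono_AE) auto
    also have "\<dots> \<le> prob {\<omega>\<in>space M. \<bar>A n \<omega>\<bar> > \<delta>} + prob {\<omega>\<in>space M. \<bar>B n \<omega>\<bar> > \<eta>}"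
      by (rule measure_Un_le) auto
    finally show ?case .
  qed
  moreover have "(\<lambda>n. prob {\<omega>\<in>space M. \<bar>A n \<omega>\<bar> > \<delta>} + prob {\<omega>\<in>space M. \<bar>B n \<omega>\<bar> > \<eta>}) \<longlonglongrightarrow> 0"
    using tendsto_add[OF vanishingD[OF A \<delta>] vanishingD[OF B \<eta>]] by simp
  ultimately show "(\<lambda>n. prob {\<omega>\<in>space M. \<bar>Z n \<omega>\<bar> > \<eta>}) \<longlonglongrightarrow> 0"
    by (rule tendsto_sandwich[OF _ _ tendsto_const, rotated]) auto
qed

lemma vanishing_zero: "vanishing (\<lambda>n \<omega>. 0)"
  by (rule vanishingI) auto

lemma vanishing_mono_AE:
  assumes "vanishing B" "\<And>n. Z n \<in> borel_measurable M"
    "\<forall>\<^sub>F n in sequentially. AE \<omega> in M. \<bar>Z n \<omega>\<bar> \<le> \<bar>B n \<omega>\<bar>"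
  shows "vanishing Z"
  by (rule vanishing_bounded_on[OF vanishing_zero assms(1,2), where \<delta>=1]) (use assms(3) in auto)

lemma vanishing_add:
  assumes A: "vanishing A" and B: "vanishing B"
  shows "vanishing (\<lambda>n \<omega>. A n \<omega> + B n \<omega>)"
proof (rule vanishingI)
  note [measurable] = vanishing_measurable[OF A] vanishing_measurable[OF B]
  show "(\<lambda>\<omega>. A n \<omega> + B n \<omega>) \<in> borel_measurable M" for n by measurable
  fix \<eta> :: real assume "\<eta> > 0"
  then have \<eta>: "\<eta>/2 > 0" by simp
  have "prob {\<omega>\<in>space M. \<bar>A n \<omega> + B n \<omega>\<bar> > \<eta>} \<le>
      prob {\<omega>\<in>space M. \<bar>A n \<omega>\<bar> > \<eta>/2} + prob {\<omega>\<in>space M. \<bar>B n \<omega>\<bar> > \<eta>/2}" for n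
  proof -
    have "prob {\<omega>\<in>space M. \<bar>A n \<omega> + B n \<omega>\<bar> > \<eta>} \<le>
      prob ({\<omega>\<in>space M. \<bar>A n \<omega>\<bar> > \<eta>/2} \<union> {\<omega>\<in>space M. \<bar>B n \<omega>\<bar> > \<eta>/2})"
      by (intro finite_measure_mono) auto
    also have "\<dots> \<le> prob {\<omega>\<in>space M. \<bar>A n \<omega>\<bar> > \<eta>/2} + prob {\<omega>\<in>space M. \<bar>B n \<omega>\<bar> > \<eta>/2}"
      by (rule measure_Un_le) auto
    finally show ?thesis .
  qed
  then have "\<forall>\<^sub>F n in sequentially. norm (prob {\<omega>\<in>space M. \<bar>A n \<omega> + B n \<omega>\<bar> > \<eta>}) \<le>
      prob {\<omega>\<in>space M. \<bar>A n \<omega>\<bar> > \<eta>/2} + prob {\<omega>\<in>space M. \<bar>B n \<omega>\<bar> > \<eta>/2}"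
    by simp
  moreover have "(\<lambda>n. prob {\<omega>\<in>space M. \<bar>A n \<omega>\<bar> > \<eta>/2} + prob {\<omega>\<in>space M. \<bar>B n \<omega>\<bar> > \<eta>/2}) \<longlonglongrightarrow> 0"
    using tendsto_add[OF vanishingD[OF A \<eta>] vanishingD[OF B \<eta>]] by simp
  ultimately show "(\<lambda>n. prob {\<omega>\<in>space M. \<bar>A n \<omega> + B n \<omega>\<bar> > \<eta>}) \<longlonglongrightarrow> 0"
    by (rule Lim_null_comparison)
qed

lemma vanishing_abs: "vanishing A \<Longrightarrow> vanishing (\<lambda>n \<omega>. \<bar>A n \<omega>\<bar>)"
  unfolding vanishing_def tendsto_in_prob_def by (auto intro: borel_measurable_abs)

lemma vanishing_sqrt:
  assumes A: "vanishing A" shows "vanishing (\<lambda>n \<omega>. sqrt \<bar>A n \<omega>\<bar>)"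
proof (rule vanishingI)
  note [measurable] = vanishing_measurable[OF A]
  show "(\<lambda>\<omega>. sqrt \<bar>A n \<omega>\<bar>) \<in> borel_measurable M" for n by measurable
  fix \<eta> :: real assume \<eta>: "\<eta> > 0"
  have "sqrt \<bar>x\<bar> > \<eta> \<longleftrightarrow> \<bar>x\<bar> > \<eta>\<^sup>2" for x :: real
    using \<eta> real_sqrt_less_iff[of "\<eta>\<^sup>2" "\<bar>x\<bar>"] by simp
  then show "(\<lambda>n. prob {\<omega>\<in>space M. \<bar>sqrt \<bar>A n \<omega>\<bar>\<bar> > \<eta>}) \<longlonglongrightarrow> 0"
    using vanishingD[OF A, of "\<eta>\<^sup>2"] \<eta> by simp
qed

text \<open>Bounded second moments make \<open>T\<close> tight by Chebyshev's inequality, and a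
  factor tending to 0 in probability times a tight one tends to 0 in probability.\<close>

lemma vanishing_mult_L2_bounded:
  assumes A: "vanishing A" and T[measurable]: "\<And>n. T n \<in> borel_measurable M"
    and int: "\<And>n. integrable M (\<lambda>\<omega>. (T n \<omega>)\<^sup>2)" and le: "\<And>n. expectation (\<lambda>\<omega>. (T n \<omega>)\<^sup>2) \<le> C"
  shows "vanishing (\<lambda>n \<omega>. A n \<omega> * T n \<omega>)"
proof (rule vanishingI)
  note [measurable] = vanishing_measurable[OF A]
  show "(\<lambda>\<omega>. A n \<omega> * T n \<omega>) \<in> borel_measurable M" for n by measurable
  fix \<eta> :: real assume \<eta>: "\<eta> > 0"
  have C: "C \<ge> 0"
    by (rule order.trans[OF _ le[of 0]]) simp
  show "(\<lambda>n. prob {\<omega>\<in>space M. \<bar>A n \<omega> * T n \<omega>\<bar> > \<eta>}) \<longlonglongrightarrow> 0"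
  proof (rule LIMSEQ_I)
    fix e :: real assume e: "e > 0"
    \<comment> \<open>Chosen so that Chebyshev gives \<open>C / K\<^sup>2 < e/2\<close>. Using
      \<open>C + 1\<close> keeps \<open>K\<close> positive when \<open>C = 0\<close>.\<close>
    define K where "K = sqrt (2 * (C + 1) / e)"
    have K: "K > 0" "C / K\<^sup>2 < e/2"
      using C e by (auto simp: K_def field_simps)
    from LIMSEQ_D[OF vanishingD[OF A, of "\<eta> / K"], of "e/2"] \<eta> K e
    obtain N where N: "\<And>n. n \<ge> N \<Longrightarrow> prob {\<omega>\<in>space M. \<bar>A n \<omega>\<bar> > \<eta> / K} < e/2"
      by auto
    show "\<exists>N. \<forall>n\<ge>N. norm (prob {\<omega>\<in>space M. \<bar>A n \<omega> * T n \<omega>\<bar> > \<eta>} - 0) < e"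
    proof (intro exI allI impI)
      fix n assume n: "n \<ge> N"
      have "\<bar>A n \<omega>\<bar> > \<eta> / K \<or> (T n \<omega>)\<^sup>2 \<ge> K\<^sup>2" if "\<bar>A n \<omega> * T n \<omega>\<bar> > \<eta>" for \<omega>
      proof (rule ccontr)
        assume "\<not> ?thesis"
        then have "\<bar>A n \<omega>\<bar> \<le> \<eta> / K" "\<bar>T n \<omega>\<bar> \<le> K"
          using K by (auto simp: not_le intro: power2_le_imp_le dest!: less_imp_le)
        then have "\<bar>A n \<omega> * T n \<omega>\<bar> \<le> \<eta> / K * K"
          using \<eta> K unfolding abs_mult by (intro mult_mono) auto
        with that K show False by simp
      qed
      then have "prob {\<omega>\<in>space M. \<bar>A n \<omega> * T n \<omega>\<bar> > \<eta>} \<le>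
         prob ({\<omega>\<in>space M. \<bar>A n \<omega>\<bar> > \<eta> / K} \<union> {\<omega>\<in>space M. (T n \<omega>)\<^sup>2 \<ge> K\<^sup>2})"
        by (intro finite_measure_mono) auto
      also have "\<dots> \<le> prob {\<omega>\<in>space M. \<bar>A n \<omega>\<bar> > \<eta> / K} + prob {\<omega>\<in>space M. (T n \<omega>)\<^sup>2 \<ge> K\<^sup>2}"
        by (rule measure_Un_le) auto
      also have "prob {\<omega>\<in>space M. (T n \<omega>)\<^sup>2 \<ge> K\<^sup>2} \<le> expectation (\<lambda>\<omega>. (T n \<omega>)\<^sup>2) / K\<^sup>2"
        using K by (intro integral_Markov_inequality_measure[OF int, where A="{}"]) auto
      also have "\<dots> \<le> C / K\<^sup>2" using le by (intro divide_right_mono) auto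
      finally show "norm (prob {\<omega>\<in>space M. \<bar>A n \<omega> * T n \<omega>\<bar> > \<eta>} - 0) < e"
        using N[OF n] K(2) unfolding real_norm_def diff_0_right abs_of_nonneg[OF measure_nonneg] by linarith
    qed
  qed
qed

lemma vanishing_cmult:
  assumes "vanishing A" shows "vanishing (\<lambda>n \<omega>. c * A n \<omega>)"
proof -
  have "vanishing (\<lambda>n \<omega>. A n \<omega> * c)"
    by (rule vanishing_mult_L2_bounded[where C="c\<^sup>2", OF assms]) (simp_all add: prob_space)
  then show ?thesis by (simp only: mult.commute)
qed

lemma vanishing_L1:
  assumes Y: "\<And>n. integrable M (Y n)"
    and le: "\<forall>\<^sub>F n in sequentially. expectation (\<lambda>\<omega>. \<bar>Y n \<omega>\<bar>) \<le> b n" and b: "b \<longlonglongrightarrow> 0"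
  shows "vanishing Y"
proof (rule vanishingI)
  show Y_meas[measurable]: "Y n \<in> borel_measurable M" for n using Y by simp
  fix \<eta> :: real assume \<eta>: "\<eta> > 0"
  have "\<forall>\<^sub>F n in sequentially. prob {\<omega>\<in>space M. \<bar>Y n \<omega>\<bar> > \<eta>} \<le> b n / \<eta>"
    using le
  proof eventually_elim
    case (elim n)
    have "prob {\<omega>\<in>space M. \<bar>Y n \<omega>\<bar> > \<eta>} \<le> prob {\<omega>\<in>space M. \<bar>Y n \<omega>\<bar> \<ge> \<eta>}"
      by (intro finite_measure_mono) auto
    also have "\<dots> \<le> expectation (\<lambda>\<omega>. \<bar>Y n \<omega>\<bar>) / \<eta>"
      using Y \<eta> by (intro integral_Markov_inequality_measure[where A="{}"]) auto
    also have "\<dots> \<le> b n / \<eta>" using elim \<eta> by (intro divide_right_mono) auto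
    finally show ?case .
  qed
  moreover have "(\<lambda>n. b n / \<eta>) \<longlonglongrightarrow> 0" using tendsto_divide[OF b tendsto_const, of \<eta>] \<eta> by simp
  ultimately show "(\<lambda>n. prob {\<omega>\<in>space M. \<bar>Y n \<omega>\<bar> > \<eta>}) \<longlonglongrightarrow> 0"
    by (rule tendsto_sandwich[OF _ _ tendsto_const, rotated]) auto
qed

lemma vanishing_L2:
  assumes Y: "\<And>n. Y n \<in> borel_measurable M" "\<And>n. integrable M (\<lambda>\<omega>. (Y n \<omega>)\<^sup>2)"
    and le: "\<forall>\<^sub>F n in sequentially. expectation (\<lambda>\<omega>. (Y n \<omega>)\<^sup>2) \<le> b n" and b: "b \<longlonglongrightarrow> 0"
  shows "vanishing Y"
proof -
  have "vanishing (\<lambda>n \<omega>. (Y n \<omega>)\<^sup>2)"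
    by (rule vanishing_L1[OF Y(2) _ b]) (use le in simp)
  from vanishing_sqrt[OF this] have "vanishing (\<lambda>n \<omega>. \<bar>Y n \<omega>\<bar>)" by simp
  then show ?thesis by (rule vanishing_mono_AE) (use Y in auto)
qed

lemma vanishing_const:
  assumes "b \<longlonglongrightarrow> 0" shows "vanishing (\<lambda>n \<omega>. b n)"
  by (rule vanishing_L1[where b="\<lambda>n. \<bar>b n\<bar>", OF _ _ tendsto_rabs_zero[OF assms]])
     (simp_all add: prob_space)

lemma vanishing_const_mult:
  assumes "vanishing A" "b \<longlonglongrightarrow> 0"
  shows "vanishing (\<lambda>n \<omega>. A n \<omega> * b n)"
proof -
  from assms(2) obtain K where K: "\<And>n. \<bar>b n\<bar> \<le> K"
    using convergent_imp_Bseq[of b] by (auto simp: convergent_def Bseq_def)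
  show ?thesis
  proof (rule vanishing_mult_L2_bounded[where C="K\<^sup>2", OF assms(1)])
    show "expectation (\<lambda>\<omega>. (b n)\<^sup>2) \<le> K\<^sup>2" for n
      using power_mono[OF K abs_ge_zero, of n 2] by (simp add: prob_space)
  qed simp_all
qed

text \<open>Once \<open>\<bar>\<kappa>\<bar> \<le> \<gamma>/2\<close>, the inequality can be solved for \<open>\<bar>U\<bar>\<close>, and then the right-hand side vanishes.\<close>

lemma vanishing_linearization:
  assumes \<kappa>: "vanishing \<kappa>" and \<rho>: "vanishing \<rho>" and \<Delta>: "vanishing \<Delta>" and pos: "\<gamma> > 0" "\<delta> > 0"
    and T[measurable]: "\<And>n. T n \<in> borel_measurable M"
    and U[measurable]: "\<And>n. U n \<in> borel_measurable M"
    and T2: "\<And>n. integrable M (\<lambda>\<omega>. (T n \<omega>)\<^sup>2)" "\<And>n. expectation (\<lambda>\<omega>. (T n \<omega>)\<^sup>2) \<le> C"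
    and le: "\<forall>\<^sub>F n in sequentially. AE \<omega> in M. \<bar>\<Delta> n \<omega>\<bar> \<le> \<delta> \<longrightarrow>
       \<bar>\<gamma> * U n \<omega> - T n \<omega>\<bar> \<le> \<bar>\<kappa> n \<omega>\<bar> * \<bar>U n \<omega>\<bar> + \<bar>\<rho> n \<omega>\<bar>"
  shows "vanishing (\<lambda>n \<omega>. U n \<omega> - T n \<omega> / \<gamma>)"
proof -
  \<comment> \<open>One bound \<open>?A \<le> \<delta>\<close> encodes two requirements:
    \<open>\<Delta>\<close> is at most \<open>\<delta>\<close>, and \<open>\<kappa>\<close> is at
    most \<open>\<gamma> / 2\<close>. On this event \<open>U\<close> is at most
    \<open>(2/\<gamma>) (|\<rho>| + |T|)\<close>, and inserting this into the hypothesis produces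
    \<open>?W\<close>.\<close>
  let ?A = "\<lambda>n \<omega>. \<bar>\<Delta> n \<omega>\<bar> + (2 * \<delta> / \<gamma>) * \<bar>\<kappa> n \<omega>\<bar>"
  let ?W = "\<lambda>n \<omega>. (2 / \<gamma>) * (\<bar>\<kappa> n \<omega>\<bar> * \<bar>T n \<omega>\<bar>) + 2 * \<bar>\<rho> n \<omega>\<bar>"
  have "vanishing (\<lambda>n \<omega>. \<bar>\<kappa> n \<omega>\<bar> * \<bar>T n \<omega>\<bar>)"
    by (rule vanishing_mult_L2_bounded[OF vanishing_abs[OF \<kappa>]]) (use T2 in auto)
  then have W: "vanishing (\<lambda>n \<omega>. (1/\<gamma>) * ?W n \<omega>)"
    by (intro vanishing_cmult vanishing_add vanishing_abs \<rho>)
  have A: "vanishing ?A" by (intro vanishing_cmult vanishing_add vanishing_abs \<kappa> \<Delta>)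
  have Z: "(\<lambda>\<omega>. U n \<omega> - T n \<omega> / \<gamma>) \<in> borel_measurable M" for n by simp
  show ?thesis
  proof (rule vanishing_bounded_on[OF A W Z pos(2)])
    show "\<forall>\<^sub>F n in sequentially. AE \<omega> in M. \<bar>?A n \<omega>\<bar> \<le> \<delta> \<longrightarrow> \<bar>U n \<omega> - T n \<omega> / \<gamma>\<bar> \<le> \<bar>(1/\<gamma>) * ?W n \<omega>\<bar>"
      using le
    proof eventually_elim
      case (elim n)
      then show ?case
      proof (eventually_elim, intro impI)
        fix \<omega>
        assume h: "\<bar>\<Delta> n \<omega>\<bar> \<le> \<delta> \<longrightarrow> \<bar>\<gamma> * U n \<omega> - T n \<omega>\<bar> \<le> \<bar>\<kappa> n \<omega>\<bar> * \<bar>U n \<omega>\<bar> + \<bar>\<rho> n \<omega>\<bar>"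
          and a: "\<bar>?A n \<omega>\<bar> \<le> \<delta>"
        define k u t p where "k = \<bar>\<kappa> n \<omega>\<bar>" and "u = \<bar>U n \<omega>\<bar>" and "t = \<bar>T n \<omega>\<bar>" and "p = \<bar>\<rho> n \<omega>\<bar>"
        note d = k_def u_def t_def p_def
        have nn: "0 \<le> 2 * \<delta> / \<gamma> * k" "k \<ge> 0" "u \<ge> 0" "t \<ge> 0" "p \<ge> 0" using pos by (auto simp: d)
        have "\<bar>\<Delta> n \<omega>\<bar> \<le> \<delta>" and k: "2 * \<delta> / \<gamma> * k \<le> \<delta>" using a nn by (auto simp: d)
        with h have h: "\<bar>\<gamma> * U n \<omega> - T n \<omega>\<bar> \<le> k * u + p" by (simp add: d)
        have k: "k \<le> \<gamma> / 2" using k pos by (simp add: field_simps)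
        have "\<gamma> * u = \<bar>\<gamma> * U n \<omega>\<bar>" using pos by (simp add: d abs_mult)
        then have "\<gamma> * u \<le> k * u + p + t" using h unfolding t_def by linarith
        also have "k * u \<le> \<gamma> / 2 * u" using k nn by (intro mult_right_mono) auto
        finally have "u \<le> (2/\<gamma>) * (p + t)" using pos by (simp add: field_simps)
        then have "k * u \<le> k * ((2/\<gamma>) * (p + t))" using nn by (intro mult_left_mono) auto
        also have "\<dots> = (2/\<gamma>) * (k * t) + (2/\<gamma>) * k * p" by (simp add: algebra_simps add_divide_distrib)
        also have "(2/\<gamma>) * k * p \<le> 1 * p" using k pos nn by (intro mult_right_mono) (auto simp: field_simps)
        finally have *: "\<bar>\<gamma> * U n \<omega> - T n \<omega>\<bar> \<le> ?W n \<omega>" using h by (simp add: d)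
        have "U n \<omega> - T n \<omega> / \<gamma> = (\<gamma> * U n \<omega> - T n \<omega>) / \<gamma>" using pos by (simp add: field_simps)
        then have "\<bar>U n \<omega> - T n \<omega> / \<gamma>\<bar> = \<bar>\<gamma> * U n \<omega> - T n \<omega>\<bar> / \<gamma>" using pos by simp
        also have "\<dots> \<le> ?W n \<omega> / \<gamma>" using * pos by (intro divide_right_mono) auto
        also have "\<dots> = (1/\<gamma>) * ?W n \<omega>" by simp
        also have "\<dots> \<le> \<bar>\<dots>\<bar>" by (rule abs_ge_self)
        finally show "\<bar>U n \<omega> - T n \<omega> / \<gamma>\<bar> \<le> \<bar>(1/\<gamma>) * ?W n \<omega>\<bar>" .
      qed
    qed
  qed
qed

text \<open>Slutsky's argument on characteristic functions: the complex exponential is bounded by 1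
  and 1-Lipschitz, so the integrands differ by at most \<open>|t| \<delta>\<close> where
  \<open>U\<close> and \<open>V\<close> are \<open>\<delta>\<close>-close, and by at most 2
  elsewhere.\<close>

lemma char_tendsto_of_vanishing:
  assumes UV: "vanishing (\<lambda>n \<omega>. U n \<omega> - V n \<omega>)"
    and U[measurable]: "\<And>n. U n \<in> borel_measurable M" and V[measurable]: "\<And>n. V n \<in> borel_measurable M"
    and lim: "(\<lambda>n. char (distr M borel (V n)) t) \<longlonglongrightarrow> l"
  shows "(\<lambda>n. char (distr M borel (U n)) t) \<longlonglongrightarrow> l"
proof -
  have "(\<lambda>n. char (distr M borel (U n)) t - char (distr M borel (V n)) t) \<longlonglongrightarrow> 0"
  proof (rule LIMSEQ_I)
    fix e :: real assume e: "e > 0"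
    \<comment> \<open>The close part then contributes at most \<open>e/2\<close>, and the bad event,
      of probability below \<open>e/4\<close>, contributes less than \<open>e/2\<close>. The summand
      1 covers \<open>t = 0\<close>.\<close>
    define \<delta> where "\<delta> = e / (2 * (\<bar>t\<bar> + 1))"
    have \<delta>: "\<delta> > 0" "\<bar>t\<bar> * \<delta> \<le> e / 2" using e by (auto simp: \<delta>_def field_simps)
    let ?B = "\<lambda>n. {\<omega>\<in>space M. \<bar>U n \<omega> - V n \<omega>\<bar> > \<delta>}"
    from LIMSEQ_D[OF vanishingD[OF UV \<delta>(1)], of "e/4"] e
    obtain N where N: "\<And>n. n \<ge> N \<Longrightarrow> prob (?B n) < e/4" by auto
    show "\<exists>N. \<forall>n\<ge>N. norm (char (distr M borel (U n)) t - char (distr M borel (V n)) t - 0) < e"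
    proof (intro exI allI impI)
      fix n assume n: "n \<ge> N"
      have int: "integrable M (\<lambda>\<omega>. iexp (t * W \<omega>))" if "W \<in> borel_measurable M" for W
        using that by (intro integrable_const_bound[where B=1]) auto
      have bd: "norm (iexp (t * U n \<omega>) - iexp (t * V n \<omega>)) \<le> \<bar>t\<bar> * \<delta> + 2 * indicator (?B n) \<omega>"
        if "\<omega> \<in> space M" for \<omega>
      proof (cases "\<omega> \<in> ?B n")
        case True
        have "norm (iexp (t * U n \<omega>) - iexp (t * V n \<omega>)) \<le> 2"
          by (rule order.trans[OF norm_triangle_ineq4]) simp
        also have "\<dots> \<le> \<bar>t\<bar> * \<delta> + 2 * indicator (?B n) \<omega>" using True \<delta>(1) by simp
        finally show ?thesis .
      next
        case False
        have "iexp (t * U n \<omega>) - iexp (t * V n \<omega>) =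
            iexp (t * V n \<omega>) * (iexp (t * (U n \<omega> - V n \<omega>)) - 1)"
          by (simp add: algebra_simps exp_add[symmetric])
        then have "norm (iexp (t * U n \<omega>) - iexp (t * V n \<omega>)) = norm (iexp (t * (U n \<omega> - V n \<omega>)) - 1)"
          by (simp add: norm_mult)
        also have "\<dots> \<le> \<bar>t * (U n \<omega> - V n \<omega>)\<bar>"
          using iexp_approx1[of "t * (U n \<omega> - V n \<omega>)" 0] by simp
        also have "\<dots> \<le> \<bar>t\<bar> * \<delta>" using False that unfolding abs_mult by (intro mult_left_mono) auto
        finally show ?thesis using False by simp
      qed
      have "char (distr M borel (U n)) t - char (distr M borel (V n)) t =
          (CLINT \<omega>|M. iexp (t * U n \<omega>) - iexp (t * V n \<omega>))"
        unfolding char_def by (subst (1 2) integral_distr) (auto simp: int simp del: of_real_mult intro!: Bochner_Integration.integral_diff[symmetric])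
      also have "norm \<dots> \<le> expectation (\<lambda>\<omega>. norm (iexp (t * U n \<omega>) - iexp (t * V n \<omega>)))"
        by (rule integral_norm_bound)
      also have "\<dots> \<le> expectation (\<lambda>\<omega>. \<bar>t\<bar> * \<delta> + 2 * indicator (?B n) \<omega>)"
      proof (rule integral_mono[OF _ _ bd])
        show "integrable M (\<lambda>\<omega>. norm (iexp (t * U n \<omega>) - iexp (t * V n \<omega>)))"
          using int U V by (simp del: of_real_mult)
        show "integrable M (\<lambda>\<omega>. \<bar>t\<bar> * \<delta> + 2 * indicator (?B n) \<omega>)"
          using \<delta> by (intro integrable_const_bound[where B="\<bar>t\<bar> * \<delta> + 2"])
            (auto simp: indicator_def intro!: AE_I2)
      qed
      also have "\<dots> = \<bar>t\<bar> * \<delta> + 2 * prob (?B n)"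
      proof -
        have "integrable M (indicat_real (?B n))"
          by (rule integrable_real_indicator) (auto simp: less_top[symmetric])
        then show ?thesis by (subst Bochner_Integration.integral_add) (auto simp: prob_space)
      qed
      also have "\<dots> < e" using \<delta> N[OF n] by simp
      finally show "norm (char (distr M borel (U n)) t - char (distr M borel (V n)) t - 0) < e" by simp
    qed
  qed
  from tendsto_add[OF this lim] show ?thesis by simp
qed

end

section \<open>Predictable transforms of bounded i.i.d. variables\<close>

locale bounded_iid = prob_space M for M :: "'a measure" +
  fixes X :: "nat \<Rightarrow> 'a \<Rightarrow> real" and \<mu> v :: real
  assumes indep: "indep_vars (\<lambda>_. borel) X {1..}"
    and ident: "t \<ge> 1 \<Longrightarrow> distr M borel (X t) = distr M borel (X 1)"
    and range: "t \<ge> 1 \<Longrightarrow> \<omega> \<in> space M \<Longrightarrow> X t \<omega> \<in> {0..1}"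
    and mean: "expectation (X 1) = \<mu>"
    and var: "variance (X 1) = v"
begin

text \<open>The sigma-algebra of the first \<open>t - 1\<close> observations; being measurable for
  \<open>hist t\<close> is predictability at time \<open>t\<close>. Pulling it back from the product
  space matches the representation of bets as functions of the vector of past observations.\<close>

definition hist :: "nat \<Rightarrow> 'a measure" where
  "hist t = vimage_algebra (space M) (\<lambda>\<omega>. \<lambda>i\<in>{1..<t}. X i \<omega>) (PiM {1..<t} (\<lambda>_. borel))"

lemma space_hist [simp]: "space (hist t) = space M"
  by (simp add: hist_def)

lemma X_measurable [measurable]: "t \<ge> 1 \<Longrightarrow> X t \<in> borel_measurable M"
  using indep by (auto simp: indep_vars_def2)

lemma hist_vector_measurable:
  "(\<lambda>\<omega>. \<lambda>i\<in>{1..<t}. X i \<omega>) \<in> hist t \<rightarrow>\<^sub>M PiM {1..<t} (\<lambda>_. borel)"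
  unfolding hist_def by (rule measurable_vimage_algebra1) (auto simp: space_PiM)

lemma X_measurable_hist:
  assumes "1 \<le> i" "i < t" shows "X i \<in> borel_measurable (hist t)"
proof -
  have "(\<lambda>\<omega>. (\<lambda>i\<in>{1..<t}. X i \<omega>) i) \<in> borel_measurable (hist t)"
    using assms by (intro measurable_compose[OF hist_vector_measurable] measurable_component_singleton) auto
  then show ?thesis using assms by simp
qed

lemma measurable_from_hist:
  assumes "f \<in> hist t \<rightarrow>\<^sub>M N" shows "f \<in> M \<rightarrow>\<^sub>M N"
proof -
  have "(\<lambda>\<omega>. \<omega>) \<in> M \<rightarrow>\<^sub>M hist t"
    unfolding hist_def
    by (rule measurable_vimage_algebra2) (auto intro!: measurable_restrict X_measurable)
  from measurable_compose[OF this assms] show ?thesis .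
qed

lemma measurable_hist_mono:
  assumes "f \<in> hist s \<rightarrow>\<^sub>M N" "s \<le> t" shows "f \<in> hist t \<rightarrow>\<^sub>M N"
proof -
  have "(\<lambda>\<omega>. \<omega>) \<in> hist t \<rightarrow>\<^sub>M hist s"
    unfolding hist_def[of s]
    by (rule measurable_vimage_algebra2) (use assms(2) in \<open>auto intro!: measurable_restrict X_measurable_hist\<close>)
  from measurable_compose[OF this assms(1)] show ?thesis .
qed

text \<open>The events of \<open>Z\<close> lie in the sigma-algebra of the block
  \<open>{1..<t}\<close> and those of \<open>h (X t)\<close> in that of the block
  \<open>{t}\<close>. Disjoint blocks of an independent family are independent, and this passes to
  smaller families of events.\<close>

lemma indep_var_hist:
  assumes t: "t \<ge> 1" and Z: "Z \<in> borel_measurable (hist t)" and h: "h \<in> borel_measurable borel"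
  shows "indep_var borel (Z :: 'a \<Rightarrow> real) borel (\<lambda>\<omega>. h (X t \<omega>))"
proof -
  let ?R = "\<lambda>J \<omega>. \<lambda>i\<in>J. X i \<omega>" and ?P = "\<lambda>J. PiM J (\<lambda>_. borel :: real measure)"
  let ?G = "\<lambda>J. {?R J -` A \<inter> space M |A. A \<in> sets (?P J)}"
  have *: "indep_var (?P {1..<t}) (?R {1..<t}) (?P {t}) (?R {t})"
    by (rule indep_var_restrict[OF indep]) (use t in auto)
  have "{Z -` A \<inter> space M |A. A \<in> sets borel} \<subseteq> ?G {1..<t}"
  proof safe
    fix A :: "real set" assume "A \<in> sets borel"
    then have "Z -` A \<inter> space M \<in> sets (hist t)"
      using measurable_sets[OF Z] by simp
    then show "\<exists>B. Z -` A \<inter> space M = ?R {1..<t} -` B \<inter> space M \<and> B \<in> sets (?P {1..<t})"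
      unfolding hist_def by (subst (asm) sets_vimage_algebra2) (auto simp: space_PiM)
  qed
  then have Z_sub: "sigma_sets (space M) {Z -` A \<inter> space M |A. A \<in> sets borel}
      \<subseteq> sigma_sets (space M) (?G {1..<t})"
    by (rule sigma_sets_mono')
  have "{(\<lambda>\<omega>. h (X t \<omega>)) -` A \<inter> space M |A. A \<in> sets borel} \<subseteq> ?G {t}"
  proof safe
    fix A :: "real set" assume A: "A \<in> sets borel"
    have "(\<lambda>f. h (f t)) \<in> borel_measurable (?P {t})"
      using h by (intro measurable_compose[OF _ h] measurable_component_singleton) auto
    from measurable_sets[OF this A]
    show "\<exists>B. (\<lambda>\<omega>. h (X t \<omega>)) -` A \<inter> space M = ?R {t} -` B \<inter> space M \<and> B \<in> sets (?P {t})"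
      by (intro exI[of _ "(\<lambda>f. h (f t)) -` A \<inter> space (?P {t})"]) (auto simp: space_PiM)
  qed
  then have h_sub: "sigma_sets (space M) {(\<lambda>\<omega>. h (X t \<omega>)) -` A \<inter> space M |A. A \<in> sets borel}
      \<subseteq> sigma_sets (space M) (?G {t})"
    by (rule sigma_sets_mono')
  have "random_variable borel (\<lambda>\<omega>. h (X t \<omega>))"
    using t h by (intro measurable_compose[OF _ h]) auto
  then show ?thesis
    using * measurable_from_hist[OF Z] Z_sub h_sub unfolding indep_var_eq indep_set_def
    by (auto elim!: indep_sets_mono_sets split: bool.splits)
qed

text \<open>Banach-valued \<open>h\<close> are allowed because the lemma serves both real moments
  and the complex exponentials in characteristic functions.\<close>

lemma expectation_X_eq:
  fixes h :: "real \<Rightarrow> 'b::{banach, second_countable_topology}"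
  assumes "t \<ge> 1" "h \<in> borel_measurable borel"
  shows "(LINT \<omega>|M. h (X t \<omega>)) = (LINT \<omega>|M. h (X 1 \<omega>))"
  using ident[OF assms(1)] integral_distr[of "X t" M borel h] integral_distr[of "X 1" M borel h] assms
  by simp

lemma expectation_hist_mult:
  fixes h :: "real \<Rightarrow> real"
  assumes t: "t \<ge> 1" and Z: "Z \<in> borel_measurable (hist t)" "\<And>\<omega>. \<omega> \<in> space M \<Longrightarrow> \<bar>Z \<omega>\<bar> \<le> B"
    and h: "h \<in> borel_measurable borel" "\<And>\<omega>. \<omega> \<in> space M \<Longrightarrow> \<bar>h (X t \<omega>)\<bar> \<le> 1"
  shows "expectation (\<lambda>\<omega>. Z \<omega> * h (X t \<omega>)) = expectation Z * expectation (\<lambda>\<omega>. h (X 1 \<omega>))"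
proof -
  have [measurable]: "Z \<in> borel_measurable M" "h \<in> borel_measurable borel" "X t \<in> borel_measurable M"
    using Z measurable_from_hist h t by auto
  have "expectation (\<lambda>\<omega>. Z \<omega> * h (X t \<omega>)) = expectation Z * expectation (\<lambda>\<omega>. h (X t \<omega>))"
    by (rule indep_var_lebesgue_integral[OF indep_var_hist[OF t Z(1) h(1)]])
       (use Z h in \<open>auto intro: integrable_const_bound[where B=B] integrable_const_bound[where B=1]\<close>)
  then show ?thesis using expectation_X_eq[OF t h(1)] by simp
qed

text \<open>Martingale differences are orthogonal.\<close>

lemma second_moment_transform_le:
  fixes h :: "real \<Rightarrow> real" and b :: "nat \<Rightarrow> real"
  assumes Z: "\<And>t. t \<ge> 1 \<Longrightarrow> Z t \<in> borel_measurable (hist t)"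
      "\<And>t \<omega>. t \<ge> 1 \<Longrightarrow> \<omega> \<in> space M \<Longrightarrow> \<bar>Z t \<omega>\<bar> \<le> B"
      "\<And>t. t \<ge> 1 \<Longrightarrow> expectation (\<lambda>\<omega>. (Z t \<omega>)\<^sup>2) \<le> b t"
    and h: "h \<in> borel_measurable borel"
      "\<And>t \<omega>. t \<ge> 1 \<Longrightarrow> \<omega> \<in> space M \<Longrightarrow> \<bar>h (X t \<omega>)\<bar> \<le> 1"
      "expectation (\<lambda>\<omega>. h (X 1 \<omega>)) = 0"
  shows "integrable M (\<lambda>\<omega>. (\<Sum>t=1..n. Z t \<omega> * h (X t \<omega>))\<^sup>2) \<and>
    expectation (\<lambda>\<omega>. (\<Sum>t=1..n. Z t \<omega> * h (X t \<omega>))\<^sup>2) \<le> (\<Sum>t=1..n. b t)"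
proof (induction n)
  case 0
  then show ?case by simp
next
  case (Suc n)
  let ?S = "\<lambda>\<omega>. \<Sum>t=1..n. Z t \<omega> * h (X t \<omega>)" and ?t = "Suc n"
  have B: "B \<ge> 0" using Z(2)[of 1] not_empty by fastforce
  have [measurable]: "h \<in> borel_measurable borel" by fact
  have Zh: "Z ?t \<in> borel_measurable (hist ?t)" using Z(1)[of ?t] by simp
  have S[measurable]: "?S \<in> borel_measurable (hist ?t)"
    by (intro borel_measurable_sum borel_measurable_times measurable_hist_mono[OF Z(1)]
        measurable_compose[OF X_measurable_hist h(1)]) auto
  have [measurable]: "?S \<in> borel_measurable M" "Z ?t \<in> borel_measurable M" "X ?t \<in> borel_measurable M"
    using measurable_from_hist[OF S] measurable_from_hist[OF Zh] by auto
  have Zb: "\<bar>Z ?t \<omega>\<bar> \<le> B" "\<bar>h (X ?t \<omega>)\<bar> \<le> 1" if "\<omega> \<in> space M" for \<omega>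
    using Z(2)[of ?t] h(2)[of ?t] that by auto
  have Sb: "\<bar>?S \<omega>\<bar> \<le> real n * B" if "\<omega> \<in> space M" for \<omega>
  proof -
    have "\<bar>?S \<omega>\<bar> \<le> (\<Sum>t=1..n. B * 1)"
      using that B unfolding abs_mult
      by (intro order.trans[OF sum_abs] sum_mono, unfold abs_mult, intro mult_mono Z h) auto
    then show ?thesis by simp
  qed
  have SZb: "\<bar>?S \<omega> * Z ?t \<omega>\<bar> \<le> real n * B * B" if "\<omega> \<in> space M" for \<omega>
    using that Sb[OF that] Zb[OF that] B by (auto simp: abs_mult intro!: mult_mono)
  \<comment> \<open>The product of the earlier sum and the new coefficient is predictable, so the
    expectation factorises and \<open>h\<close> contributes the factor 0.\<close>
  have cross: "expectation (\<lambda>\<omega>. (?S \<omega> * Z ?t \<omega>) * h (X ?t \<omega>)) = 0"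
    using expectation_hist_mult[of ?t "\<lambda>\<omega>. ?S \<omega> * Z ?t \<omega>" "real n * B * B" h] S Zh SZb Zb h
    by simp
  have i1: "integrable M (\<lambda>\<omega>. (?S \<omega> * Z ?t \<omega>) * h (X ?t \<omega>))"
  proof (rule integrable_const_bound[where B="real n * B * B * 1"])
    show "AE \<omega> in M. norm ((?S \<omega> * Z ?t \<omega>) * h (X ?t \<omega>)) \<le> real n * B * B * 1"
      unfolding real_norm_def abs_mult[of "_ * _" "h _"] using SZb Zb B by (intro AE_I2 mult_mono) auto
  qed measurable
  have sq: "(Z ?t \<omega> * h (X ?t \<omega>))\<^sup>2 \<le> (Z ?t \<omega>)\<^sup>2" if "\<omega> \<in> space M" for \<omega>
    using Zb(2)[OF that] by (simp add: power_mult_distrib mult_left_le abs_square_le_1)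
  have i3: "integrable M (\<lambda>\<omega>. (Z ?t \<omega>)\<^sup>2)"
    using Zb B by (intro integrable_const_bound[where B="B\<^sup>2"]) (auto intro!: AE_I2 abs_le_square_iff[THEN iffD1])
  have i2: "integrable M (\<lambda>\<omega>. (Z ?t \<omega> * h (X ?t \<omega>))\<^sup>2)"
    using sq by (intro Bochner_Integration.integrable_bound[OF i3]) (auto intro!: AE_I2)
  have e2: "expectation (\<lambda>\<omega>. (Z ?t \<omega> * h (X ?t \<omega>))\<^sup>2) \<le> b ?t"
    using integral_mono[OF i2 i3 sq] Z(3)[of ?t] by simp
  have eq: "(\<Sum>t=1..Suc n. Z t \<omega> * h (X t \<omega>))\<^sup>2 =
      (?S \<omega>)\<^sup>2 + 2 * ((?S \<omega> * Z ?t \<omega>) * h (X ?t \<omega>)) + (Z ?t \<omega> * h (X ?t \<omega>))\<^sup>2" for \<omega>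
    by (simp add: power2_sum algebra_simps)
  show ?case
    unfolding eq using Suc.IH i1 i2 e2 cross by (auto simp del: sum.cl_ivl_Suc simp: sum.cl_ivl_Suc)
qed

end

section \<open>The limit law of the weighted sum\<close>

lemma abs_exp_minus_linear_le:
  fixes y :: real assumes "y \<ge> 0" shows "\<bar>exp (- y) - (1 - y)\<bar> \<le> y\<^sup>2"
proof -
  have "exp (- y) = 1 / exp y" by (simp add: exp_minus field_simps)
  also have "\<dots> \<le> 1 / (1 + y)" using assms by (intro divide_left_mono) (auto simp: exp_ge_add_one_self)
  \<comment> \<open>This is \<open>(1 + y) * (1 - y + y\<^sup>2) = 1 + y^3 \<ge> 1\<close>.\<close>
  also have "\<dots> \<le> 1 - y + y\<^sup>2"
    using assms by (simp add: divide_simps algebra_simps power2_eq_square)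
  finally show ?thesis using exp_ge_add_one_self[of "-y"] by simp
qed

text \<open>Observation \<open>i\<close> enters the running mean of time \<open>t\<close> with
  weight \<open>1 / (t - 1)\<close>, for \<open>t\<close> from \<open>i + 1\<close> to
  \<open>n\<close>. With \<open>j = t - 1\<close> its total weight up to time \<open>n\<close> is
  this piece of the harmonic series, roughly \<open>ln (n / i)\<close>.\<close>

definition hsum :: "nat \<Rightarrow> nat \<Rightarrow> real" where
  "hsum n i = (\<Sum>j=i..<n. 1 / real j)"

lemma hsum_Suc: "i \<le> n \<Longrightarrow> hsum (Suc n) i = hsum n i + 1 / real n"
  by (simp add: hsum_def)

lemma hsum_self [simp]: "hsum n n = 0"
  by (simp add: hsum_def)

lemma hsum_nonneg: "0 \<le> hsum n i"
  by (auto simp: hsum_def intro!: sum_nonneg)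

lemma hsum_le: "1 \<le> i \<Longrightarrow> hsum n i \<le> hsum n 1"
  unfolding hsum_def by (intro sum_mono2) auto

lemma hsum_le_ln: "hsum n 1 \<le> 1 + ln (real n + 1)"
proof (cases "n \<le> 1")
  case True
  then show ?thesis by (auto simp: hsum_def le_Suc_eq)
next
  case False
  have "hsum n 1 = harm (n - 1)"
    unfolding hsum_def harm_def using False by (intro sum.cong) (auto simp: field_simps)
  also have "\<dots> \<le> harm n" by (intro harm_mono) simp
  \<comment> \<open>The difference of the harmonic number and the logarithm decreases from its value
    1 at the first index.\<close>
  also have "\<dots> \<le> 1 + ln (real n)" using decseqD[OF decseq_harm_diff_ln, of 0 "n - 1"] False by (simp add: harm_expand)
  also have "\<dots> \<le> 1 + ln (real n + 1)" using False by simp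
  finally show ?thesis .
qed

text \<open>Passing from \<open>n\<close> to \<open>n + 1\<close> raises each of the
  \<open>n\<close> weights by \<open>1 / n\<close>, hence the total by 1; the newest observation has
  weight 0.\<close>

lemma sum_hsum: "n \<ge> 1 \<Longrightarrow> (\<Sum>i=1..n. hsum n i) = real n - 1"
proof (induction n rule: dec_induct)
  case (step n)
  have "(\<Sum>i=1..Suc n. hsum (Suc n) i) = (\<Sum>i=1..n. hsum n i + 1 / real n)"
    by (simp add: hsum_Suc)
  also have "\<dots> = (real n - 1) + 1" using step by (simp add: sum.distrib)
  finally show ?case by simp
qed simp

text \<open>Each step adds \<open>(2 / n) (n - 1)\<close> from the cross terms and
  \<open>1 / n\<close> from the squares, together \<open>2 - 1 / n\<close>; the harmonic sum on the
  right collects the terms \<open>1 / n\<close>.\<close>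

lemma sum_hsum_square: "n \<ge> 1 \<Longrightarrow> (\<Sum>i=1..n. (hsum n i)\<^sup>2) = 2 * (real n - 1) - hsum n 1"
proof (induction n rule: dec_induct)
  case (step n)
  have "(\<Sum>i=1..Suc n. (hsum (Suc n) i)\<^sup>2) = (\<Sum>i=1..n. (hsum n i + 1 / real n)\<^sup>2)"
    by (simp add: hsum_Suc)
  also have "\<dots> = (\<Sum>i=1..n. (hsum n i)\<^sup>2) + (\<Sum>i=1..n. hsum n i) * (2 / real n) + real n * (1 / real n)\<^sup>2"
  proof -
    have "(h + 1 / real n)\<^sup>2 = h\<^sup>2 + h * (2 / real n) + (1 / real n)\<^sup>2" for h
      by (simp add: power2_sum)
    then show ?thesis by (simp only: sum.distrib sum_distrib_right[symmetric] sum_constant) simp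
  qed
  also have "\<dots> = 2 * (real n - 1) - hsum n 1 + (real n - 1) * (2 / real n) + real n * (1 / real n)\<^sup>2"
    using step by (simp only: step.IH sum_hsum)
  also have "\<dots> = 2 * (real (Suc n) - 1) - hsum (Suc n) 1"
    using step by (simp add: hsum_Suc field_simps power2_eq_square)
  finally show ?case .
qed simp

text \<open>\<open>wgt c n i\<close> is the total weight of the \<open>i\<close>-th observation in a sum of \<open>n\<close> observations
  plus \<open>c\<close> times the sum of their running means.\<close>

definition wgt :: "real \<Rightarrow> nat \<Rightarrow> nat \<Rightarrow> real" where
  "wgt c n i = 1 + c * hsum n i"

lemma wgt_le:
  assumes "1 \<le> i" shows "\<bar>wgt c n i\<bar> \<le> 1 + \<bar>c\<bar> * (1 + ln (real n + 1))"
proof -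
  have "\<bar>c * hsum n i\<bar> \<le> \<bar>c\<bar> * (1 + ln (real n + 1))"
    unfolding abs_mult using hsum_le[OF assms] hsum_le_ln[of n] hsum_nonneg[of n i]
    by (intro mult_left_mono) (auto intro: order.trans)
  then show ?thesis by (simp add: wgt_def)
qed

lemma sum_wgt_square:
  assumes "n \<ge> 1"
  shows "(\<Sum>i=1..n. (wgt c n i)\<^sup>2) = real n + 2 * c * (real n - 1) + c\<^sup>2 * (2 * (real n - 1) - hsum n 1)"
proof -
  have "(\<Sum>i=1..n. (wgt c n i)\<^sup>2) = real n + 2 * c * (\<Sum>i=1..n. hsum n i) + c\<^sup>2 * (\<Sum>i=1..n. (hsum n i)\<^sup>2)"
    by (simp add: wgt_def power2_sum sum.distrib sum_distrib_left power_mult_distrib mult.assoc)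
  then show ?thesis using assms by (simp only: sum_hsum sum_hsum_square)
qed

lemma sum_wgt_square_le: "(\<Sum>i=1..n. (wgt c n i)\<^sup>2) \<le> (1 + 2 * \<bar>c\<bar> + 2 * c\<^sup>2) * real n"
proof (cases "n \<ge> 1")
  case True
  have "c * (real n - 1) \<le> \<bar>c\<bar> * (real n - 1)"
    using True by (intro mult_right_mono) auto
  also have "\<dots> \<le> \<bar>c\<bar> * real n" by (intro mult_left_mono) auto
  finally have "2 * c * (real n - 1) \<le> 2 * \<bar>c\<bar> * real n" by simp
  moreover have "c\<^sup>2 * (2 * (real n - 1) - hsum n 1) \<le> c\<^sup>2 * (2 * real n)"
    using hsum_nonneg[of n 1] by (intro mult_left_mono) auto
  ultimately show ?thesis unfolding sum_wgt_square[OF True] by (simp add: algebra_simps)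
qed simp

text \<open>Since \<open>hsum n i\<close> behaves like \<open>ln (n / i)\<close>, the limit is the
  integral of \<open>(1 - c ln u)^2\<close> over the unit interval. The exact formula for the sum
  makes a Riemann sum argument unnecessary: it suffices that the harmonic sum is
  \<open>o(n)\<close>.\<close>

lemma sum_wgt_square_tendsto:
  "(\<lambda>n. (\<Sum>i=1..n. (wgt c n i)\<^sup>2) / real n) \<longlonglongrightarrow> 1 + 2 * c + 2 * c\<^sup>2"
proof -
  have h: "(\<lambda>n. hsum n 1 / real n) \<longlonglongrightarrow> 0"
  proof (rule tendsto_sandwich[OF _ _ tendsto_const])
    show "(\<lambda>n. (1 + ln (real n + 1)) / real n) \<longlonglongrightarrow> 0" by real_asymp
    show "\<forall>\<^sub>F n in sequentially. hsum n 1 / real n \<le> (1 + ln (real n + 1)) / real n"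
      by (intro always_eventually allI divide_right_mono hsum_le_ln) simp
  qed (auto simp: hsum_nonneg)
  have "(\<lambda>n. 1 + 2 * c * (1 - 1 / real n) + c\<^sup>2 * (2 * (1 - 1 / real n) - hsum n 1 / real n))
      \<longlonglongrightarrow> 1 + 2 * c * (1 - 0) + c\<^sup>2 * (2 * (1 - 0) - 0)"
    by (intro tendsto_intros h lim_1_over_n)
  then have lim: "(\<lambda>n. 1 + 2 * c * (1 - 1 / real n) + c\<^sup>2 * (2 * (1 - 1 / real n) - hsum n 1 / real n))
      \<longlonglongrightarrow> 1 + 2 * c + 2 * c\<^sup>2" by (simp add: mult.commute)
  have "\<forall>\<^sub>F n in sequentially. 1 + 2 * c * (1 - 1 / real n) + c\<^sup>2 * (2 * (1 - 1 / real n) - hsum n 1 / real n)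
      = (\<Sum>i=1..n. (wgt c n i)\<^sup>2) / real n"
    using eventually_ge_at_top[of 1]
    by eventually_elim (simp only: sum_wgt_square, simp add: field_simps)
  then show ?thesis by (rule Lim_transform_eventually[OF lim])
qed

context bounded_iid
begin

text \<open>The default value of \<open>prev_mean\<close> is here the true mean, so
  \<open>mbar\<close> is 0 at time 1. This agrees with the quotient \<open>0 / 0 = 0\<close> in
  \<open>mbar_eq\<close>.\<close>

definition mbar :: "nat \<Rightarrow> 'a \<Rightarrow> real" where
  "mbar t \<omega> = prev_mean X \<mu> t \<omega> - \<mu>"

lemma mbar_eq: "t \<ge> 1 \<Longrightarrow> mbar t \<omega> = (\<Sum>i=1..t-1. X i \<omega> - \<mu>) / real (t - 1)"
  by (auto simp: mbar_def prev_mean_def sum_subtractf field_simps)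

lemma mean_bounds: "0 \<le> \<mu>" "\<mu> \<le> 1"
proof -
  have i: "integrable M (X 1)"
    by (rule integrable_const_bound[where B=1]) (use range[of 1] in auto)
  show "0 \<le> \<mu>" "\<mu> \<le> 1"
    using integral_mono[OF _ i, of "\<lambda>_. 0"] integral_mono[OF i, of "\<lambda>_. 1"] range[of 1] mean
    by (auto simp: prob_space)
qed

lemma centred_le: "t \<ge> 1 \<Longrightarrow> \<omega> \<in> space M \<Longrightarrow> \<bar>X t \<omega> - \<mu>\<bar> \<le> 1"
  using range[of t \<omega>] mean_bounds by auto

lemma centred_integrable: "integrable M (\<lambda>\<omega>. X 1 \<omega> - \<mu>)" "integrable M (\<lambda>\<omega>. (X 1 \<omega> - \<mu>)\<^sup>2)"
  by (rule integrable_const_bound[where B=1]; use centred_le[of 1] in \<open>auto simp: abs_square_le_1\<close>)+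

lemma centred_expectation: "expectation (\<lambda>\<omega>. X 1 \<omega> - \<mu>) = 0" "expectation (\<lambda>\<omega>. (X 1 \<omega> - \<mu>)\<^sup>2) = v"
proof -
  have "integrable M (X 1)"
    by (rule integrable_const_bound[where B=1]) (use range[of 1] in auto)
  then show "expectation (\<lambda>\<omega>. X 1 \<omega> - \<mu>) = 0" using mean by (simp add: prob_space)
  show "expectation (\<lambda>\<omega>. (X 1 \<omega> - \<mu>)\<^sup>2) = v" using var unfolding mean .
qed

lemma var_bounds: "0 \<le> v" "v \<le> 1"
proof -
  have "(X 1 \<omega> - \<mu>)\<^sup>2 \<le> 1" if "\<omega> \<in> space M" for \<omega>
    using centred_le[of 1 \<omega>] that by (simp add: abs_square_le_1)
  then show "0 \<le> v" "v \<le> 1"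
    using integral_mono[OF centred_integrable(2), of "\<lambda>_. 1"] integral_mono[OF _ centred_integrable(2), of "\<lambda>_. 0"]
    unfolding centred_expectation by (auto simp: prob_space)
qed

text \<open>Interchange of summation, done by induction: the new running mean distributes
  \<open>1 / n\<close> to each of the first \<open>n\<close> observations, exactly as
  \<open>hsum_Suc\<close> does.\<close>

lemma sum_mbar: "(\<Sum>t=1..n. mbar t \<omega>) = (\<Sum>i=1..n. hsum n i * (X i \<omega> - \<mu>))"
proof (induction n)
  case (Suc n)
  have "(\<Sum>i=1..Suc n. hsum (Suc n) i * (X i \<omega> - \<mu>)) = (\<Sum>i=1..n. (hsum n i + 1 / real n) * (X i \<omega> - \<mu>))"
    by (simp add: hsum_Suc)
  also have "\<dots> = (\<Sum>i=1..n. hsum n i * (X i \<omega> - \<mu>)) + (\<Sum>i=1..n. X i \<omega> - \<mu>) / real n"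
    by (simp only: distrib_right sum.distrib) (simp add: sum_divide_distrib)
  also have "\<dots> = (\<Sum>t=1..Suc n. mbar t \<omega>)" using Suc by (simp add: mbar_eq)
  finally show ?case ..
qed simp

definition main_term :: "real \<Rightarrow> nat \<Rightarrow> 'a \<Rightarrow> real" where
  "main_term c n \<omega> = (\<Sum>t=1..n. (X t \<omega> - \<mu>) + c * mbar t \<omega>) / sqrt (real n)"

lemma main_term_eq: "main_term c n \<omega> = (\<Sum>t=1..n. wgt c n t / sqrt (real n) * (X t \<omega> - \<mu>))"
proof -
  have "(\<Sum>t=1..n. (X t \<omega> - \<mu>) + c * mbar t \<omega>) = (\<Sum>t=1..n. X t \<omega> - \<mu>) + c * (\<Sum>t=1..n. mbar t \<omega>)"
    by (simp only: sum.distrib sum_distrib_left)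
  also have "\<dots> = (\<Sum>t=1..n. wgt c n t * (X t \<omega> - \<mu>))"
    unfolding sum_mbar wgt_def by (simp only: sum.distrib sum_distrib_left distrib_right mult_1_left mult.assoc)
  finally show ?thesis by (simp add: main_term_def sum_divide_distrib)
qed

lemma main_term_measurable [measurable]: "main_term c n \<in> borel_measurable M"
  unfolding main_term_eq[abs_def] by (intro borel_measurable_sum) auto

text \<open>The bound does not depend on \<open>n\<close>. It supplies the tightness that
  \<open>vanishing_linearization\<close> asks of the leading term.\<close>

lemma main_term_second_moment:
  "integrable M (\<lambda>\<omega>. (main_term c n \<omega>)\<^sup>2)"
  "expectation (\<lambda>\<omega>. (main_term c n \<omega>)\<^sup>2) \<le> 1 + 2 * \<bar>c\<bar> + 2 * c\<^sup>2"
proof -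
  let ?Z = "\<lambda>t. wgt c n t / sqrt (real n)"
  have Z: "\<bar>?Z t\<bar> \<le> (1 + \<bar>c\<bar> * (1 + ln (real n + 1))) / sqrt (real n)" if "t \<ge> 1" for t
    using divide_right_mono[OF wgt_le[OF that, of c n], of "sqrt (real n)"] by (simp add: abs_divide)
  have *: "integrable M (\<lambda>\<omega>. (main_term c n \<omega>)\<^sup>2) \<and> expectation (\<lambda>\<omega>. (main_term c n \<omega>)\<^sup>2) \<le> (\<Sum>t=1..n. (?Z t)\<^sup>2)"
    unfolding main_term_eq
    by (rule second_moment_transform_le[where Z="\<lambda>t _. ?Z t" and h="\<lambda>x. x - \<mu>"])
       (use Z centred_le centred_expectation in \<open>auto simp: prob_space\<close>)
  have "(\<Sum>t=1..n. (?Z t)\<^sup>2) = (\<Sum>t=1..n. (wgt c n t)\<^sup>2) / real n"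
    by (simp add: power_divide sum_divide_distrib)
  also have "\<dots> \<le> 1 + 2 * \<bar>c\<bar> + 2 * c\<^sup>2"
    using sum_wgt_square_le[where c=c and n=n] by (cases "n = 0") (auto simp: field_simps)
  finally show "integrable M (\<lambda>\<omega>. (main_term c n \<omega>)\<^sup>2)"
    "expectation (\<lambda>\<omega>. (main_term c n \<omega>)\<^sup>2) \<le> 1 + 2 * \<bar>c\<bar> + 2 * c\<^sup>2" using * by auto
qed

definition cf :: "real \<Rightarrow> complex" where
  "cf s = char (distr M borel (\<lambda>\<omega>. X 1 \<omega> - \<mu>)) s"

text \<open>Both functions are compared with \<open>1 - s\<^sup>2 * v / 2\<close>, the first by a
  third-order Taylor bound for bounded variables. The shape of the error matters: the factors
  \<open>s\<^sup>2\<close> have a bounded sum over the observations, while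
  \<open>|s| + s\<^sup>2\<close> is uniformly small.\<close>

lemma cf_approx: "norm (cf s - exp (- (s\<^sup>2 * v / 2))) \<le> s\<^sup>2 * (\<bar>s\<bar> + s\<^sup>2)"
proof -
  let ?Y = "\<lambda>\<omega>. X 1 \<omega> - \<mu>"
  have "norm (cf s - (1 - s\<^sup>2 * v / 2)) \<le> (s\<^sup>2 / 6) * expectation (\<lambda>\<omega>. min (6 * (?Y \<omega>)\<^sup>2) (\<bar>s\<bar> * \<bar>?Y \<omega>\<bar> ^ 3))"
    unfolding cf_def using centred_integrable centred_expectation
    by (intro char_approx3') auto
  also have "\<dots> \<le> (s\<^sup>2 / 6) * \<bar>s\<bar>"
  proof (rule mult_left_mono)
    have "min (6 * (?Y \<omega>)\<^sup>2) (\<bar>s\<bar> * \<bar>?Y \<omega>\<bar> ^ 3) \<le> \<bar>s\<bar>" if "\<omega> \<in> space M" for \<omega>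
      using centred_le[of 1 \<omega>] that by (intro min.coboundedI2 mult_left_le power_le_one) auto
    moreover have "integrable M (\<lambda>\<omega>. min (6 * (?Y \<omega>)\<^sup>2) (\<bar>s\<bar> * \<bar>?Y \<omega>\<bar> ^ 3))"
      by (rule integrable_const_bound[where B="\<bar>s\<bar>"]) (use calculation in \<open>auto intro!: AE_I2\<close>)
    ultimately show "expectation (\<lambda>\<omega>. min (6 * (?Y \<omega>)\<^sup>2) (\<bar>s\<bar> * \<bar>?Y \<omega>\<bar> ^ 3)) \<le> \<bar>s\<bar>"
      using integral_mono[of M _ "\<lambda>_. \<bar>s\<bar>"] by (simp add: prob_space)
  qed simp
  finally have 1: "norm (cf s - (1 - s\<^sup>2 * v / 2)) \<le> s\<^sup>2 * \<bar>s\<bar>" by (rule order.trans) (simp add: field_simps)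
  let ?y = "s\<^sup>2 * v / 2"
  have "norm (complex_of_real (1 - ?y) - complex_of_real (exp (- ?y))) = \<bar>exp (- ?y) - (1 - ?y)\<bar>"
    by (simp only: of_real_diff[symmetric] norm_of_real abs_minus_commute)
  also have "\<dots> \<le> ?y\<^sup>2" using var_bounds by (intro abs_exp_minus_linear_le) auto
  also have "\<dots> \<le> (s\<^sup>2)\<^sup>2"
  proof (rule power_mono)
    show "?y \<le> s\<^sup>2"
      using mult_left_mono[OF var_bounds(2) zero_le_power2[of s]] zero_le_power2[of s] by linarith
  qed (use var_bounds in auto)
  finally have 2: "norm (complex_of_real (1 - ?y) - complex_of_real (exp (- ?y))) \<le> s\<^sup>2 * s\<^sup>2"
    by (simp only: power2_eq_square)
  have "cf s - exp (- ?y) = (cf s - (1 - ?y)) + (complex_of_real (1 - ?y) - complex_of_real (exp (- ?y)))"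
    by (simp add: exp_of_real)
  then have "norm (cf s - exp (- ?y)) \<le> norm (cf s - (1 - ?y)) + norm (complex_of_real (1 - ?y) - complex_of_real (exp (- ?y)))"
    by (metis norm_triangle_ineq)
  also have "\<dots> \<le> s\<^sup>2 * (\<bar>s\<bar> + s\<^sup>2)" using 1 2 by (simp add: distrib_left)
  finally show ?thesis by simp
qed

lemma char_main_term:
  "char (distr M borel (main_term c n)) u = (\<Prod>t=1..n. cf (u * (wgt c n t / sqrt (real n))))"
proof -
  let ?Z = "\<lambda>t. wgt c n t / sqrt (real n)"
  have "indep_vars (\<lambda>_. borel) (\<lambda>t \<omega>. ?Z t * (X t \<omega> - \<mu>)) {1..n}"
    by (rule indep_vars_compose2[OF indep_vars_subset[OF indep], where Y="\<lambda>t x. ?Z t * (x - \<mu>)"]) auto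
  then have "char (distr M borel (main_term c n)) u =
      (\<Prod>t=1..n. char (distr M borel (\<lambda>\<omega>. ?Z t * (X t \<omega> - \<mu>))) u)"
    unfolding main_term_eq[abs_def] by (rule char_distr_sum)
  also have "\<dots> = (\<Prod>t=1..n. cf (u * ?Z t))"
  proof (rule prod.cong[OF refl])
    fix t assume "t \<in> {1..n}"
    then have t: "t \<ge> 1" by simp
    show "char (distr M borel (\<lambda>\<omega>. ?Z t * (X t \<omega> - \<mu>))) u = cf (u * ?Z t)"
      unfolding cf_def char_def using t expectation_X_eq[OF t, of "\<lambda>x. iexp (u * (?Z t * (x - \<mu>)))"]
      by (subst (1 2) integral_distr) (auto simp: mult.assoc)
  qed
  finally show ?thesis .
qed

text \<open>A product of factors of modulus at most 1 changes by no more than the sum of the changes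
  of its factors. By \<open>cf_approx\<close> that sum is at most \<open>u\<^sup>2 * ?q n\<close>,
  which stays bounded, times \<open>?m n + (?m n)\<^sup>2\<close>. The logarithmic weights make
  \<open>?m\<close> of order \<open>ln n / sqrt n\<close>, so no single observation matters.\<close>

lemma char_main_term_tendsto:
  "(\<lambda>n. char (distr M borel (main_term c n)) u) \<longlonglongrightarrow> exp (- (u\<^sup>2 * (v * (1 + 2 * c + 2 * c\<^sup>2)) / 2))"
proof -
  let ?x = "\<lambda>n t. u * (wgt c n t / sqrt (real n))"
  let ?m = "\<lambda>n. \<bar>u\<bar> * ((1 + \<bar>c\<bar> * (1 + ln (real n + 1))) / sqrt (real n))"
  let ?q = "\<lambda>n. (\<Sum>t=1..n. (wgt c n t)\<^sup>2) / real n"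
  have q: "(\<Sum>t=1..n. (?x n t)\<^sup>2) = u\<^sup>2 * ?q n" for n
    by (simp add: power_mult_distrib power_divide sum_divide_distrib sum_distrib_left)
  have bound: "norm (char (distr M borel (main_term c n)) u - exp (- (u\<^sup>2 * ?q n * v / 2)))
      \<le> (u\<^sup>2 * ?q n) * (?m n + (?m n)\<^sup>2)" for n
  proof -
    have "exp (- (u\<^sup>2 * ?q n * v / 2)) = (\<Prod>t=1..n. exp (- ((?x n t)\<^sup>2 * v / 2)))"
      unfolding q[symmetric] exp_sum[OF finite_atLeastAtMost, symmetric]
      by (simp add: sum_distrib_right sum_negf sum_divide_distrib)
    then have e: "exp (- (u\<^sup>2 * ?q n * v / 2)) = (\<Prod>t=1..n. complex_of_real (exp (- ((?x n t)\<^sup>2 * v / 2))))"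
      by (simp only: of_real_prod)
    have "norm ((\<Prod>t=1..n. cf (?x n t)) - (\<Prod>t=1..n. complex_of_real (exp (- ((?x n t)\<^sup>2 * v / 2)))))
       \<le> (\<Sum>t=1..n. norm (cf (?x n t) - complex_of_real (exp (- ((?x n t)\<^sup>2 * v / 2)))))"
    proof (rule norm_prod_diff)
      interpret D: real_distribution "distr M borel (\<lambda>\<omega>. X 1 \<omega> - \<mu>)" by (rule real_distribution_distr) simp
      show "norm (cf (?x n t)) \<le> 1" for t unfolding cf_def by (rule D.cmod_char_le_1)
    qed (use var_bounds in \<open>auto simp: \<close>)
    also have "\<dots> \<le> (\<Sum>t=1..n. (?x n t)\<^sup>2 * (?m n + (?m n)\<^sup>2))"
    proof (rule sum_mono)
      fix t assume "t \<in> {1..n}"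
      then have "\<bar>?x n t\<bar> \<le> ?m n"
        using divide_right_mono[OF wgt_le[of t c n], of "sqrt (real n)"]
        unfolding abs_mult by (intro mult_left_mono) (auto simp: abs_divide)
      then have "\<bar>?x n t\<bar> + (?x n t)\<^sup>2 \<le> ?m n + (?m n)\<^sup>2"
        using power_mono[of "\<bar>?x n t\<bar>" "?m n" 2] by (intro add_mono) (simp_all only: power2_abs abs_ge_zero)
      then have "(?x n t)\<^sup>2 * (\<bar>?x n t\<bar> + (?x n t)\<^sup>2) \<le> (?x n t)\<^sup>2 * (?m n + (?m n)\<^sup>2)"
        by (intro mult_left_mono) auto
      with cf_approx[of "?x n t"]
      show "norm (cf (?x n t) - complex_of_real (exp (- ((?x n t)\<^sup>2 * v / 2)))) \<le> (?x n t)\<^sup>2 * (?m n + (?m n)\<^sup>2)"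
        by (simp only: of_real_exp)
    qed
    also have "\<dots> = (u\<^sup>2 * ?q n) * (?m n + (?m n)\<^sup>2)" by (simp only: sum_distrib_right[symmetric] q)
    finally show ?thesis unfolding char_main_term e .
  qed
  have m: "?m \<longlonglongrightarrow> 0" by real_asymp
  have "(\<lambda>n. (u\<^sup>2 * ?q n) * (?m n + (?m n)\<^sup>2)) \<longlonglongrightarrow> (u\<^sup>2 * (1 + 2 * c + 2 * c\<^sup>2)) * (0 + 0\<^sup>2)"
    by (intro tendsto_intros sum_wgt_square_tendsto m)
  then have "(\<lambda>n. char (distr M borel (main_term c n)) u - exp (- (u\<^sup>2 * ?q n * v / 2))) \<longlonglongrightarrow> 0"
    by (intro Lim_null_comparison[OF always_eventually[OF allI[OF bound]]]) simp
  moreover have "(\<lambda>n. complex_of_real (exp (- (u\<^sup>2 * ?q n * v / 2)))) \<longlonglongrightarrow> complex_of_real (exp (- (u\<^sup>2 * (1 + 2 * c + 2 * c\<^sup>2) * v / 2)))"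
    by (intro tendsto_intros sum_wgt_square_tendsto) simp
  ultimately have "(\<lambda>n. char (distr M borel (main_term c n)) u) \<longlonglongrightarrow> complex_of_real (exp (- (u\<^sup>2 * (1 + 2 * c + 2 * c\<^sup>2) * v / 2)))"
    using tendsto_add by fastforce
  then show ?thesis by (simp add: mult_ac)
qed

end

section \<open>Pointwise expansions of the score\<close>

text \<open>
  In the two estimates below, \<open>l\<close>, \<open>d\<close> stand for the bet and its derivative at the true mean,
  \<open>l1\<close>, \<open>d1\<close> for those at distance \<open>D\<close> from it, and \<open>y\<close> for the centred observation.
\<close>

lemma score_expansion:
  fixes l d y \<beta> v b p L \<epsilon> :: real
  assumes l: "l = \<beta> * b + p" and L: "\<bar>l\<bar> \<le> L" "\<bar>d\<bar> \<le> L" "\<bar>\<beta>\<bar> \<le> L" "1 \<le> L" and b: "\<bar>b\<bar> \<le> 1"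
    and y: "\<bar>y\<bar> \<le> 1" "\<bar>y\<^sup>2 - v\<bar> \<le> 1" and v: "\<bar>v\<bar> \<le> 1"
    and pos: "\<epsilon> > 0" "1 + l * y \<ge> \<epsilon>"
  shows "\<bar>(d * y - l) / (1 + l * y) + \<beta> * (y + (1 - \<beta> * v) * b)
      - ((d + \<beta>) * y + \<beta>\<^sup>2 * (b * (y\<^sup>2 - v)))\<bar>
    \<le> (12 * L^3 * (1 + 1 / \<epsilon>)) * (\<bar>p\<bar> + \<bar>d + \<beta>\<bar> * \<bar>b\<bar> + b\<^sup>2)"
proof -
  have D: "1 + l * y > 0" using pos by linarith
  let ?D = "1 + l * y" and ?N = "d * y - l"
  have le1: "\<bar>u * x\<bar> \<le> C" if "\<bar>u\<bar> \<le> C" "\<bar>x\<bar> \<le> 1" "0 \<le> C" for u x C :: real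
    using mult_mono[of "\<bar>u\<bar>" C "\<bar>x\<bar>" 1] that by (simp add: abs_mult)
  have ly: "\<bar>l * y\<bar> \<le> L" "\<bar>d * y\<bar> \<le> L"
    using le1[OF L(1) y(1)] le1[OF L(2) y(1)] L(4) by simp_all
  \<comment> \<open>A crude bound on \<open>p\<close>, obtained from those on \<open>l\<close> and
    \<open>b\<close>; it reduces \<open>p\<^sup>2\<close> to a multiple of the absolute value of
    \<open>p\<close>.\<close>
  have p: "\<bar>p\<bar> \<le> 2 * L\<^sup>2"
  proof -
    have "\<bar>\<beta> * b\<bar> \<le> L * 1" using L(3,4) b unfolding abs_mult by (intro mult_mono) auto
    moreover have "L \<le> L\<^sup>2" using L(4) by (simp add: power2_eq_square)
    moreover have "p = l - \<beta> * b" using l by simp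
    ultimately show ?thesis using L(1) by linarith
  qed
  \<comment> \<open>This is \<open>?N / ?D = ?N - ?N * l * y + ?N * (l * y)\<^sup>2 / ?D\<close>
    with \<open>\<beta> * b + p\<close> substituted for \<open>l\<close> and \<open>d\<close> split
    into \<open>-\<beta>\<close> and \<open>d + \<beta>\<close>. The terms linear in
    \<open>b\<close> with constant coefficient cancel; what remains contains \<open>p\<close>,
    \<open>(d + \<beta>) * l\<close> or \<open>l\<^sup>2\<close>.\<close>
  have eq: "?N / ?D + \<beta> * (y + (1 - \<beta> * v) * b) - ((d + \<beta>) * y + \<beta>\<^sup>2 * (b * (y\<^sup>2 - v)))
      = - p + \<beta> * p * y\<^sup>2 - (d + \<beta>) * l * y\<^sup>2 + l\<^sup>2 * (y + ?N * y\<^sup>2 / ?D)"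
    using D unfolding l by (simp add: divide_simps) algebra
  have t1: "\<bar>- p + \<beta> * p * y\<^sup>2\<bar> \<le> (1 + L) * \<bar>p\<bar>"
  proof -
    have "\<bar>\<beta> * p * y\<^sup>2\<bar> \<le> L * \<bar>p\<bar> * 1"
      unfolding abs_mult using L(3,4) y(1) by (intro mult_mono) (auto simp: abs_square_le_1)
    then show ?thesis by (simp add: algebra_simps)
  qed
  have t2: "\<bar>(d + \<beta>) * l * y\<^sup>2\<bar> \<le> L * (\<bar>d + \<beta>\<bar> * \<bar>b\<bar>) + 2 * L * \<bar>p\<bar>"
  proof -
    have "\<bar>(d + \<beta>) * l * y\<^sup>2\<bar> \<le> \<bar>d + \<beta>\<bar> * (L * \<bar>b\<bar> + \<bar>p\<bar>) * 1"
    proof -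
      have "\<bar>l\<bar> \<le> \<bar>\<beta>\<bar> * \<bar>b\<bar> + \<bar>p\<bar>" unfolding l by (simp add: abs_mult[symmetric] abs_triangle_ineq)
      also have "\<bar>\<beta>\<bar> * \<bar>b\<bar> \<le> L * \<bar>b\<bar>" using L(3) by (intro mult_right_mono) auto
      finally show ?thesis unfolding abs_mult using y by (intro mult_mono) (auto simp: abs_square_le_1)
    qed
    also have "\<dots> = L * (\<bar>d + \<beta>\<bar> * \<bar>b\<bar>) + \<bar>d + \<beta>\<bar> * \<bar>p\<bar>" by (simp add: algebra_simps)
    also have "\<bar>d + \<beta>\<bar> * \<bar>p\<bar> \<le> (2 * L) * \<bar>p\<bar>" using L(2,3) by (intro mult_right_mono) auto
    finally show ?thesis by simp
  qed
  have sq: "l\<^sup>2 \<le> 2 * L\<^sup>2 * b\<^sup>2 + 4 * L\<^sup>2 * \<bar>p\<bar>"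
  proof -
    have "l\<^sup>2 \<le> 2 * (\<beta> * b)\<^sup>2 + 2 * p\<^sup>2"
      unfolding l using zero_le_power2[of "\<beta> * b - p"] by (simp add: power2_sum power2_diff)
    also have "(\<beta> * b)\<^sup>2 \<le> L\<^sup>2 * b\<^sup>2"
      unfolding power_mult_distrib using L(3,4) by (intro mult_right_mono abs_le_square_iff[THEN iffD1]) auto
    also have "p\<^sup>2 \<le> 2 * L\<^sup>2 * \<bar>p\<bar>"
      using mult_right_mono[OF p, of "\<bar>p\<bar>"] by (simp add: power2_eq_square)
    finally show ?thesis by simp
  qed
  have t3: "\<bar>l\<^sup>2 * (y + ?N * y\<^sup>2 / ?D)\<bar> \<le> (2 * L\<^sup>2 * b\<^sup>2 + 4 * L\<^sup>2 * \<bar>p\<bar>) * (2 * L * (1 + 1/\<epsilon>))"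
  proof -
    have "\<bar>?N * y\<^sup>2 / ?D\<bar> \<le> (2 * L) * 1 / \<epsilon>"
    proof -
      have "\<bar>?N\<bar> \<le> 2 * L" using L(1) ly(2) by linarith
      then have "\<bar>?N * y\<^sup>2\<bar> \<le> (2 * L) * 1"
        unfolding abs_mult using y by (intro mult_mono) (simp_all add: abs_square_le_1)
      then show ?thesis unfolding abs_divide using D pos L(4) by (intro frac_le) simp_all
    qed
    then have "\<bar>y + ?N * y\<^sup>2 / ?D\<bar> \<le> 1 + 2 * L / \<epsilon>" using y by linarith
    also have "\<dots> \<le> 2 * L * (1 + 1/\<epsilon>)" using L(4) by (simp add: algebra_simps)
    finally have *: "\<bar>y + ?N * y\<^sup>2 / ?D\<bar> \<le> 2 * L * (1 + 1/\<epsilon>)" .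
    show ?thesis
      unfolding abs_mult using sq * L(4) by (intro mult_mono) auto
  qed
  define E where "E = 1 + 1 / \<epsilon>"
  have E: "E \<ge> 1" using pos by (simp add: E_def)
  have L3: "L \<le> L^3" "1 \<le> L^3"
    using L(4) power_increasing[of 1 3 L] one_le_power[of L 3] by auto
  have LE: "L \<le> L^3 * E" "1 \<le> L^3 * E"
    using mult_mono[of L "L^3" 1 E] mult_mono[of 1 "L^3" 1 E] L3 L(4) E by auto
  define P Q R where "P = \<bar>p\<bar>" and "Q = \<bar>d + \<beta>\<bar> * \<bar>b\<bar>" and "R = b\<^sup>2"
  have nn: "P \<ge> 0" "Q \<ge> 0" "R \<ge> 0" by (auto simp: P_def Q_def R_def)
  have "\<bar>?N / ?D + \<beta> * (y + (1 - \<beta> * v) * b) - ((d + \<beta>) * y + \<beta>\<^sup>2 * (b * (y\<^sup>2 - v)))\<bar>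
      \<le> (1 + L) * P + (L * Q + 2 * L * P) + (2 * L\<^sup>2 * R + 4 * L\<^sup>2 * P) * (2 * L * E)"
    unfolding eq P_def Q_def R_def E_def using t1 t2 t3 by linarith
  \<comment> \<open>The constant 12 is \<open>1 + 3 + 8\<close>, the total coefficient of
    \<open>P\<close> once \<open>1\<close> and \<open>L\<close> are bounded by
    \<open>L^3 * E\<close>.\<close>
  also have "\<dots> = P + 3 * (L * P) + L * Q + 8 * ((L^3 * E) * P) + 4 * ((L^3 * E) * R)"
    by (simp add: algebra_simps power2_eq_square power3_eq_cube)
  also have "\<dots> \<le> 12 * ((L^3 * E) * P) + 12 * ((L^3 * E) * Q) + 12 * ((L^3 * E) * R)"
  proof -
    have "L * P \<le> (L^3 * E) * P" "1 * P \<le> (L^3 * E) * P" "L * Q \<le> (L^3 * E) * Q"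
      using mult_right_mono[OF LE(1) nn(1)] mult_right_mono[OF LE(2) nn(1)] mult_right_mono[OF LE(1) nn(2)]
      by auto
    moreover have "0 \<le> (L^3 * E) * Q" "0 \<le> (L^3 * E) * R" using LE nn by auto
    ultimately show ?thesis by linarith
  qed
  also have "\<dots> = 12 * L^3 * E * (P + Q + R)" by (simp add: algebra_simps)
  finally show ?thesis by (simp add: P_def Q_def R_def E_def)
qed

text \<open>With \<open>N\<close> for the numerator and \<open>E\<close> for the denominator of the
  score, \<open>E\<close> grows by about \<open>N * D\<close>, and \<open>N\<close> by about
  \<open>(d1 - d) * y - 2 * d * D\<close>. For \<open>E\<close> near 1 and \<open>N\<close> near
  \<open>-\<beta> * y\<close> the quotient therefore grows by the stated main term. The difference
  \<open>d1 - d\<close> is left unexpanded, so that no second derivative of the bet appears. Every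
  error carries \<open>D\<close> together with a further small factor, which later makes it
  negligible relative to the drift.\<close>

lemma score_increment:
  fixes l d l1 d1 y D \<beta> L \<epsilon> :: real
  assumes L: "\<bar>l\<bar> \<le> L" "\<bar>d\<bar> \<le> L" "\<bar>d1\<bar> \<le> L" "\<bar>l1\<bar> \<le> L" "\<bar>\<beta>\<bar> \<le> L" "1 \<le> L"
    and lip: "\<bar>d1 - d\<bar> \<le> L * \<bar>D\<bar>" "\<bar>l1 - l\<bar> \<le> L * \<bar>D\<bar>" "\<bar>l1 - l - d * D\<bar> \<le> L * D\<^sup>2"
    and y: "\<bar>y\<bar> \<le> 1" "\<bar>y - D\<bar> \<le> 1"
    and pos: "\<epsilon> > 0" "1 + l * y \<ge> \<epsilon>" "1 + l1 * (y - D) \<ge> \<epsilon>"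
  shows "\<bar>(d1 * (y - D) - l1) / (1 + l1 * (y - D)) - (d * y - l) / (1 + l * y)
      - ((d1 - d) * y + 2 * \<beta> * D - \<beta>\<^sup>2 * y\<^sup>2 * D)\<bar>
    \<le> 40 * L^3 * (1 + 1/\<epsilon> + 1/\<epsilon>\<^sup>2) * \<bar>D\<bar> * (\<bar>l\<bar> + \<bar>d + \<beta>\<bar> + \<bar>D\<bar>)"
proof -
  define N N1 E E1 where "N = d * y - l" and "N1 = d1 * (y - D) - l1"
    and "E = 1 + l * y" and "E1 = 1 + l1 * (y - D)"
  define a where "a = \<bar>D\<bar>"
  have a: "a \<ge> 0" "D\<^sup>2 = a\<^sup>2" by (auto simp: a_def)
  have E: "E \<ge> \<epsilon>" "E1 \<ge> \<epsilon>" "E > 0" "E1 > 0" using pos by (auto simp: E_def E1_def)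
  have le1: "\<bar>u * x\<bar> \<le> K" if "\<bar>u\<bar> \<le> K" "\<bar>x\<bar> \<le> 1" "0 \<le> K" for u x K :: real
    using mult_mono[of "\<bar>u\<bar>" K "\<bar>x\<bar>" 1] that by (simp add: abs_mult)
  have leD: "\<bar>u * D\<bar> \<le> K * a" if "\<bar>u\<bar> \<le> K" for u K :: real
    using mult_right_mono[OF that, of "\<bar>D\<bar>"] by (simp add: abs_mult a_def)
  have N: "\<bar>N\<bar> \<le> 2 * L"
    using le1[OF L(2) y(1)] L(1) unfolding N_def by linarith
  have N1: "\<bar>N1\<bar> \<le> 2 * L"
    using le1[OF L(3) y(2)] L(4) unfolding N1_def by linarith
  have sq: "u * a * a = u * a\<^sup>2" for u by (simp add: power2_eq_square)
  have dD: "\<bar>(d1 - d) * D\<bar> \<le> L * a\<^sup>2"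
    using leD[OF lip(1)] unfolding a_def[symmetric] sq .
  have lD: "\<bar>(l1 - l) * D\<bar> \<le> L * a\<^sup>2"
    using leD[OF lip(2)] unfolding a_def[symmetric] sq .
  have ly: "\<bar>(l1 - l - d * D) * y\<bar> \<le> L * a\<^sup>2"
    using le1[OF lip(3) y(1)] L(6) a by simp
  have dN: "\<bar>N1 - N - ((d1 - d) * y - 2 * d * D)\<bar> \<le> 2 * L * a\<^sup>2"
  proof -
    have "N1 - N - ((d1 - d) * y - 2 * d * D) = - ((d1 - d) * D) - (l1 - l - d * D)"
      by (simp add: N_def N1_def algebra_simps)
    then show ?thesis using dD lip(3)[unfolded a(2)] by linarith
  qed
  have dN': "\<bar>N1 - N\<bar> \<le> 3 * L * a"
  proof -
    have "N1 - N = (d1 - d) * y - d1 * D - (l1 - l)"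
      by (simp add: N_def N1_def algebra_simps)
    moreover have "\<bar>(d1 - d) * y\<bar> \<le> L * a" using le1[OF lip(1) y(1)] L(6) by (simp add: a_def)
    ultimately show ?thesis using leD[OF L(3)] lip(2) unfolding a_def by linarith
  qed
  have dE: "\<bar>E1 - E - N * D\<bar> \<le> 2 * L * a\<^sup>2"
  proof -
    have "E1 - E - N * D = (l1 - l - d * D) * y - (l1 - l) * D"
      by (simp add: N_def E_def E1_def algebra_simps)
    then show ?thesis using ly lD by linarith
  qed
  have dE': "\<bar>E1 - E\<bar> \<le> 2 * L * a"
  proof -
    have "E1 - E = (l1 - l) * y - l1 * D"
      by (simp add: E_def E1_def algebra_simps)
    moreover have "\<bar>(l1 - l) * y\<bar> \<le> L * a" using le1[OF lip(2) y(1)] L(6) by (simp add: a_def)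
    ultimately show ?thesis using leD[OF L(4)] by linarith
  qed
  have E1le: "\<bar>E1\<bar> \<le> 2 * L" using le1[OF L(4) y(2)] L(6) unfolding E1_def by linarith
  have ly': "\<bar>l * y\<bar> \<le> \<bar>l\<bar>" using mult_left_mono[OF y(1), of "\<bar>l\<bar>"] by (simp add: abs_mult)
  \<comment> \<open>Allows \<open>N\<^sup>2 * D / (E * E1)\<close> to be replaced by
    \<open>N\<^sup>2 * D\<close>.\<close>
  have EE: "\<bar>E * E1 - 1\<bar> \<le> 3 * L * \<bar>l\<bar> + 2 * L * a"
  proof -
    have "E * E1 - 1 = (l * y) * E1 + (l * y) + (E1 - E)" by (simp add: E_def algebra_simps)
    moreover have "\<bar>(l * y) * E1\<bar> \<le> \<bar>l\<bar> * (2 * L)"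
      unfolding abs_mult[of "l * y"] using ly' E1le by (intro mult_mono) auto
    moreover have "1 * \<bar>l\<bar> \<le> L * \<bar>l\<bar>" using L(6) by (intro mult_right_mono) auto
    ultimately show ?thesis using ly' dE' by (simp add: algebra_simps)
  qed
  \<comment> \<open>An exact identity whose five groups are bounded by \<open>b1\<close> to
    \<open>b5\<close>: each is quadratic in \<open>D\<close> or contains \<open>D\<close> together
    with \<open>l\<close> or \<open>d + \<beta>\<close>.\<close>
  have main: "N1 / E1 - N / E - ((d1 - d) * y + 2 * \<beta> * D - \<beta>\<^sup>2 * y\<^sup>2 * D) =
      (N1 - N - ((d1 - d) * y - 2 * d * D)) - 2 * ((d + \<beta>) * D)
      - (N1 - N) * (l * y) / E
      - ((N1 - N) * (E1 - E) + N * (E1 - E - N * D) - N\<^sup>2 * D * (E * E1 - 1)) / (E * E1)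
      - (N\<^sup>2 - \<beta>\<^sup>2 * y\<^sup>2) * D"
  proof -
    have 1: "N1 / E1 - N / E = (N1 - N) / E - N1 * (E1 - E) / (E * E1)"
      using E by (simp add: field_simps)
    have 2: "(N1 - N) / E = (N1 - N) - (N1 - N) * (l * y) / E"
      using E by (simp add: field_simps E_def)
    have 3: "N1 * (E1 - E) / (E * E1) = N\<^sup>2 * D +
        ((N1 - N) * (E1 - E) + N * (E1 - E - N * D) - N\<^sup>2 * D * (E * E1 - 1)) / (E * E1)"
      using E by (simp add: field_simps power2_eq_square)
    show ?thesis unfolding 1 2 3 by (simp add: algebra_simps)
  qed
  define e where "e = 1 + 1/\<epsilon> + 1/\<epsilon>\<^sup>2"
  have e: "e \<ge> 1" "1/\<epsilon> \<le> e" "1/\<epsilon>\<^sup>2 \<le> e" using pos by (auto simp: e_def)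
  define W where "W = L^3 * e"
  have Lp: "L \<le> L^3" "L\<^sup>2 \<le> L^3" "0 \<le> L^3"
    using L(6) power_increasing[of 1 3 L] power_increasing[of 2 3 L] by auto
  have Wmono: "x * z \<le> W" if "x \<le> L^3" "z \<le> e" "0 \<le> z" for x z
    unfolding W_def by (rule mult_mono[OF that(1,2) Lp(3) that(3)])
  have inv: "0 \<le> 1/\<epsilon>" "0 \<le> 1/\<epsilon>\<^sup>2" using pos(1) by simp_all
  have W: "L \<le> W" "0 \<le> W" "L\<^sup>2 * (1/\<epsilon>\<^sup>2) \<le> W" "L^3 * (1/\<epsilon>\<^sup>2) \<le> W" "L * (1/\<epsilon>) \<le> W"
    using Wmono[OF Lp(1) e(1)] Wmono[OF Lp(3), of 0] Wmono[OF Lp(2) e(3) inv(2)]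
      Wmono[OF order.refl e(3) inv(2)] Wmono[OF Lp(1) e(2) inv(1)] e(1) by simp_all
  define c where "c = \<bar>l\<bar>"
  define q where "q = \<bar>d + \<beta>\<bar>"
  have nn: "c \<ge> 0" "q \<ge> 0" by (auto simp: c_def q_def)
  have b1: "\<bar>N1 - N - ((d1 - d) * y - 2 * d * D)\<bar> \<le> 2 * (W * a\<^sup>2)"
    using dN mult_right_mono[OF W(1), of "a\<^sup>2"] by simp
  have b2: "\<bar>2 * ((d + \<beta>) * D)\<bar> \<le> 2 * (W * (q * a))"
  proof -
    have "1 * (q * a) \<le> W * (q * a)" using W(1) L(6) nn a by (intro mult_right_mono) auto
    then show ?thesis by (simp add: abs_mult a_def q_def)
  qed
  have b3: "\<bar>(N1 - N) * (l * y) / E\<bar> \<le> 3 * (W * (c * a))"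
  proof -
    have "\<bar>(N1 - N) * (l * y) / E\<bar> \<le> (3 * L * a) * c / \<epsilon>"
      unfolding abs_divide abs_mult[of "N1 - N"] c_def
      using dN' ly' E pos(1) L(6) a by (intro frac_le mult_mono) auto
    also have "\<dots> = 3 * ((L * (1/\<epsilon>)) * (c * a))" by simp
    also have "\<dots> \<le> 3 * (W * (c * a))"
      using W nn a by (intro mult_left_mono mult_right_mono) auto
    finally show ?thesis .
  qed
  have b4: "\<bar>((N1 - N) * (E1 - E) + N * (E1 - E - N * D) - N\<^sup>2 * D * (E * E1 - 1)) / (E * E1)\<bar>
      \<le> 18 * (W * a\<^sup>2) + 12 * (W * (c * a))"
  proof -
    have x1: "\<bar>(N1 - N) * (E1 - E)\<bar> \<le> (3 * L * a) * (2 * L * a)"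
      unfolding abs_mult using dN' dE' L(6) a by (intro mult_mono) auto
    have x2: "\<bar>N * (E1 - E - N * D)\<bar> \<le> (2 * L) * (2 * L * a\<^sup>2)"
      unfolding abs_mult[of N] using N dE L(6) a by (intro mult_mono) auto
    have "\<bar>N\<^sup>2\<bar> \<le> (2 * L)\<^sup>2" using power_mono[OF N, of 2] by simp
    then have x3: "\<bar>N\<^sup>2 * D * (E * E1 - 1)\<bar> \<le> (2 * L)\<^sup>2 * a * (3 * L * c + 2 * L * a)"
      unfolding abs_mult a_def[symmetric] c_def
      using EE L(6) a unfolding abs_mult[symmetric] by (intro mult_mono) (auto simp: a_def abs_mult)
    have "\<bar>(N1 - N) * (E1 - E) + N * (E1 - E - N * D) - N\<^sup>2 * D * (E * E1 - 1)\<bar>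
        \<le> 10 * L\<^sup>2 * a\<^sup>2 + 12 * L^3 * (c * a) + 8 * L^3 * a\<^sup>2"
      using x1 x2 x3 by (simp add: algebra_simps power2_eq_square power3_eq_cube)
    moreover have "\<epsilon>\<^sup>2 \<le> \<bar>E * E1\<bar>"
      using mult_mono[OF E(1,2)] E pos by (simp add: power2_eq_square abs_mult)
    ultimately have "\<bar>((N1 - N) * (E1 - E) + N * (E1 - E - N * D) - N\<^sup>2 * D * (E * E1 - 1)) / (E * E1)\<bar>
       \<le> (10 * L\<^sup>2 * a\<^sup>2 + 12 * L^3 * (c * a) + 8 * L^3 * a\<^sup>2) / \<epsilon>\<^sup>2"
      unfolding abs_divide using pos(1) L(6) a nn by (intro frac_le) auto
    also have "\<dots> = 10 * ((L\<^sup>2 * (1/\<epsilon>\<^sup>2)) * a\<^sup>2) + 12 * ((L^3 * (1/\<epsilon>\<^sup>2)) * (c * a)) + 8 * ((L^3 * (1/\<epsilon>\<^sup>2)) * a\<^sup>2)"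
      by (simp add: add_divide_distrib)
    also have "\<dots> \<le> 10 * (W * a\<^sup>2) + 12 * (W * (c * a)) + 8 * (W * a\<^sup>2)"
      using W nn a by (intro add_mono mult_left_mono mult_right_mono) auto
    finally show ?thesis by simp
  qed
  have b5: "\<bar>(N\<^sup>2 - \<beta>\<^sup>2 * y\<^sup>2) * D\<bar> \<le> 3 * (W * (c * a)) + 2 * (W * (q * a))"
  proof -
    have "\<bar>N + d * y\<bar> \<le> 3 * L" using N le1[OF L(2) y(1)] L(6) by linarith
    then have "\<bar>l * (N + d * y)\<bar> \<le> c * (3 * L)"
      unfolding abs_mult[of l] c_def by (rule mult_left_mono) simp
    moreover have "\<bar>(d + \<beta>) * (d - \<beta>)\<bar> \<le> q * (2 * L)"
      unfolding abs_mult q_def using L(2,5) by (intro mult_mono) auto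
    then have "\<bar>(d + \<beta>) * (d - \<beta>) * y\<^sup>2\<bar> \<le> q * (2 * L)"
    proof (rule le1)
      show "\<bar>y\<^sup>2\<bar> \<le> 1" using y(1) by (simp add: abs_square_le_1)
      show "0 \<le> q * (2 * L)" using nn L(6) by simp
    qed
    moreover have "N\<^sup>2 - \<beta>\<^sup>2 * y\<^sup>2 = - (l * (N + d * y)) + (d + \<beta>) * (d - \<beta>) * y\<^sup>2"
      by (simp add: N_def algebra_simps power2_eq_square)
    ultimately have "\<bar>N\<^sup>2 - \<beta>\<^sup>2 * y\<^sup>2\<bar> \<le> c * (3 * L) + q * (2 * L)" by linarith
    from leD[OF this] have "\<bar>(N\<^sup>2 - \<beta>\<^sup>2 * y\<^sup>2) * D\<bar> \<le> 3 * (L * (c * a)) + 2 * (L * (q * a))"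
      by (simp add: algebra_simps)
    also have "\<dots> \<le> 3 * (W * (c * a)) + 2 * (W * (q * a))"
      using W nn a by (intro add_mono mult_left_mono mult_right_mono) auto
    finally show ?thesis .
  qed
  have nnW: "0 \<le> W * (c * a)" "0 \<le> W * (q * a)" "0 \<le> W * a\<^sup>2" using W nn a by auto
  \<comment> \<open>The coefficients of the three products add up to 18, 4 and 20; 40 is a round
    common bound.\<close>
  have "\<bar>N1 / E1 - N / E - ((d1 - d) * y + 2 * \<beta> * D - \<beta>\<^sup>2 * y\<^sup>2 * D)\<bar>
      \<le> 40 * (W * (c * a)) + 40 * (W * (q * a)) + 40 * (W * a\<^sup>2)"
    unfolding main using b1 b2 b3 b4 b5 nnW by linarith
  also have "\<dots> = 40 * W * a * (c + q + a)" by (simp add: algebra_simps power2_eq_square)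
  finally show ?thesis
    by (simp add: N_def N1_def E_def E1_def W_def e_def a_def c_def q_def mult.assoc)
qed

section \<open>Betting strategies\<close>

text \<open>A Toeplitz lemma: a finite initial segment is killed by \<open>g\<close>, and the tail
  is a small multiple of the total weight. It serves two normalisations, constant weights with
  \<open>n\<close> and weights \<open>1 / sqrt t\<close> with \<open>sqrt n\<close>.\<close>

lemma weighted_mean_tendsto_zero:
  fixes x w g :: "nat \<Rightarrow> real"
  assumes x: "x \<longlonglongrightarrow> 0" and w: "\<And>t. 0 \<le> w t" and g: "filterlim g at_top sequentially"
    and le: "\<And>n. (\<Sum>t=1..n. w t) \<le> C * g n"
  shows "(\<lambda>n. (\<Sum>t=1..n. w t * x t) / g n) \<longlonglongrightarrow> 0"
proof (rule LIMSEQ_I)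
  fix e :: real assume e: "e > 0"
  define C' where "C' = \<bar>C\<bar> + 1"
  have C': "C' > 0" "C \<le> C'" by (auto simp: C'_def)
  define \<eta> where "\<eta> = e / (2 * C')"
  have \<eta>: "\<eta> > 0" "\<eta> * C' = e / 2" using e C' by (auto simp: \<eta>_def)
  from LIMSEQ_D[OF x \<eta>(1)] obtain N where N: "\<And>t. t \<ge> N \<Longrightarrow> \<bar>x t\<bar> < \<eta>" by auto
  define B where "B = (\<Sum>t=1..N. w t * \<bar>x t\<bar>)"
  have B: "B \<ge> 0" by (auto simp: B_def intro!: sum_nonneg mult_nonneg_nonneg w)
  have *: "\<bar>\<Sum>t=1..n. w t * x t\<bar> \<le> B + \<eta> * (\<Sum>t=1..n. w t)" for n
  proof -
    have "\<bar>\<Sum>t=1..n. w t * x t\<bar> \<le> (\<Sum>t=1..n. w t * \<bar>x t\<bar>)"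
      using sum_abs[of "\<lambda>t. w t * x t" "{1..n}"] w by (simp add: abs_mult)
    also have "\<dots> \<le> (\<Sum>t=1..n. (if t \<le> N then w t * \<bar>x t\<bar> else 0) + \<eta> * w t)"
    proof (rule sum_mono)
      fix t show "w t * \<bar>x t\<bar> \<le> (if t \<le> N then w t * \<bar>x t\<bar> else 0) + \<eta> * w t"
        using N[of t] w[of t] \<eta> mult_left_mono[of "\<bar>x t\<bar>" \<eta> "w t"] by (auto simp: mult.commute)
    qed
    also have "\<dots> = (\<Sum>t=1..n. if t \<le> N then w t * \<bar>x t\<bar> else 0) + \<eta> * (\<Sum>t=1..n. w t)"
      by (simp add: sum.distrib sum_distrib_left)
    also have "(\<Sum>t=1..n. if t \<le> N then w t * \<bar>x t\<bar> else 0) = (\<Sum>t\<in>{1..n} \<inter> {..N}. w t * \<bar>x t\<bar>)"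
      by (simp only: sum.inter_restrict finite_atLeastAtMost atMost_iff)
    also have "\<dots> \<le> B"
      unfolding B_def by (intro sum_mono2) (auto simp: w)
    finally show ?thesis by simp
  qed
  have "\<forall>\<^sub>F n in sequentially. g n > 2 * B / e \<and> g n > 0"
    using g unfolding filterlim_at_top_dense by (auto intro: eventually_conj)
  then obtain M where M: "\<And>n. n \<ge> M \<Longrightarrow> g n > 2 * B / e \<and> g n > 0"
    unfolding eventually_sequentially by blast
  show "\<exists>no. \<forall>n\<ge>no. norm ((\<Sum>t=1..n. w t * x t) / g n - 0) < e"
  proof (intro exI allI impI)
    fix n assume "n \<ge> M"
    then have gn: "g n > 2 * B / e" "g n > 0" using M by auto
    have "\<bar>\<Sum>t=1..n. w t * x t\<bar> \<le> B + \<eta> * (C * g n)"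
      using *[of n] mult_left_mono[OF le[of n] less_imp_le[OF \<eta>(1)]] by linarith
    also have "\<eta> * (C * g n) \<le> \<eta> * (C' * g n)"
      using \<eta> C' gn by (intro mult_left_mono mult_right_mono) auto
    also have "\<eta> * (C' * g n) = e / 2 * g n" using \<eta>(2) by (simp add: mult.assoc[symmetric])
    finally have "\<bar>\<Sum>t=1..n. w t * x t\<bar> < e * g n" using gn e by (simp add: field_simps)
    then show "norm ((\<Sum>t=1..n. w t * x t) / g n - 0) < e" using gn by (simp add: field_simps)
  qed
qed

lemma cesaro_zero:
  fixes x :: "nat \<Rightarrow> real"
  assumes "x \<longlonglongrightarrow> 0" shows "(\<lambda>n. (\<Sum>t=1..n. x t) / real n) \<longlonglongrightarrow> 0"
  using weighted_mean_tendsto_zero[OF assms, of "\<lambda>_. 1" real 1] filterlim_real_sequentially by simp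

text \<open>Telescoping: consecutive roots \<open>a < b\<close> satisfy
  \<open>1 = (b - a) (b + a) \<le> 2 b (b - a)\<close>.\<close>

lemma sum_inverse_sqrt_le: "(\<Sum>t=1..n. 1 / sqrt (real t)) \<le> 2 * sqrt (real n)"
proof (induction n)
  case (Suc n)
  have "1 / sqrt (real (Suc n)) \<le> 2 * (sqrt (real (Suc n)) - sqrt (real n))"
  proof -
    define a b where "a = sqrt (real n)" and "b = sqrt (real (Suc n))"
    have ab: "a\<^sup>2 = real n" "b\<^sup>2 = real n + 1" "a \<ge> 0" "b > 0" by (auto simp: a_def b_def)
    have "0 \<le> (b - a)\<^sup>2" by simp
    moreover have "2 * (b - a) * b = 2 * b\<^sup>2 - 2 * a * b" by (simp add: algebra_simps power2_eq_square)
    ultimately have "1 \<le> 2 * (b - a) * b" using ab(1,2) unfolding power2_diff by (simp add: mult.commute mult.left_commute)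
    then show ?thesis using ab(4) unfolding a_def[symmetric] b_def[symmetric] by (simp add: divide_le_eq)
  qed
  with Suc show ?case by simp
qed simp

lemma sqrt_weighted_zero:
  fixes x :: "nat \<Rightarrow> real"
  assumes "x \<longlonglongrightarrow> 0" shows "(\<lambda>n. (\<Sum>t=1..n. x t / sqrt (real t)) / sqrt (real n)) \<longlonglongrightarrow> 0"
  using weighted_mean_tendsto_zero[OF assms, of "\<lambda>t. 1 / sqrt (real t)" "\<lambda>n. sqrt (real n)" 2]
    sum_inverse_sqrt_le filterlim_compose[OF sqrt_at_top filterlim_real_sequentially] by simp

text \<open>The expectation of \<open>(x * \<bar>f \<omega>\<bar> - \<bar>g
  \<omega>\<bar>)\<^sup>2\<close> is a nonnegative quadratic polynomial in \<open>x\<close>,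
  evaluated at its minimiser \<open>E / A\<close> when \<open>A\<close> is positive.\<close>

lemma (in prob_space) cauchy_schwarz_expectation:
  fixes f g :: "'a \<Rightarrow> real"
  assumes m[measurable]: "f \<in> borel_measurable M" "g \<in> borel_measurable M"
    and i: "integrable M (\<lambda>\<omega>. (f \<omega>)\<^sup>2)" "integrable M (\<lambda>\<omega>. (g \<omega>)\<^sup>2)"
  shows "integrable M (\<lambda>\<omega>. \<bar>f \<omega>\<bar> * \<bar>g \<omega>\<bar>)"
    "expectation (\<lambda>\<omega>. \<bar>f \<omega>\<bar> * \<bar>g \<omega>\<bar>) \<le> sqrt (expectation (\<lambda>\<omega>. (f \<omega>)\<^sup>2)) * sqrt (expectation (\<lambda>\<omega>. (g \<omega>)\<^sup>2))"
proof -
  define A B E where "A = expectation (\<lambda>\<omega>. (f \<omega>)\<^sup>2)" and "B = expectation (\<lambda>\<omega>. (g \<omega>)\<^sup>2)"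
    and "E = expectation (\<lambda>\<omega>. \<bar>f \<omega>\<bar> * \<bar>g \<omega>\<bar>)"
  have amgm: "a * b \<le> a\<^sup>2 + b\<^sup>2" if "a \<ge> 0" "b \<ge> 0" for a b :: real
    using zero_le_power2[of "a - b"] mult_nonneg_nonneg[OF that] unfolding power2_diff by linarith
  show int: "integrable M (\<lambda>\<omega>. \<bar>f \<omega>\<bar> * \<bar>g \<omega>\<bar>)"
    by (rule Bochner_Integration.integrable_bound[OF Bochner_Integration.integrable_add[OF i]])
       (use amgm[of "\<bar>f _\<bar>" "\<bar>g _\<bar>"] in \<open>auto simp: abs_mult\<close>)
  have nn: "A \<ge> 0" "B \<ge> 0" "E \<ge> 0" by (auto simp: A_def B_def E_def)
  have quad: "0 \<le> x\<^sup>2 * A - 2 * x * E + B" for x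
  proof -
    have "0 \<le> expectation (\<lambda>\<omega>. (x * \<bar>f \<omega>\<bar> - \<bar>g \<omega>\<bar>)\<^sup>2)" by simp
    also have "(\<lambda>\<omega>. (x * \<bar>f \<omega>\<bar> - \<bar>g \<omega>\<bar>)\<^sup>2) = (\<lambda>\<omega>. x\<^sup>2 * (f \<omega>)\<^sup>2 - 2 * x * (\<bar>f \<omega>\<bar> * \<bar>g \<omega>\<bar>) + (g \<omega>)\<^sup>2)"
      by (auto simp: power2_diff power_mult_distrib)
    also have "expectation \<dots> = x\<^sup>2 * A - 2 * x * E + B"
      using i int by (simp add: A_def B_def E_def)
    finally show ?thesis .
  qed
  have "E\<^sup>2 \<le> A * B"
  proof (cases "A = 0")
    case True
    have "E = 0"
    proof (rule ccontr)
      assume "E \<noteq> 0"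
      then have "E > 0" using nn by simp
      \<comment> \<open>For \<open>A = 0\<close> the polynomial is linear, and at this point it
        takes the value -1.\<close>
      with quad[of "(B + 1) / (2 * E)"] True nn show False by simp
    qed
    then show ?thesis using nn by simp
  next
    case False
    then have "A > 0" using nn by simp
    have "(E / A)\<^sup>2 * A = E\<^sup>2 / A" using \<open>A > 0\<close> by (simp add: power2_eq_square)
    then have "E\<^sup>2 / A \<le> B" using quad[of "E / A"] by (simp add: power2_eq_square)
    then show ?thesis using \<open>A > 0\<close> by (simp add: field_simps)
  qed
  then have "E \<le> sqrt (A * B)" by (rule real_le_rsqrt)
  then show "expectation (\<lambda>\<omega>. \<bar>f \<omega>\<bar> * \<bar>g \<omega>\<bar>) \<le> sqrt (expectation (\<lambda>\<omega>. (f \<omega>)\<^sup>2)) * sqrt (expectation (\<lambda>\<omega>. (g \<omega>)\<^sup>2))"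
    by (simp add: A_def B_def E_def real_sqrt_mult)
qed

lemma (in prob_space) expectation_abs_le_sqrt:
  fixes f :: "'a \<Rightarrow> real"
  assumes "f \<in> borel_measurable M" "integrable M (\<lambda>\<omega>. (f \<omega>)\<^sup>2)"
  shows "integrable M f" "expectation (\<lambda>\<omega>. \<bar>f \<omega>\<bar>) \<le> sqrt (expectation (\<lambda>\<omega>. (f \<omega>)\<^sup>2))"
proof -
  note * = cauchy_schwarz_expectation[OF assms(1) _ assms(2), of "\<lambda>_. 1"]
  show "integrable M f" using *(1) assms(1) by (simp add: integrable_abs_iff)
  show "expectation (\<lambda>\<omega>. \<bar>f \<omega>\<bar>) \<le> sqrt (expectation (\<lambda>\<omega>. (f \<omega>)\<^sup>2))"
    using *(2) by (simp add: prob_space)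
qed

locale me_setting = bounded_iid M X \<theta>s "\<sigma>\<^sup>2" for M :: "'a measure" and X \<theta>s and \<sigma> :: real +
  fixes lam :: "nat \<Rightarrow> real \<Rightarrow> 'a \<Rightarrow> real" and est r :: "nat \<Rightarrow> 'a \<Rightarrow> real"
    and \<Theta>\<^sub>0 :: "real set" and \<beta> L \<epsilon> :: real
  assumes var_pos: "\<sigma>\<^sup>2 > 0"
    and strategy: "betting_strategy M X lam"
    and smooth: "\<And>t. t \<ge> 1 \<Longrightarrow> AE \<omega> in M. C2_on (\<lambda>\<theta>. lam t \<theta> \<omega>) {0<..<1}"
    and estimator: "ME_estimator M X lam est"
    and consistent: "tendsto_in_prob M est \<theta>s"
    and beta_pos: "\<beta> > 0"
    and A1_deriv: "tendsto_L2 M (\<lambda>t \<omega>. deriv (\<lambda>\<theta>. lam t \<theta> \<omega>) \<theta>s) (- \<beta>)"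
    and A2_expansion: "\<And>t \<omega>. t \<ge> 1 \<Longrightarrow> \<omega> \<in> space M \<Longrightarrow>
          lam t \<theta>s \<omega> = \<beta> * (prev_mean X \<theta>s t \<omega> - \<theta>s) + r t \<omega>"
    and A2_residual: "tendsto_in_prob M (\<lambda>n \<omega>. (\<Sum>t=1..n. \<bar>r t \<omega>\<bar>) / sqrt (real n)) 0"
    and A3_nbhd: "open \<Theta>\<^sub>0" "\<theta>s \<in> \<Theta>\<^sub>0" "\<Theta>\<^sub>0 \<subseteq> {0<..<1}"
    and A3_bound: "\<And>t. t \<ge> 1 \<Longrightarrow> AE \<omega> in M. \<forall>\<theta>\<in>\<Theta>\<^sub>0.
          \<bar>lam t \<theta> \<omega>\<bar> + \<bar>deriv (\<lambda>\<theta>. lam t \<theta> \<omega>) \<theta>\<bar>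
            + \<bar>deriv (deriv (\<lambda>\<theta>. lam t \<theta> \<omega>)) \<theta>\<bar> \<le> L"
    and A3_away: "\<epsilon> > 0"
          "\<And>t. t \<ge> 1 \<Longrightarrow> AE \<omega> in M. \<forall>\<theta>\<in>\<Theta>\<^sub>0. 1 + lam t \<theta> \<omega> * (X t \<omega> - \<theta>) \<ge> \<epsilon>"
begin

section \<open>Predictability and regularity of the bets near the true mean\<close>

lemma lam_hist:
  assumes "t \<ge> 1" "\<theta> \<in> {0..1}" shows "lam t \<theta> \<in> borel_measurable (hist t)"
proof -
  from strategy assms obtain g where g: "g \<in> borel_measurable (PiM {1..<t} (\<lambda>_. borel))"
    "\<And>\<omega>. \<omega> \<in> space M \<Longrightarrow> lam t \<theta> \<omega> = g (\<lambda>i\<in>{1..<t}. X i \<omega>)"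
    unfolding betting_strategy_def by blast
  have "(\<lambda>\<omega>. g (\<lambda>i\<in>{1..<t}. X i \<omega>)) \<in> borel_measurable (hist t)"
    by (rule measurable_compose[OF hist_vector_measurable g(1)])
  then show ?thesis by (subst measurable_cong[OF g(2)]) auto
qed

definition K :: real where "K = max 1 (max L \<beta>)"

lemma K_ge: "1 \<le> K" "L \<le> K" "\<beta> \<le> K" "\<bar>\<beta>\<bar> \<le> K" "0 \<le> K"
  using beta_pos by (auto simp: K_def)

text \<open>A version of the derivative of the bet that is everywhere predictable and bounded.\<close>

definition dl :: "nat \<Rightarrow> real \<Rightarrow> 'a \<Rightarrow> real" where
  "dl t \<theta> \<omega> = max (- K) (min K (lim (\<lambda>k. (lam t (\<theta> + (1 - \<theta>) / real (Suc k)) \<omega> - lam t \<theta> \<omega>)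
     / ((1 - \<theta>) / real (Suc k)))))"

text \<open>The nodes of the difference quotients lie in \<open>{0..1}\<close>, where the bets are
  predictable. Limit and truncation preserve measurability whether or not the quotients
  converge.\<close>

lemma dl_hist:
  assumes "t \<ge> 1" "0 \<le> \<theta>" "\<theta> < 1" shows "dl t \<theta> \<in> borel_measurable (hist t)"
proof -
  have "\<theta> + (1 - \<theta>) / real (Suc k) \<in> {0..1}" for k
    using assms mult_left_mono[of 1 "real (Suc k)" "1 - \<theta>"] by (auto simp: field_simps)
  then have [measurable]: "lam t (\<theta> + (1 - \<theta>) / real (Suc k)) \<in> borel_measurable (hist t)"
    "lam t \<theta> \<in> borel_measurable (hist t)" for k
    using lam_hist assms by auto
  show ?thesis unfolding dl_def[abs_def] by measurable
qed

lemma dl_measurable: "t \<ge> 1 \<Longrightarrow> 0 \<le> \<theta> \<Longrightarrow> \<theta> < 1 \<Longrightarrow> dl t \<theta> \<in> borel_measurable M"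
  by (rule measurable_from_hist[OF dl_hist])

lemma dl_le: "\<bar>dl t \<theta> \<omega>\<bar> \<le> K"
  using K_ge by (auto simp: dl_def)

text \<open>Collects the almost sure regularity at one time into a property of the outcome. As times
  are countable, a single null set is discarded, and all estimates on the remaining outcomes are
  deterministic and valid for all \<open>\<theta>\<close> at once.\<close>

definition good :: "nat \<Rightarrow> 'a \<Rightarrow> bool" where
  "good t \<omega> \<longleftrightarrow> \<omega> \<in> space M \<and> C2_on (\<lambda>\<theta>. lam t \<theta> \<omega>) {0<..<1} \<and>
     (\<forall>\<theta>\<in>\<Theta>\<^sub>0. \<bar>lam t \<theta> \<omega>\<bar> + \<bar>deriv (\<lambda>\<theta>. lam t \<theta> \<omega>) \<theta>\<bar>
            + \<bar>deriv (deriv (\<lambda>\<theta>. lam t \<theta> \<omega>)) \<theta>\<bar> \<le> L) \<and>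
     (\<forall>\<theta>\<in>\<Theta>\<^sub>0. 1 + lam t \<theta> \<omega> * (X t \<omega> - \<theta>) \<ge> \<epsilon>)"

lemma AE_good: "AE \<omega> in M. \<forall>t\<ge>1. good t \<omega>"
  unfolding AE_all_countable
proof (intro allI)
  fix t show "AE \<omega> in M. 1 \<le> t \<longrightarrow> good t \<omega>"
  proof (cases "t \<ge> 1")
    case True
    show ?thesis
      using AE_space smooth[OF True] A3_bound[OF True] A3_away(2)[OF True]
      by eventually_elim (simp add: good_def)
  qed simp
qed

text \<open>On a good outcome the difference quotients converge to the derivative, which is at most
  \<open>L \<le> K\<close> in absolute value, so the truncation in \<open>dl\<close> is
  inactive.\<close>

lemma good_deriv:
  assumes g: "good t \<omega>" and \<theta>: "\<theta> \<in> \<Theta>\<^sub>0"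
  shows "((\<lambda>\<theta>. lam t \<theta> \<omega>) has_real_derivative dl t \<theta> \<omega>) (at \<theta>)"
    "deriv (\<lambda>\<theta>. lam t \<theta> \<omega>) \<theta> = dl t \<theta> \<omega>"
proof -
  let ?f = "\<lambda>\<theta>. lam t \<theta> \<omega>"
  have \<theta>1: "\<theta> \<in> {0<..<1}" using \<theta> A3_nbhd by auto
  then have "?f differentiable (at \<theta>)" using g by (auto simp: good_def C2_on_def)
  then have D: "(?f has_real_derivative deriv ?f \<theta>) (at \<theta>)"
    by (simp add: DERIV_deriv_iff_real_differentiable)
  then have "((\<lambda>h. (?f (\<theta> + h) - ?f \<theta>) / h) \<longlongrightarrow> deriv ?f \<theta>) (at 0)" by (simp add: DERIV_def)
  moreover have "(\<lambda>k. (1 - \<theta>) / real (Suc k)) \<longlonglongrightarrow> 0"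
    by (rule LIMSEQ_Suc[OF lim_const_over_n])
  then have "filterlim (\<lambda>k. (1 - \<theta>) / real (Suc k)) (at 0) sequentially"
    unfolding filterlim_at using \<theta>1 by simp
  ultimately have "(\<lambda>k. (?f (\<theta> + (1 - \<theta>) / real (Suc k)) - ?f \<theta>) / ((1 - \<theta>) / real (Suc k))) \<longlonglongrightarrow> deriv ?f \<theta>"
    by (rule filterlim_compose)
  then have l: "lim (\<lambda>k. (?f (\<theta> + (1 - \<theta>) / real (Suc k)) - ?f \<theta>) / ((1 - \<theta>) / real (Suc k))) = deriv ?f \<theta>"
    by (rule limI)
  have "\<bar>deriv ?f \<theta>\<bar> \<le> L" using g \<theta> unfolding good_def by fastforce
  then have "\<bar>deriv ?f \<theta>\<bar> \<le> K" using K_ge by simp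
  then show eq: "deriv ?f \<theta> = dl t \<theta> \<omega>" unfolding dl_def l by auto
  show "(?f has_real_derivative dl t \<theta> \<omega>) (at \<theta>)" using D unfolding eq .
qed

lemma good_lam_le:
  assumes g: "good t \<omega>" and \<theta>: "\<theta> \<in> \<Theta>\<^sub>0" shows "\<bar>lam t \<theta> \<omega>\<bar> \<le> K"
proof -
  have "\<bar>lam t \<theta> \<omega>\<bar> \<le> L" using g \<theta> unfolding good_def by fastforce
  then show ?thesis using K_ge by simp
qed

text \<open>Mean value inequality; the bound on the second derivative of the bets enters the
  argument in this form. Convexity of \<open>S\<close> is required because
  \<open>\<Theta>\<^sub>0\<close> may be disconnected.\<close>

lemma good_dl_lipschitz:
  assumes g: "good t \<omega>" and S: "convex S" "S \<subseteq> \<Theta>\<^sub>0" and xy: "x \<in> S" "y \<in> S"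
  shows "\<bar>dl t x \<omega> - dl t y \<omega>\<bar> \<le> K * \<bar>x - y\<bar>"
proof -
  let ?f = "\<lambda>\<theta>. lam t \<theta> \<omega>"
  have "norm (deriv ?f x - deriv ?f y) \<le> K * norm (x - y)"
  proof (rule field_differentiable_bound[OF S(1) _ _ xy])
    fix z assume z: "z \<in> S"
    then have "deriv ?f differentiable (at z)" using g S A3_nbhd by (auto simp: good_def C2_on_def)
    then have "(deriv ?f has_real_derivative deriv (deriv ?f) z) (at z)"
      by (simp add: DERIV_deriv_iff_real_differentiable)
    then show "(deriv ?f has_field_derivative deriv (deriv ?f) z) (at z within S)"
      by (rule has_field_derivative_at_within)
    have "\<bar>deriv (deriv ?f) z\<bar> \<le> L" using g z S unfolding good_def by fastforce
    then show "norm (deriv (deriv ?f) z) \<le> K" using K_ge by simp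
  qed
  moreover have "x \<in> \<Theta>\<^sub>0" "y \<in> \<Theta>\<^sub>0" using xy S by auto
  ultimately show ?thesis by (simp add: good_deriv(2)[OF g])
qed

lemma good_lam_lipschitz:
  assumes g: "good t \<omega>" and S: "convex S" "S \<subseteq> \<Theta>\<^sub>0" and xy: "x \<in> S" "y \<in> S"
  shows "\<bar>lam t x \<omega> - lam t y \<omega>\<bar> \<le> K * \<bar>x - y\<bar>"
proof -
  have "norm (lam t x \<omega> - lam t y \<omega>) \<le> K * norm (x - y)"
  proof (rule field_differentiable_bound[OF S(1) _ _ xy, where f'="\<lambda>z. dl t z \<omega>"])
    fix z assume "z \<in> S"
    then have "z \<in> \<Theta>\<^sub>0" using S(2) by auto
    from good_deriv(1)[OF g this]
    show "((\<lambda>\<theta>. lam t \<theta> \<omega>) has_real_derivative dl t z \<omega>) (at z within S)"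
      by (rule has_field_derivative_at_within)
  qed (simp add: dl_le)
  then show ?thesis by simp
qed

text \<open>Mean value inequality for the bet minus its tangent at \<open>x\<close>: the slope of
  this difference on the segment is at most \<open>K * \<bar>y - x\<bar>\<close>. The factor 1/2 of
  Taylor's formula is given away.\<close>

lemma good_lam_taylor:
  assumes g: "good t \<omega>" and S: "convex S" "S \<subseteq> \<Theta>\<^sub>0" and xy: "x \<in> S" "y \<in> S"
  shows "\<bar>lam t y \<omega> - lam t x \<omega> - dl t x \<omega> * (y - x)\<bar> \<le> K * (y - x)\<^sup>2"
proof -
  have sub: "closed_segment x y \<subseteq> S" using S xy by (simp add: closed_segment_subset)
  have "norm ((lam t y \<omega> - dl t x \<omega> * y) - (lam t x \<omega> - dl t x \<omega> * x)) \<le> (K * \<bar>y - x\<bar>) * norm (y - x)"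
  proof (rule field_differentiable_bound[where S="closed_segment x y" and f="\<lambda>z. lam t z \<omega> - dl t x \<omega> * z"
        and f'="\<lambda>z. dl t z \<omega> - dl t x \<omega>"])
    fix z assume z: "z \<in> closed_segment x y"
    then have "z \<in> S" using sub by auto
    then show "((\<lambda>z. lam t z \<omega> - dl t x \<omega> * z) has_real_derivative dl t z \<omega> - dl t x \<omega>) (at z within closed_segment x y)"
      using S by (auto intro!: derivative_eq_intros has_field_derivative_at_within[OF good_deriv(1)[OF g]])
    have "\<bar>dl t z \<omega> - dl t x \<omega>\<bar> \<le> K * \<bar>z - x\<bar>" by (rule good_dl_lipschitz[OF g S \<open>z \<in> S\<close> xy(1)])
    also have "\<dots> \<le> K * \<bar>y - x\<bar>"
      using z K_ge by (intro mult_left_mono) (auto simp: closed_segment_eq_real_ivl split: if_splits)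
    finally show "norm (dl t z \<omega> - dl t x \<omega>) \<le> K * \<bar>y - x\<bar>" by simp
  qed auto
  then show ?thesis by (simp add: algebra_simps power2_eq_square abs_mult_self_eq)
qed

definition score :: "nat \<Rightarrow> real \<Rightarrow> 'a \<Rightarrow> real" where
  "score t \<theta> \<omega> = (dl t \<theta> \<omega> * (X t \<omega> - \<theta>) - lam t \<theta> \<omega>) / (1 + lam t \<theta> \<omega> * (X t \<omega> - \<theta>))"

text \<open>On \<open>\<Theta>\<^sub>0\<close> all wealth factors are at least
  \<open>\<epsilon>\<close>, so the extended log-wealth is the real function \<open>F\<close> there.
  A minimiser over the unit interval that lies in the open set \<open>\<Theta>\<^sub>0\<close> is a
  local minimum of \<open>F\<close>.\<close>

lemma score_sum_zero:
  assumes g: "\<forall>t\<ge>1. good t \<omega>" and \<theta>: "\<theta> \<in> \<Theta>\<^sub>0"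
    and min: "is_arg_min (log_wealth X lam n \<omega>) (\<lambda>\<theta>. \<theta> \<in> {0..1}) \<theta>"
  shows "(\<Sum>t=1..n. score t \<theta> \<omega>) = 0"
proof -
  define F where "F = (\<lambda>\<theta>. \<Sum>t=1..n. ln (1 + lam t \<theta> \<omega> * (X t \<omega> - \<theta>)))"
  have pos: "1 + lam t \<theta> \<omega> * (X t \<omega> - \<theta>) > 0" if "t \<ge> 1" "\<theta> \<in> \<Theta>\<^sub>0" for t \<theta>
    using g that A3_away(1) unfolding good_def by fastforce
  have lw: "log_wealth X lam n \<omega> \<theta> = ereal (F \<theta>)" if "\<theta> \<in> \<Theta>\<^sub>0" for \<theta>
    unfolding log_wealth_def F_def sum_ereal[symmetric]
    by (rule sum.cong) (use pos that in \<open>auto simp: ext_ln_def\<close>)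
  have le: "F \<theta> \<le> F y" if "y \<in> \<Theta>\<^sub>0" for y
  proof -
    have "y \<in> {0..1}" using that A3_nbhd by fastforce
    then have "\<not> log_wealth X lam n \<omega> y < log_wealth X lam n \<omega> \<theta>" using min by (auto simp: is_arg_min_def)
    then show ?thesis using lw that \<theta> by auto
  qed
  have D: "(F has_real_derivative (\<Sum>t=1..n. score t \<theta> \<omega>)) (at \<theta>)"
    unfolding F_def
  proof (rule DERIV_sum)
    fix t assume "t \<in> {1..n}"
    then have t: "t \<ge> 1" by simp
    have "((\<lambda>\<theta>. lam t \<theta> \<omega> * (X t \<omega> - \<theta>)) has_real_derivative
        dl t \<theta> \<omega> * (X t \<omega> - \<theta>) + (0 - 1) * lam t \<theta> \<omega>) (at \<theta>)"
      by (intro DERIV_mult DERIV_diff DERIV_const DERIV_ident good_deriv(1) g[rule_format, OF t] \<theta>)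
    from DERIV_chain2[OF DERIV_ln_divide[OF pos[OF t \<theta>]] DERIV_add[OF DERIV_const this]]
    show "((\<lambda>\<theta>. ln (1 + lam t \<theta> \<omega> * (X t \<omega> - \<theta>))) has_real_derivative score t \<theta> \<omega>) (at \<theta>)"
      by (simp add: score_def)
  qed
  from A3_nbhd(1) \<theta> obtain d where d: "d > 0" "ball \<theta> d \<subseteq> \<Theta>\<^sub>0" by (auto simp: open_contains_ball)
  show ?thesis
  proof (rule DERIV_local_min[OF D d(1)], intro allI impI)
    fix y assume "\<bar>\<theta> - y\<bar> < d"
    then have "y \<in> ball \<theta> d" by (simp add: dist_real_def)
    then show "F \<theta> \<le> F y" using le d(2) by blast
  qed
qed


section \<open>Negligible sums at the true mean\<close>

abbreviation "d t \<equiv> dl t \<theta>s"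

lemma theta01: "0 \<le> \<theta>s" "\<theta>s < 1" "0 < \<theta>s"
  using A3_nbhd by auto

lemma d_hist: "t \<ge> 1 \<Longrightarrow> d t \<in> borel_measurable (hist t)"
  using dl_hist theta01 by simp

lemma d_measurable [measurable]: "t \<ge> 1 \<Longrightarrow> d t \<in> borel_measurable M"
  using dl_measurable theta01 by simp

definition err :: "nat \<Rightarrow> real" where
  "err t = expectation (\<lambda>\<omega>. (d t \<omega> + \<beta>)\<^sup>2)"

lemma d_dev_le: "\<bar>d t \<omega> + \<beta>\<bar> \<le> 2 * K"
  using dl_le[of t \<theta>s \<omega>] K_ge by linarith

lemma d_dev_integrable: "t \<ge> 1 \<Longrightarrow> integrable M (\<lambda>\<omega>. (d t \<omega> + \<beta>)\<^sup>2)"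
  using power_mono[OF d_dev_le[of t], where n=2] by (intro integrable_const_bound[where B="(2*K)\<^sup>2"]) auto

lemma err_nonneg: "0 \<le> err t" by (simp add: err_def)

text \<open>The predictable version \<open>d\<close> agrees almost everywhere with the derivative in
  the convergence hypothesis and is bounded, so the nonnegative integrals are finite and their limit
  passes to real expectations.\<close>

lemma err_tendsto: "err \<longlonglongrightarrow> 0"
proof -
  have "(\<lambda>t. enn2real (\<integral>\<^sup>+\<omega>. ennreal ((deriv (\<lambda>\<theta>. lam t \<theta> \<omega>) \<theta>s - - \<beta>)\<^sup>2) \<partial>M)) \<longlonglongrightarrow> enn2real 0"
    using A1_deriv unfolding tendsto_L2_def by (intro tendsto_enn2real) auto
  moreover have "\<forall>\<^sub>F t in sequentially.
      enn2real (\<integral>\<^sup>+\<omega>. ennreal ((deriv (\<lambda>\<theta>. lam t \<theta> \<omega>) \<theta>s - - \<beta>)\<^sup>2) \<partial>M) = err t"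
    using eventually_ge_at_top[of 1]
  proof eventually_elim
    case (elim t)
    have "AE \<omega> in M. deriv (\<lambda>\<theta>. lam t \<theta> \<omega>) \<theta>s = d t \<omega>"
      using AE_good by eventually_elim (use elim good_deriv(2) A3_nbhd in auto)
    then have "(\<integral>\<^sup>+\<omega>. ennreal ((deriv (\<lambda>\<theta>. lam t \<theta> \<omega>) \<theta>s - - \<beta>)\<^sup>2) \<partial>M) = (\<integral>\<^sup>+\<omega>. ennreal ((d t \<omega> + \<beta>)\<^sup>2) \<partial>M)"
      by (intro nn_integral_cong_AE) (auto elim: eventually_mono)
    also have "\<dots> = ennreal (err t)"
      unfolding err_def by (rule nn_integral_eq_integral[OF d_dev_integrable[OF elim]]) simp
    finally show ?case using err_nonneg by simp
  qed
  ultimately show ?thesis by (simp add: tendsto_cong)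
qed

lemma mbar_hist: "t \<ge> 1 \<Longrightarrow> mbar t \<in> borel_measurable (hist t)"
proof -
  assume t: "t \<ge> 1"
  have "(\<lambda>\<omega>. (\<Sum>i=1..t-1. X i \<omega> - \<theta>s) / real (t - 1)) \<in> borel_measurable (hist t)"
    by (intro borel_measurable_divide borel_measurable_sum borel_measurable_diff X_measurable_hist) auto
  then show ?thesis by (simp add: mbar_eq[OF t, abs_def])
qed

lemma mbar_measurable [measurable]: "t \<ge> 1 \<Longrightarrow> mbar t \<in> borel_measurable M"
  by (rule measurable_from_hist[OF mbar_hist])

lemma mbar_le: "t \<ge> 1 \<Longrightarrow> \<omega> \<in> space M \<Longrightarrow> \<bar>mbar t \<omega>\<bar> \<le> 1"
proof -
  assume t: "t \<ge> 1" and w: "\<omega> \<in> space M"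
  have "\<bar>\<Sum>i=1..t-1. X i \<omega> - \<theta>s\<bar> \<le> (\<Sum>i=1..t-1. 1)"
    by (intro order.trans[OF sum_abs] sum_mono) (use centred_le w in auto)
  then show ?thesis using t by (auto simp: mbar_eq abs_divide divide_le_eq)
qed

text \<open>Orthogonality gives \<open>1 / (t - 1)\<close> for \<open>t \<ge> 2\<close>; the form
  \<open>2 / t\<close> also covers \<open>t = 1\<close>, where \<open>mbar\<close> is 0.\<close>

lemma mbar_second_moment:
  assumes t: "t \<ge> 1"
  shows "integrable M (\<lambda>\<omega>. (mbar t \<omega>)\<^sup>2)" "expectation (\<lambda>\<omega>. (mbar t \<omega>)\<^sup>2) \<le> 2 / real t"
proof -
  have *: "integrable M (\<lambda>\<omega>. (\<Sum>i=1..t-1. 1 / real (t - 1) * (X i \<omega> - \<theta>s))\<^sup>2) \<and>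
      expectation (\<lambda>\<omega>. (\<Sum>i=1..t-1. 1 / real (t - 1) * (X i \<omega> - \<theta>s))\<^sup>2) \<le> (\<Sum>i=1..t-1. (1 / real (t - 1))\<^sup>2)"
    by (rule second_moment_transform_le[where Z="\<lambda>_ _. 1 / real (t - 1)" and h="\<lambda>x. x - \<theta>s" and B="1 / real (t - 1)"])
       (use centred_le centred_expectation in \<open>auto simp: prob_space\<close>)
  have eq: "mbar t = (\<lambda>\<omega>. \<Sum>i=1..t-1. 1 / real (t - 1) * (X i \<omega> - \<theta>s))"
    using t by (auto simp: mbar_eq sum_divide_distrib)
  have "(\<Sum>i=1..t-1. (1 / real (t - 1))\<^sup>2) = real (t - 1) * (1 / real (t - 1))\<^sup>2" by simp
  also have "\<dots> \<le> 2 / real t"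
  proof (cases "t = 1")
    case False
    then have "real (t - 1) * (1 / real (t - 1))\<^sup>2 = 1 / real (t - 1)"
      using t by (simp add: power2_eq_square)
    also have "\<dots> \<le> 2 / real t" using t False by (simp add: field_simps of_nat_diff)
    finally show ?thesis .
  qed simp
  finally show "integrable M (\<lambda>\<omega>. (mbar t \<omega>)\<^sup>2)" "expectation (\<lambda>\<omega>. (mbar t \<omega>)\<^sup>2) \<le> 2 / real t"
    using * unfolding eq by auto
qed

lemma r_eq: "t \<ge> 1 \<Longrightarrow> \<omega> \<in> space M \<Longrightarrow> lam t \<theta>s \<omega> = \<beta> * mbar t \<omega> + r t \<omega>"
  using A2_expansion by (simp add: mbar_def)

text \<open>Measurability of the residual is derived: on the sample space it is the difference of
  the bet and a multiple of the running mean.\<close>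

lemma r_measurable [measurable]: "t \<ge> 1 \<Longrightarrow> r t \<in> borel_measurable M"
proof -
  assume t: "t \<ge> 1"
  have [measurable]: "lam t \<theta>s \<in> borel_measurable M"
    using measurable_from_hist[OF lam_hist[OF t]] theta01 by auto
  have "(\<lambda>\<omega>. lam t \<theta>s \<omega> - \<beta> * mbar t \<omega>) \<in> borel_measurable M"
    using t by measurable
  then show ?thesis by (rule measurable_cong[THEN iffD1, rotated]) (simp add: r_eq[OF t])
qed

lemma vanishing_R: "vanishing (\<lambda>n \<omega>. (\<Sum>t=1..n. \<bar>r t \<omega>\<bar>) / sqrt (real n))"
  unfolding vanishing_def using A2_residual by (auto intro!: borel_measurable_divide borel_measurable_sum)

text \<open>Expectations of order \<open>o(1 / sqrt t)\<close> add up to \<open>o(sqrt n)\<close>,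
  and Markov's inequality does the rest.\<close>

lemma vanishing_sqrt_sum:
  fixes Y :: "nat \<Rightarrow> 'a \<Rightarrow> real"
  assumes Y: "\<And>t. t \<ge> 1 \<Longrightarrow> integrable M (Y t)" "\<And>t \<omega>. t \<ge> 1 \<Longrightarrow> 0 \<le> Y t \<omega>"
    and le: "\<And>t. t \<ge> 1 \<Longrightarrow> expectation (Y t) \<le> x t / sqrt (real t)" and x: "x \<longlonglongrightarrow> 0"
  shows "vanishing (\<lambda>n \<omega>. (\<Sum>t=1..n. Y t \<omega>) / sqrt (real n))"
proof (rule vanishing_L1[OF _ _ sqrt_weighted_zero[OF x]])
  show "integrable M (\<lambda>\<omega>. (\<Sum>t=1..n. Y t \<omega>) / sqrt (real n))" for n
    by (intro integrable_divide_zero Bochner_Integration.integrable_sum) (use Y in auto)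
  show "\<forall>\<^sub>F n in sequentially. expectation (\<lambda>\<omega>. \<bar>(\<Sum>t=1..n. Y t \<omega>) / sqrt (real n)\<bar>)
      \<le> (\<Sum>t=1..n. x t / sqrt (real t)) / sqrt (real n)"
  proof (intro always_eventually allI)
    fix n
    have "\<bar>(\<Sum>t=1..n. Y t \<omega>) / sqrt (real n)\<bar> = (\<Sum>t=1..n. Y t \<omega>) / sqrt (real n)" for \<omega>
      by (intro abs_of_nonneg divide_nonneg_nonneg sum_nonneg) (use Y in auto)
    then have "expectation (\<lambda>\<omega>. \<bar>(\<Sum>t=1..n. Y t \<omega>) / sqrt (real n)\<bar>) = expectation (\<lambda>\<omega>. (\<Sum>t=1..n. Y t \<omega>) / sqrt (real n))"
      by (simp only:)
    also have "\<dots> = (\<Sum>t=1..n. expectation (Y t)) / sqrt (real n)"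
      using Y by (simp add: Bochner_Integration.integral_sum)
    also have "\<dots> \<le> (\<Sum>t=1..n. x t / sqrt (real t)) / sqrt (real n)"
      by (intro divide_right_mono sum_mono le) auto
    finally show "expectation (\<lambda>\<omega>. \<bar>(\<Sum>t=1..n. Y t \<omega>) / sqrt (real n)\<bar>) \<le> (\<Sum>t=1..n. x t / sqrt (real t)) / sqrt (real n)" .
  qed
qed

lemma vanishing_mean:
  fixes Y :: "nat \<Rightarrow> 'a \<Rightarrow> real"
  assumes Y: "\<And>t. t \<ge> 1 \<Longrightarrow> integrable M (Y t)" "\<And>t \<omega>. t \<ge> 1 \<Longrightarrow> 0 \<le> Y t \<omega>"
    and le: "\<And>t. t \<ge> 1 \<Longrightarrow> expectation (Y t) \<le> x t" and x: "x \<longlonglongrightarrow> 0"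
  shows "vanishing (\<lambda>n \<omega>. (\<Sum>t=1..n. Y t \<omega>) / real n)"
proof (rule vanishing_L1[OF _ _ cesaro_zero[OF x]])
  show "integrable M (\<lambda>\<omega>. (\<Sum>t=1..n. Y t \<omega>) / real n)" for n
    by (intro integrable_divide_zero Bochner_Integration.integrable_sum) (use Y in auto)
  show "\<forall>\<^sub>F n in sequentially. expectation (\<lambda>\<omega>. \<bar>(\<Sum>t=1..n. Y t \<omega>) / real n\<bar>) \<le> (\<Sum>t=1..n. x t) / real n"
  proof (intro always_eventually allI)
    fix n
    have "\<bar>(\<Sum>t=1..n. Y t \<omega>) / real n\<bar> = (\<Sum>t=1..n. Y t \<omega>) / real n" for \<omega>
      by (intro abs_of_nonneg divide_nonneg_nonneg sum_nonneg) (use Y in auto)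
    then have "expectation (\<lambda>\<omega>. \<bar>(\<Sum>t=1..n. Y t \<omega>) / real n\<bar>) = expectation (\<lambda>\<omega>. (\<Sum>t=1..n. Y t \<omega>) / real n)"
      by (simp only:)
    also have "\<dots> = (\<Sum>t=1..n. expectation (Y t)) / real n"
      using Y by (simp add: Bochner_Integration.integral_sum)
    also have "\<dots> \<le> (\<Sum>t=1..n. x t) / real n"
      by (intro divide_right_mono sum_mono le) auto
    finally show "expectation (\<lambda>\<omega>. \<bar>(\<Sum>t=1..n. Y t \<omega>) / real n\<bar>) \<le> (\<Sum>t=1..n. x t) / real n" .
  qed
qed

text \<open>By Cauchy-Schwarz the terms have expectation at most
  \<open>sqrt (2 * err t) / sqrt (real t)\<close>: the running mean supplies the rate, so that the
  derivative needs to converge in mean square without any rate.\<close>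

lemma vanishing_P: "vanishing (\<lambda>n \<omega>. (\<Sum>t=1..n. \<bar>d t \<omega> + \<beta>\<bar> * \<bar>mbar t \<omega>\<bar>) / sqrt (real n))"
proof (rule vanishing_sqrt_sum[where x="\<lambda>t. sqrt (2 * err t)"])
  fix t :: nat assume t: "t \<ge> 1"
  note cs = cauchy_schwarz_expectation[of "\<lambda>\<omega>. d t \<omega> + \<beta>" "mbar t", OF _ mbar_measurable[OF t]
      d_dev_integrable[OF t] mbar_second_moment(1)[OF t]]
  have m: "(\<lambda>\<omega>. d t \<omega> + \<beta>) \<in> borel_measurable M" using d_measurable[OF t] by simp
  show "integrable M (\<lambda>\<omega>. \<bar>d t \<omega> + \<beta>\<bar> * \<bar>mbar t \<omega>\<bar>)" by (rule cs(1)[OF m])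
  have "expectation (\<lambda>\<omega>. \<bar>d t \<omega> + \<beta>\<bar> * \<bar>mbar t \<omega>\<bar>) \<le> sqrt (err t) * sqrt (expectation (\<lambda>\<omega>. (mbar t \<omega>)\<^sup>2))"
    using cs(2)[OF m] by (simp add: err_def)
  also have "\<dots> \<le> sqrt (err t) * sqrt (2 / real t)"
    by (intro mult_left_mono real_sqrt_le_mono mbar_second_moment(2)[OF t]) (simp add: err_nonneg)
  also have "\<dots> = sqrt (2 * err t) / sqrt (real t)" by (simp add: real_sqrt_mult real_sqrt_divide)
  finally show "expectation (\<lambda>\<omega>. \<bar>d t \<omega> + \<beta>\<bar> * \<bar>mbar t \<omega>\<bar>) \<le> sqrt (2 * err t) / sqrt (real t)" .
next
  show "(\<lambda>t. sqrt (2 * err t)) \<longlonglongrightarrow> 0"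
    using tendsto_real_sqrt[OF tendsto_mult_left[OF err_tendsto, of 2]] by simp
qed simp

lemma two_over_sqrt: "(\<lambda>t. 2 / sqrt (real t)) \<longlonglongrightarrow> 0" by real_asymp

lemma vanishing_Q: "vanishing (\<lambda>n \<omega>. (\<Sum>t=1..n. (mbar t \<omega>)\<^sup>2) / sqrt (real n))"
proof (rule vanishing_sqrt_sum[OF _ _ _ two_over_sqrt])
  fix t :: nat assume "t \<ge> 1"
  then show "integrable M (\<lambda>\<omega>. (mbar t \<omega>)\<^sup>2)" "expectation (\<lambda>\<omega>. (mbar t \<omega>)\<^sup>2) \<le> 2 / sqrt (real t) / sqrt (real t)"
    using mbar_second_moment[of t] by (auto simp: divide_divide_eq_left)
qed simp

lemma vanishing_A: "vanishing (\<lambda>n \<omega>. (\<Sum>t=1..n. \<bar>mbar t \<omega>\<bar>) / real n)"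
proof (rule vanishing_mean[OF _ _ _ two_over_sqrt])
  fix t :: nat assume t: "t \<ge> 1"
  note j = expectation_abs_le_sqrt[OF mbar_measurable[OF t] mbar_second_moment(1)[OF t]]
  show "integrable M (\<lambda>\<omega>. \<bar>mbar t \<omega>\<bar>)" using j(1) by simp
  have "sqrt (expectation (\<lambda>\<omega>. (mbar t \<omega>)\<^sup>2)) \<le> sqrt (4 / real t)"
    using mbar_second_moment(2)[OF t] t by (intro real_sqrt_le_mono) (auto simp: field_simps)
  also have "\<dots> = 2 / sqrt (real t)" by (simp add: real_sqrt_divide)
  finally show "expectation (\<lambda>\<omega>. \<bar>mbar t \<omega>\<bar>) \<le> 2 / sqrt (real t)" using j(2) by simp
qed simp

lemma vanishing_B: "vanishing (\<lambda>n \<omega>. (\<Sum>t=1..n. \<bar>d t \<omega> + \<beta>\<bar>) / real n)"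
proof (rule vanishing_mean[where x="\<lambda>t. sqrt (err t)"])
  fix t :: nat assume t: "t \<ge> 1"
  have m: "(\<lambda>\<omega>. d t \<omega> + \<beta>) \<in> borel_measurable M" using d_measurable[OF t] by simp
  note j = expectation_abs_le_sqrt[OF m d_dev_integrable[OF t]]
  show "integrable M (\<lambda>\<omega>. \<bar>d t \<omega> + \<beta>\<bar>)" using j(1) by simp
  show "expectation (\<lambda>\<omega>. \<bar>d t \<omega> + \<beta>\<bar>) \<le> sqrt (err t)" using j(2) by (simp add: err_def)
next
  show "(\<lambda>t. sqrt (err t)) \<longlonglongrightarrow> 0"
    using tendsto_real_sqrt[OF err_tendsto] by simp
qed simp

text \<open>By orthogonality the second moment of the sum is at most the sum of the
  \<open>b t\<close>, which is \<open>o(n)\<close> as \<open>b\<close> tends to 0.\<close>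

lemma vanishing_transform:
  fixes h :: "real \<Rightarrow> real" and b :: "nat \<Rightarrow> real"
  assumes Z: "\<And>t. t \<ge> 1 \<Longrightarrow> Z t \<in> borel_measurable (hist t)"
      "\<And>t \<omega>. t \<ge> 1 \<Longrightarrow> \<omega> \<in> space M \<Longrightarrow> \<bar>Z t \<omega>\<bar> \<le> B"
      "\<And>t. t \<ge> 1 \<Longrightarrow> expectation (\<lambda>\<omega>. (Z t \<omega>)\<^sup>2) \<le> b t"
    and h: "h \<in> borel_measurable borel"
      "\<And>t \<omega>. t \<ge> 1 \<Longrightarrow> \<omega> \<in> space M \<Longrightarrow> \<bar>h (X t \<omega>)\<bar> \<le> 1"
      "expectation (\<lambda>\<omega>. h (X 1 \<omega>)) = 0"
    and b: "b \<longlonglongrightarrow> 0"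
  shows "vanishing (\<lambda>n \<omega>. (\<Sum>t=1..n. Z t \<omega> * h (X t \<omega>)) / sqrt (real n))"
proof (rule vanishing_L2[OF _ _ _ cesaro_zero[OF b]])
  note * = second_moment_transform_le[OF Z h]
  have [measurable]: "h \<in> borel_measurable borel" by fact
  have [measurable]: "Z t \<in> borel_measurable M" if "t \<ge> 1" for t by (rule measurable_from_hist[OF Z(1)[OF that]])
  show "(\<lambda>\<omega>. (\<Sum>t=1..n. Z t \<omega> * h (X t \<omega>)) / sqrt (real n)) \<in> borel_measurable M" for n
    by (intro borel_measurable_divide borel_measurable_sum borel_measurable_times) (auto intro: measurable_compose[OF X_measurable h(1)])
  show "integrable M (\<lambda>\<omega>. ((\<Sum>t=1..n. Z t \<omega> * h (X t \<omega>)) / sqrt (real n))\<^sup>2)" for n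
    using * by (simp add: power_divide)
  show "\<forall>\<^sub>F n in sequentially. expectation (\<lambda>\<omega>. ((\<Sum>t=1..n. Z t \<omega> * h (X t \<omega>)) / sqrt (real n))\<^sup>2) \<le> (\<Sum>t=1..n. b t) / real n"
    using * by (intro always_eventually allI) (simp add: power_divide divide_right_mono)
qed

lemma centred_square_le: "t \<ge> 1 \<Longrightarrow> \<omega> \<in> space M \<Longrightarrow> \<bar>(X t \<omega> - \<theta>s)\<^sup>2 - \<sigma>\<^sup>2\<bar> \<le> 1"
proof -
  assume "t \<ge> 1" "\<omega> \<in> space M"
  then have "0 \<le> (X t \<omega> - \<theta>s)\<^sup>2" "(X t \<omega> - \<theta>s)\<^sup>2 \<le> 1"
    using centred_le[of t \<omega>] by (auto simp: abs_square_le_1)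
  then show ?thesis using var_bounds by linarith
qed

lemma centred_square_expectation: "expectation (\<lambda>\<omega>. (X 1 \<omega> - \<theta>s)\<^sup>2 - \<sigma>\<^sup>2) = 0"
  using centred_expectation(2) centred_integrable(2) by (simp add: prob_space)

lemma vanishing_M1: "vanishing (\<lambda>n \<omega>. (\<Sum>t=1..n. (d t \<omega> + \<beta>) * (X t \<omega> - \<theta>s)) / sqrt (real n))"
  by (rule vanishing_transform[where Z="\<lambda>t \<omega>. d t \<omega> + \<beta>" and h="\<lambda>x. x - \<theta>s" and B="2 * K" and b=err])
     (use d_hist d_dev_le centred_le centred_expectation(1) err_tendsto in \<open>auto simp: err_def\<close>)

lemma vanishing_M2: "vanishing (\<lambda>n \<omega>. (\<Sum>t=1..n. mbar t \<omega> * ((X t \<omega> - \<theta>s)\<^sup>2 - \<sigma>\<^sup>2)) / sqrt (real n))"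
proof (rule vanishing_transform[where Z=mbar and h="\<lambda>x. (x - \<theta>s)\<^sup>2 - \<sigma>\<^sup>2" and B=1 and b="\<lambda>t. 2 / real t"])
  show "(\<lambda>t. 2 / real t) \<longlonglongrightarrow> 0" by (rule lim_const_over_n)
qed (use mbar_hist mbar_le mbar_second_moment centred_square_le centred_square_expectation in auto)

lemma vanishing_V: "vanishing (\<lambda>n \<omega>. (\<Sum>t=1..n. (X t \<omega> - \<theta>s)\<^sup>2 - \<sigma>\<^sup>2) / real n)"
proof (rule vanishing_L2[where b="\<lambda>n. 1 / real n"])
  have *: "integrable M (\<lambda>\<omega>. (\<Sum>t=1..n. 1 * ((X t \<omega> - \<theta>s)\<^sup>2 - \<sigma>\<^sup>2))\<^sup>2) \<and>
      expectation (\<lambda>\<omega>. (\<Sum>t=1..n. 1 * ((X t \<omega> - \<theta>s)\<^sup>2 - \<sigma>\<^sup>2))\<^sup>2) \<le> (\<Sum>t=1..n. 1)" for n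
    by (rule second_moment_transform_le[where Z="\<lambda>_ _. 1" and h="\<lambda>x. (x - \<theta>s)\<^sup>2 - \<sigma>\<^sup>2" and B=1])
       (use centred_square_le centred_square_expectation in \<open>auto simp: prob_space\<close>)
  show "(\<lambda>\<omega>. (\<Sum>t=1..n. (X t \<omega> - \<theta>s)\<^sup>2 - \<sigma>\<^sup>2) / real n) \<in> borel_measurable M" for n
    by (intro borel_measurable_divide borel_measurable_sum) auto
  show "integrable M (\<lambda>\<omega>. ((\<Sum>t=1..n. (X t \<omega> - \<theta>s)\<^sup>2 - \<sigma>\<^sup>2) / real n)\<^sup>2)" for n
    using * by (simp add: power_divide)
  show "\<forall>\<^sub>F n in sequentially. expectation (\<lambda>\<omega>. ((\<Sum>t=1..n. (X t \<omega> - \<theta>s)\<^sup>2 - \<sigma>\<^sup>2) / real n)\<^sup>2) \<le> 1 / real n"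
  proof (intro always_eventually allI)
    fix n
    have "expectation (\<lambda>\<omega>. ((\<Sum>t=1..n. (X t \<omega> - \<theta>s)\<^sup>2 - \<sigma>\<^sup>2) / real n)\<^sup>2) \<le> real n / (real n)\<^sup>2"
      using * by (simp add: power_divide divide_right_mono)
    also have "\<dots> = 1 / real n" by (simp add: power2_eq_square)
    finally show "expectation (\<lambda>\<omega>. ((\<Sum>t=1..n. (X t \<omega> - \<theta>s)\<^sup>2 - \<sigma>\<^sup>2) / real n)\<^sup>2) \<le> 1 / real n" .
  qed
qed (rule lim_1_over_n)


section \<open>Uniform control of the martingale of derivative increments\<close>

definition rad :: real where
  "rad = (SOME \<delta>. \<delta> > 0 \<and> cball \<theta>s \<delta> \<subseteq> \<Theta>\<^sub>0)"

lemma rad: "rad > 0" "\<And>\<theta>. \<bar>\<theta> - \<theta>s\<bar> \<le> rad \<Longrightarrow> \<theta> \<in> \<Theta>\<^sub>0"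
proof -
  have "\<exists>\<delta>. \<delta> > 0 \<and> cball \<theta>s \<delta> \<subseteq> \<Theta>\<^sub>0"
    using A3_nbhd(1,2) by (auto simp: open_contains_cball)
  from someI_ex[OF this] have "rad > 0" "cball \<theta>s rad \<subseteq> \<Theta>\<^sub>0" by (auto simp: rad_def)
  then show "rad > 0" "\<And>\<theta>. \<bar>\<theta> - \<theta>s\<bar> \<le> rad \<Longrightarrow> \<theta> \<in> \<Theta>\<^sub>0"
    by (auto simp: subset_iff dist_real_def abs_minus_commute)
qed

text \<open>A closed ball is convex, as the mean value estimates require, and has the grid as a
  finite net.\<close>

definition nbhd :: "real set" where "nbhd = cball \<theta>s rad"

lemma nbhd: "convex nbhd" "nbhd \<subseteq> \<Theta>\<^sub>0" "\<theta>s \<in> nbhd" "\<theta> \<in> nbhd \<longleftrightarrow> \<bar>\<theta> - \<theta>s\<bar> \<le> rad"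
  using rad by (auto simp: nbhd_def dist_real_def abs_minus_commute)

lemma nbhd01: "\<theta> \<in> nbhd \<Longrightarrow> 0 < \<theta> \<and> \<theta> < 1"
  using nbhd(2) A3_nbhd(3) by auto

text \<open>Built from the predictable versions, so that for fixed \<open>\<theta>\<close> in
  \<open>nbhd\<close> it is a martingale transform to which the orthogonality bound applies.\<close>

definition D :: "nat \<Rightarrow> real \<Rightarrow> 'a \<Rightarrow> real" where
  "D n \<theta> \<omega> = (\<Sum>t=1..n. (dl t \<theta> \<omega> - d t \<omega>) * (X t \<omega> - \<theta>s)) / real n"

lemma D_lipschitz:
  assumes g: "\<forall>t\<ge>1. good t \<omega>" and \<theta>: "\<theta> \<in> nbhd" "\<theta>' \<in> nbhd"
  shows "\<bar>D n \<theta> \<omega> - D n \<theta>' \<omega>\<bar> \<le> K * \<bar>\<theta> - \<theta>'\<bar>"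
proof -
  have w: "\<omega> \<in> space M" using g[rule_format, of 1] by (simp add: good_def)
  have "D n \<theta> \<omega> - D n \<theta>' \<omega> = (\<Sum>t=1..n. (dl t \<theta> \<omega> - dl t \<theta>' \<omega>) * (X t \<omega> - \<theta>s)) / real n"
    by (simp add: D_def diff_divide_distrib[symmetric] sum_subtractf[symmetric] algebra_simps)
  note eq = this
  have "\<bar>\<Sum>t=1..n. (dl t \<theta> \<omega> - dl t \<theta>' \<omega>) * (X t \<omega> - \<theta>s)\<bar> \<le> (\<Sum>t=1..n. (K * \<bar>\<theta> - \<theta>'\<bar>) * 1)"
  proof (intro order.trans[OF sum_abs] sum_mono)
    fix t assume "t \<in> {1..n}"
    then have t: "t \<ge> 1" by simp
    show "\<bar>(dl t \<theta> \<omega> - dl t \<theta>' \<omega>) * (X t \<omega> - \<theta>s)\<bar> \<le> (K * \<bar>\<theta> - \<theta>'\<bar>) * 1"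
      unfolding abs_mult[of "_ - _"]
      using good_dl_lipschitz[OF g[rule_format, OF t] nbhd(1,2) \<theta>] centred_le[OF t w] K_ge(5)
      by (intro mult_mono) auto
  qed
  also have "\<dots> = real n * (K * \<bar>\<theta> - \<theta>'\<bar>)" by simp
  finally have "\<bar>D n \<theta> \<omega> - D n \<theta>' \<omega>\<bar> \<le> (real n * (K * \<bar>\<theta> - \<theta>'\<bar>)) / real n"
    unfolding eq abs_divide abs_of_nat by (rule divide_right_mono) simp
  also have "\<dots> \<le> K * \<bar>\<theta> - \<theta>'\<bar>" using K_ge(5) by (cases "n = 0") auto
  finally show ?thesis .
qed

text \<open>Dividing by \<open>\<theta> - \<theta>s\<close> cancels the Lipschitz factor of the
  coefficients, which leaves a bound independent of \<open>\<theta>\<close>. At the true mean the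
  quotient is 0 by the convention for division by zero.\<close>

lemma D_quotient_second_moment:
  assumes \<theta>: "\<theta> \<in> nbhd"
  shows "integrable M (\<lambda>\<omega>. (D n \<theta> \<omega> / (\<theta> - \<theta>s))\<^sup>2)"
    "expectation (\<lambda>\<omega>. (D n \<theta> \<omega> / (\<theta> - \<theta>s))\<^sup>2) \<le> K\<^sup>2 / real n"
proof -
  let ?Z = "\<lambda>t \<omega>. (dl t \<theta> \<omega> - d t \<omega>) / ((\<theta> - \<theta>s) * real n)"
  have eq: "D n \<theta> \<omega> / (\<theta> - \<theta>s) = (\<Sum>t=1..n. ?Z t \<omega> * (X t \<omega> - \<theta>s))" for \<omega>
    by (simp add: D_def sum_divide_distrib mult.commute)
  have *: "integrable M (\<lambda>\<omega>. (\<Sum>t=1..n. ?Z t \<omega> * (X t \<omega> - \<theta>s))\<^sup>2) \<and>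
      expectation (\<lambda>\<omega>. (\<Sum>t=1..n. ?Z t \<omega> * (X t \<omega> - \<theta>s))\<^sup>2) \<le> (\<Sum>t=1..n. (K / real n)\<^sup>2)"
  \<comment> \<open>This \<open>B\<close> is only a pointwise bound for integrability. The sharp
    bound \<open>K / n\<close> on the coefficients holds almost surely and enters through their
    second moments.\<close>
  proof (rule second_moment_transform_le[where h="\<lambda>x. x - \<theta>s" and B="2 * K / (\<bar>\<theta> - \<theta>s\<bar> * real n)"])
    fix t :: nat assume t: "t \<ge> 1"
    show Zh: "?Z t \<in> borel_measurable (hist t)"
      using dl_hist[OF t, of \<theta>] d_hist[OF t] nbhd01[OF \<theta>] by (intro borel_measurable_divide borel_measurable_diff) auto
    have bd: "\<bar>?Z t \<omega>\<bar> \<le> 2 * K / (\<bar>\<theta> - \<theta>s\<bar> * real n)" for \<omega>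
    proof -
      have "\<bar>dl t \<theta> \<omega> - d t \<omega>\<bar> \<le> 2 * K" using dl_le[of t \<theta> \<omega>] dl_le[of t \<theta>s \<omega>] by linarith
      then show ?thesis by (simp add: abs_divide abs_mult divide_right_mono)
    qed
    then show "\<bar>?Z t \<omega>\<bar> \<le> 2 * K / (\<bar>\<theta> - \<theta>s\<bar> * real n)" for \<omega> .
    have "AE \<omega> in M. (?Z t \<omega>)\<^sup>2 \<le> (K / real n)\<^sup>2"
      using AE_good
    proof eventually_elim
      case (elim \<omega>)
      have "\<bar>dl t \<theta> \<omega> - d t \<omega>\<bar> \<le> K * \<bar>\<theta> - \<theta>s\<bar>"
        by (rule good_dl_lipschitz[OF elim[rule_format, OF t] nbhd(1,2) \<theta> nbhd(3)])
      then have "\<bar>?Z t \<omega>\<bar> \<le> (K * \<bar>\<theta> - \<theta>s\<bar>) / (\<bar>\<theta> - \<theta>s\<bar> * real n)"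
        unfolding abs_divide abs_mult abs_of_nat by (rule divide_right_mono) simp
      also have "\<dots> \<le> K / real n" using K_ge(5) by (cases "\<theta> = \<theta>s") auto
      finally have zb: "\<bar>?Z t \<omega>\<bar> \<le> K / real n" .
      show ?case using power_mono[OF zb abs_ge_zero, where n=2] by (simp only: power2_abs)
    qed
    moreover have "integrable M (\<lambda>\<omega>. (?Z t \<omega>)\<^sup>2)"
    proof (rule integrable_const_bound)
      show "AE \<omega> in M. norm ((?Z t \<omega>)\<^sup>2) \<le> (2 * K / (\<bar>\<theta> - \<theta>s\<bar> * real n))\<^sup>2"
        using power_mono[OF bd abs_ge_zero, where n=2] unfolding real_norm_def power_abs by (intro AE_I2)
    qed (use measurable_from_hist[OF Zh] in simp)
    ultimately show "expectation (\<lambda>\<omega>. (?Z t \<omega>)\<^sup>2) \<le> (K / real n)\<^sup>2"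
      by (intro integral_le_const)
  qed (use centred_le centred_expectation(1) in auto)
  have "(\<Sum>t=1..n. (K / real n)\<^sup>2) = K\<^sup>2 / real n" by (simp add: power2_eq_square)
  with * show "integrable M (\<lambda>\<omega>. (D n \<theta> \<omega> / (\<theta> - \<theta>s))\<^sup>2)"
    "expectation (\<lambda>\<omega>. (D n \<theta> \<omega> / (\<theta> - \<theta>s))\<^sup>2) \<le> K\<^sup>2 / real n" unfolding eq by auto
qed

text \<open>
  Any number of grid points between \<open>sqrt n\<close> and \<open>n\<close> works: the mesh must be \<open>o(1 / sqrt n)\<close>,
  and the union bound over the grid costs a factor \<open>grid n / n\<close>.
\<close>

definition grid :: "nat \<Rightarrow> nat" where
  "grid n = nat \<lceil>real n powr (3/4)\<rceil>"

definition pt :: "nat \<Rightarrow> int \<Rightarrow> real" where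
  "pt n k = \<theta>s + rad * real_of_int k / real (grid n)"

lemma grid_bounds: "real n powr (3/4) \<le> real (grid n)" "real (grid n) \<le> real n powr (3/4) + 1"
proof -
  have "real (grid n) = real_of_int \<lceil>real n powr (3/4)\<rceil>"
    unfolding grid_def by (rule of_nat_nat) (simp add: ceiling_le_zero less_le_trans[of "-1" 0])
  then show "real n powr (3/4) \<le> real (grid n)" "real (grid n) \<le> real n powr (3/4) + 1"
    using le_of_int_ceiling[of "real n powr (3/4)"] of_int_ceiling_le_add_one[of "real n powr (3/4)"] by auto
qed

lemma grid_limits: "(\<lambda>n. (2 * real (grid n) + 1) * K\<^sup>2 / real n) \<longlonglongrightarrow> 0"
  "(\<lambda>n. sqrt (real n) * (rad / real (grid n))) \<longlonglongrightarrow> 0"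
proof -
  show "(\<lambda>n. (2 * real (grid n) + 1) * K\<^sup>2 / real n) \<longlonglongrightarrow> 0"
  proof (rule tendsto_sandwich[OF _ _ tendsto_const])
    show "(\<lambda>n. (2 * (real n powr (3/4) + 1) + 1) * K\<^sup>2 / real n) \<longlonglongrightarrow> 0" by real_asymp
    show "\<forall>\<^sub>F n in sequentially. (2 * real (grid n) + 1) * K\<^sup>2 / real n \<le> (2 * (real n powr (3/4) + 1) + 1) * K\<^sup>2 / real n"
    proof (intro always_eventually allI)
      fix n
      have "2 * real (grid n) + 1 \<le> 2 * (real n powr (3/4) + 1) + 1" using grid_bounds(2)[of n] by simp
      then show "(2 * real (grid n) + 1) * K\<^sup>2 / real n \<le> (2 * (real n powr (3/4) + 1) + 1) * K\<^sup>2 / real n"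
        by (intro divide_right_mono mult_right_mono) auto
    qed
  qed auto
  show "(\<lambda>n. sqrt (real n) * (rad / real (grid n))) \<longlonglongrightarrow> 0"
  proof (rule tendsto_sandwich[OF _ _ tendsto_const])
    show "(\<lambda>n. sqrt (real n) * (rad / real n powr (3/4))) \<longlonglongrightarrow> 0" by real_asymp
    show "\<forall>\<^sub>F n in sequentially. sqrt (real n) * (rad / real (grid n)) \<le> sqrt (real n) * (rad / real n powr (3/4))"
      using eventually_gt_at_top[of 0]
    proof eventually_elim
      case (elim n)
      then have "0 < real n powr (3/4)" by simp
      moreover from this have "0 < real (grid n)" using grid_bounds(1)[of n] by linarith
      ultimately show ?case
        using rad(1) grid_bounds(1)[of n] by (intro mult_left_mono divide_left_mono mult_pos_pos) simp_all
    qed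
  qed (use rad(1) in \<open>auto intro!: always_eventually\<close>)
qed

lemma pt_nbhd:
  assumes "k \<in> {- int (grid n)..int (grid n)}" shows "pt n k \<in> nbhd"
proof -
  have "\<bar>real_of_int k\<bar> \<le> real (grid n)"
    using assms by (auto simp: abs_le_iff)
  then have "rad * \<bar>real_of_int k\<bar> / real (grid n) \<le> rad"
    using rad(1) by (cases "grid n = 0") (auto simp: divide_le_eq mult_left_mono)
  then show ?thesis using rad(1) by (simp add: nbhd(4) pt_def abs_mult abs_divide)
qed

text \<open>A sum of squares in place of a maximum over the grid: its expectation is the sum of the
  individual ones, and its square root dominates every quotient simultaneously.\<close>

definition G :: "nat \<Rightarrow> 'a \<Rightarrow> real" where
  "G n \<omega> = (\<Sum>k\<in>{- int (grid n)..int (grid n)}. (D n (pt n k) \<omega> / (pt n k - \<theta>s))\<^sup>2)"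

lemma vanishing_G: "vanishing G"
proof (rule vanishing_L1[OF _ _ grid_limits(1)])
  note sm = D_quotient_second_moment[OF pt_nbhd]
  show "integrable M (G n)" for n
    unfolding G_def[abs_def] by (intro Bochner_Integration.integrable_sum sm(1))
  show "\<forall>\<^sub>F n in sequentially. expectation (\<lambda>\<omega>. \<bar>G n \<omega>\<bar>) \<le> (2 * real (grid n) + 1) * K\<^sup>2 / real n"
  proof (intro always_eventually allI)
    fix n
    have "\<bar>G n \<omega>\<bar> = G n \<omega>" for \<omega> by (simp add: G_def sum_nonneg)
    then have "expectation (\<lambda>\<omega>. \<bar>G n \<omega>\<bar>) = expectation (G n)" by (simp only:)
    also have "\<dots> = (\<Sum>k\<in>{- int (grid n)..int (grid n)}. expectation (\<lambda>\<omega>. (D n (pt n k) \<omega> / (pt n k - \<theta>s))\<^sup>2))"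
      unfolding G_def[abs_def] by (rule Bochner_Integration.integral_sum) (rule sm(1))
    also have "\<dots> \<le> (\<Sum>k\<in>{- int (grid n)..int (grid n)}. K\<^sup>2 / real n)"
      by (intro sum_mono sm(2))
    also have "\<dots> = (2 * real (grid n) + 1) * K\<^sup>2 / real n" by (simp add: nat_add_distrib nat_mult_distrib)
    finally show "expectation (\<lambda>\<omega>. \<bar>G n \<omega>\<bar>) \<le> (2 * real (grid n) + 1) * K\<^sup>2 / real n" .
  qed
qed

text \<open>The grid point obtained by rounding down is within one mesh of \<open>\<theta>\<close>.
  There \<open>G\<close> controls \<open>D\<close>, and the Lipschitz bound transfers this to
  \<open>\<theta>\<close>. As the bound holds for all \<open>\<theta>\<close> in
  \<open>nbhd\<close>, the random estimator may be inserted.\<close>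

lemma D_le:
  assumes g: "\<forall>t\<ge>1. good t \<omega>" and \<theta>: "\<theta> \<in> nbhd" and n: "n \<ge> 1"
  shows "\<bar>D n \<theta> \<omega>\<bar> \<le> sqrt (G n \<omega>) * \<bar>\<theta> - \<theta>s\<bar> + (sqrt (G n \<omega>) + K) * (rad / real (grid n))"
proof -
  have "real n powr (3/4) > 0" using n by simp
  then have N: "real (grid n) > 0" using grid_bounds(1)[of n] by linarith
  define x where "x = (\<theta> - \<theta>s) / rad"
  define k where "k = \<lfloor>x * real (grid n)\<rfloor>"
  have x: "\<bar>x\<bar> \<le> 1" "\<theta> = \<theta>s + rad * x" using \<theta> rad(1) by (auto simp: x_def nbhd(4) abs_divide)
  have xN: "- real (grid n) \<le> x * real (grid n)" "x * real (grid n) \<le> real (grid n)"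
    using x(1) N mult_right_mono[of "-1" x "real (grid n)"] mult_right_mono[of x 1 "real (grid n)"] by auto
  have k: "k \<in> {- int (grid n)..int (grid n)}"
    using xN unfolding k_def by (auto simp: le_floor_iff floor_le_iff)
  have kd: "\<bar>x * real (grid n) - real_of_int k\<bar> \<le> 1"
    unfolding k_def by linarith
  have "\<theta> - pt n k = rad * ((x * real (grid n) - real_of_int k) / real (grid n))"
    using N x(2) by (simp add: pt_def field_simps)
  then have "\<bar>\<theta> - pt n k\<bar> = rad * (\<bar>x * real (grid n) - real_of_int k\<bar> / real (grid n))"
    using rad(1) by (simp add: abs_mult abs_divide)
  also have "\<dots> \<le> rad * (1 / real (grid n))"
    using kd rad(1) by (intro mult_left_mono divide_right_mono) auto
  finally have dist: "\<bar>\<theta> - pt n k\<bar> \<le> rad / real (grid n)" by simp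
  let ?q = "D n (pt n k) \<omega> / (pt n k - \<theta>s)"
  have "?q\<^sup>2 \<le> G n \<omega>"
    unfolding G_def by (rule member_le_sum[OF k]) auto
  then have q: "\<bar>?q\<bar> \<le> sqrt (G n \<omega>)" using real_sqrt_le_mono[of "?q\<^sup>2" "G n \<omega>"] by (simp only: real_sqrt_abs)
  \<comment> \<open>This survives the division by zero at the grid point \<open>\<theta>s\<close>,
    because \<open>D\<close> vanishes there.\<close>
  have "D n (pt n k) \<omega> = ?q * (pt n k - \<theta>s)"
    by (cases "pt n k = \<theta>s") (auto simp: D_def)
  then have "\<bar>D n (pt n k) \<omega>\<bar> = \<bar>?q\<bar> * \<bar>pt n k - \<theta>s\<bar>" by (metis abs_mult)
  also have "\<dots> \<le> sqrt (G n \<omega>) * (\<bar>\<theta> - \<theta>s\<bar> + rad / real (grid n))"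
    using q dist order.trans[OF abs_ge_zero q] by (intro mult_mono) auto
  finally have "\<bar>D n (pt n k) \<omega>\<bar> \<le> sqrt (G n \<omega>) * (\<bar>\<theta> - \<theta>s\<bar> + rad / real (grid n))" .
  moreover have "\<bar>D n \<theta> \<omega> - D n (pt n k) \<omega>\<bar> \<le> K * (rad / real (grid n))"
    using D_lipschitz[OF g \<theta> pt_nbhd[OF k], of n] mult_left_mono[OF dist K_ge(5)] by linarith
  ultimately have "\<bar>D n \<theta> \<omega>\<bar> \<le> sqrt (G n \<omega>) * (\<bar>\<theta> - \<theta>s\<bar> + rad / real (grid n)) + K * (rad / real (grid n))"
    by linarith
  then show ?thesis by (simp add: algebra_simps)
qed

section \<open>Sums of scores at the true mean and nearby\<close>

definition C1 :: real where "C1 = 12 * K^3 * (1 + 1 / \<epsilon>)"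
definition C2 :: real where "C2 = 40 * K^3 * (1 + 1 / \<epsilon> + 1 / \<epsilon>\<^sup>2)"

lemma C_nonneg: "0 \<le> C1" "0 \<le> C2"
  using K_ge(5) A3_away(1) by (auto simp: C1_def C2_def)

lemma sum_abs_diff_le:
  fixes f h e :: "nat \<Rightarrow> real"
  assumes "\<And>t. t \<ge> 1 \<Longrightarrow> \<bar>f t - h t\<bar> \<le> e t"
  shows "\<bar>(\<Sum>t=1..n. f t) - (\<Sum>t=1..n. h t)\<bar> \<le> (\<Sum>t=1..n. e t)"
  unfolding sum_subtractf[symmetric] by (intro order.trans[OF sum_abs] sum_mono assms) auto

definition rem0 :: "nat \<Rightarrow> 'a \<Rightarrow> real" where
  "rem0 n \<omega> = \<bar>(\<Sum>t=1..n. (d t \<omega> + \<beta>) * (X t \<omega> - \<theta>s)) / sqrt (real n)\<bar>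
     + \<beta>\<^sup>2 * \<bar>(\<Sum>t=1..n. mbar t \<omega> * ((X t \<omega> - \<theta>s)\<^sup>2 - \<sigma>\<^sup>2)) / sqrt (real n)\<bar>
     + C1 * ((\<Sum>t=1..n. \<bar>r t \<omega>\<bar>) / sqrt (real n)
       + (\<Sum>t=1..n. \<bar>d t \<omega> + \<beta>\<bar> * \<bar>mbar t \<omega>\<bar>) / sqrt (real n)
       + (\<Sum>t=1..n. (mbar t \<omega>)\<^sup>2) / sqrt (real n))"

lemma vanishing_rem0: "vanishing rem0"
  unfolding rem0_def[abs_def]
  by (intro vanishing_add vanishing_cmult vanishing_abs vanishing_M1 vanishing_M2 vanishing_R vanishing_P vanishing_Q)

text \<open>Summation of \<open>score_expansion\<close> with \<open>v = \<sigma>\<^sup>2\<close>.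
  Replacing the squared observation by its mean costs the transform of \<open>mbar\<close>, the
  second term of \<open>rem0\<close>.\<close>

lemma score_sum_approx:
  assumes g: "\<forall>t\<ge>1. good t \<omega>"
  shows "\<bar>(\<Sum>t=1..n. score t \<theta>s \<omega>) / sqrt (real n) + \<beta> * main_term (1 - \<beta> * \<sigma>\<^sup>2) n \<omega>\<bar> \<le> rem0 n \<omega>"
proof -
  have w: "\<omega> \<in> space M" using g[rule_format, of 1] by (simp add: good_def)
  let ?y = "\<lambda>t. X t \<omega> - \<theta>s" and ?c = "1 - \<beta> * \<sigma>\<^sup>2" and ?s = "sqrt (real n)"
  let ?a = "\<lambda>t. score t \<theta>s \<omega> + \<beta> * (?y t + ?c * mbar t \<omega>)"
  let ?b = "\<lambda>t. (d t \<omega> + \<beta>) * ?y t + \<beta>\<^sup>2 * (mbar t \<omega> * ((?y t)\<^sup>2 - \<sigma>\<^sup>2))"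
  let ?e = "\<lambda>t. C1 * (\<bar>r t \<omega>\<bar> + \<bar>d t \<omega> + \<beta>\<bar> * \<bar>mbar t \<omega>\<bar> + (mbar t \<omega>)\<^sup>2)"
  have *: "\<bar>(\<Sum>t=1..n. ?a t) - (\<Sum>t=1..n. ?b t)\<bar> \<le> (\<Sum>t=1..n. ?e t)"
  proof (rule sum_abs_diff_le)
    fix t :: nat assume t: "t \<ge> 1"
    have gt: "good t \<omega>" using g t by simp
    have "\<epsilon> \<le> 1 + lam t \<theta>s \<omega> * ?y t" using gt A3_nbhd(2) by (simp add: good_def)
    then show "\<bar>?a t - ?b t\<bar> \<le> ?e t"
      unfolding score_def C1_def
      using r_eq[OF t w] good_lam_le[OF gt A3_nbhd(2)] dl_le K_ge mbar_le[OF t w] centred_le[OF t w]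
        centred_square_le[OF t w] var_bounds A3_away(1)
      by (intro score_expansion) auto
  qed
  have "(\<Sum>t=1..n. score t \<theta>s \<omega>) / ?s + \<beta> * main_term ?c n \<omega> = (\<Sum>t=1..n. ?a t) / ?s"
    by (simp only: main_term_def sum.distrib sum_distrib_left[symmetric]) (simp add: add_divide_distrib distrib_left)
  also have "(\<Sum>t=1..n. ?a t) = ((\<Sum>t=1..n. ?a t) - (\<Sum>t=1..n. ?b t)) + (\<Sum>t=1..n. ?b t)" by simp
  finally have "\<bar>(\<Sum>t=1..n. score t \<theta>s \<omega>) / ?s + \<beta> * main_term ?c n \<omega>\<bar>
      \<le> \<bar>(\<Sum>t=1..n. ?a t) - (\<Sum>t=1..n. ?b t)\<bar> / ?s + \<bar>(\<Sum>t=1..n. ?b t) / ?s\<bar>"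
    by (simp only: add_divide_distrib abs_divide) (rule order.trans[OF abs_triangle_ineq], simp add: abs_divide)
  also have "\<bar>(\<Sum>t=1..n. ?a t) - (\<Sum>t=1..n. ?b t)\<bar> / ?s \<le> (\<Sum>t=1..n. ?e t) / ?s"
    using * by (intro divide_right_mono) auto
  also have "(\<Sum>t=1..n. ?e t) / ?s = C1 * ((\<Sum>t=1..n. \<bar>r t \<omega>\<bar>) / ?s
       + (\<Sum>t=1..n. \<bar>d t \<omega> + \<beta>\<bar> * \<bar>mbar t \<omega>\<bar>) / ?s + (\<Sum>t=1..n. (mbar t \<omega>)\<^sup>2) / ?s)"
    by (simp only: sum.distrib sum_distrib_left[symmetric] add_divide_distrib times_divide_eq_right[symmetric])
  also have "(\<Sum>t=1..n. ?b t) / ?s = (\<Sum>t=1..n. (d t \<omega> + \<beta>) * ?y t) / ?s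
      + \<beta>\<^sup>2 * ((\<Sum>t=1..n. mbar t \<omega> * ((?y t)\<^sup>2 - \<sigma>\<^sup>2)) / ?s)"
    by (simp only: sum.distrib sum_distrib_left[symmetric] add_divide_distrib times_divide_eq_right[symmetric])
  also have "\<bar>\<dots>\<bar> \<le> \<bar>(\<Sum>t=1..n. (d t \<omega> + \<beta>) * ?y t) / ?s\<bar>
      + \<beta>\<^sup>2 * \<bar>(\<Sum>t=1..n. mbar t \<omega> * ((?y t)\<^sup>2 - \<sigma>\<^sup>2)) / ?s\<bar>"
    by (rule order.trans[OF abs_triangle_ineq]) (simp add: abs_mult)
  finally show ?thesis unfolding rem0_def by linarith
qed

text \<open>Summation of \<open>score_increment\<close>, where the squared observations are split
  into \<open>\<sigma>\<^sup>2\<close>, which belongs to the drift, and a centred part obeying a law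
  of large numbers. The right-hand side keeps the factor
  \<open>\<bar>\<theta> - \<theta>s\<bar>\<close>, so that after scaling it becomes a small multiple
  of \<open>U\<close>.\<close>

lemma score_sum_increment:
  assumes g: "\<forall>t\<ge>1. good t \<omega>" and \<theta>: "\<theta> \<in> nbhd" and n: "n \<ge> 1"
  shows "\<bar>(\<Sum>t=1..n. score t \<theta> \<omega>) - (\<Sum>t=1..n. score t \<theta>s \<omega>)
      - real n * (D n \<theta> \<omega> + (\<theta> - \<theta>s) * (2 * \<beta> - \<beta>\<^sup>2 * \<sigma>\<^sup>2
          - \<beta>\<^sup>2 * ((\<Sum>t=1..n. (X t \<omega> - \<theta>s)\<^sup>2 - \<sigma>\<^sup>2) / real n)))\<bar>
    \<le> real n * (C2 * \<bar>\<theta> - \<theta>s\<bar> * (\<beta> * ((\<Sum>t=1..n. \<bar>mbar t \<omega>\<bar>) / real n) + (\<Sum>t=1..n. \<bar>r t \<omega>\<bar>) / real n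
        + (\<Sum>t=1..n. \<bar>d t \<omega> + \<beta>\<bar>) / real n + \<bar>\<theta> - \<theta>s\<bar>))"
proof -
  have w: "\<omega> \<in> space M" using g[rule_format, of 1] by (simp add: good_def)
  let ?y = "\<lambda>t. X t \<omega> - \<theta>s" and ?h = "\<theta> - \<theta>s"
  let ?a = "\<lambda>t. score t \<theta> \<omega> - score t \<theta>s \<omega>"
  let ?b = "\<lambda>t. (dl t \<theta> \<omega> - d t \<omega>) * ?y t + (2 * \<beta> * ?h - \<beta>\<^sup>2 * ?h * \<sigma>\<^sup>2) - \<beta>\<^sup>2 * ?h * ((?y t)\<^sup>2 - \<sigma>\<^sup>2)"
  let ?e = "\<lambda>t. C2 * \<bar>?h\<bar> * (\<beta> * \<bar>mbar t \<omega>\<bar> + \<bar>r t \<omega>\<bar> + \<bar>d t \<omega> + \<beta>\<bar> + \<bar>?h\<bar>)"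
  have *: "\<bar>(\<Sum>t=1..n. ?a t) - (\<Sum>t=1..n. ?b t)\<bar> \<le> (\<Sum>t=1..n. ?e t)"
  proof (rule sum_abs_diff_le)
    fix t :: nat assume t: "t \<ge> 1"
    have gt: "good t \<omega>" using g t by simp
    have \<theta>0: "\<theta> \<in> \<Theta>\<^sub>0" using \<theta> nbhd(2) by auto
    have yh: "?y t - ?h = X t \<omega> - \<theta>" by simp
    have 1: "\<epsilon> \<le> 1 + lam t \<theta>s \<omega> * ?y t" "\<epsilon> \<le> 1 + lam t \<theta> \<omega> * (?y t - ?h)"
      using gt A3_nbhd(2) \<theta>0 unfolding yh by (simp_all add: good_def)
    have 2: "\<bar>?y t - ?h\<bar> \<le> 1" unfolding yh using range[OF t w] nbhd01[OF \<theta>] by (auto simp: abs_le_iff)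
    have A: "\<bar>(dl t \<theta> \<omega> * (?y t - ?h) - lam t \<theta> \<omega>) / (1 + lam t \<theta> \<omega> * (?y t - ?h)) - (d t \<omega> * ?y t - lam t \<theta>s \<omega>) / (1 + lam t \<theta>s \<omega> * ?y t)
      - ((dl t \<theta> \<omega> - d t \<omega>) * ?y t + 2 * \<beta> * ?h - \<beta>\<^sup>2 * (?y t)\<^sup>2 * ?h)\<bar>
      \<le> C2 * \<bar>?h\<bar> * (\<bar>lam t \<theta>s \<omega>\<bar> + \<bar>d t \<omega> + \<beta>\<bar> + \<bar>?h\<bar>)"
      unfolding C2_def
      by (rule score_increment[OF good_lam_le[OF gt A3_nbhd(2)] dl_le dl_le good_lam_le[OF gt \<theta>0] K_ge(4,1)
        good_dl_lipschitz[OF gt nbhd(1,2) \<theta> nbhd(3)] good_lam_lipschitz[OF gt nbhd(1,2) \<theta> nbhd(3)]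
        good_lam_taylor[OF gt nbhd(1,2) nbhd(3) \<theta>] centred_le[OF t w] 2 A3_away(1) 1])
    have "\<bar>lam t \<theta>s \<omega>\<bar> \<le> \<beta> * \<bar>mbar t \<omega>\<bar> + \<bar>r t \<omega>\<bar>"
      unfolding r_eq[OF t w] using beta_pos by (intro order.trans[OF abs_triangle_ineq]) (simp add: abs_mult)
    then have B: "C2 * \<bar>?h\<bar> * (\<bar>lam t \<theta>s \<omega>\<bar> + \<bar>d t \<omega> + \<beta>\<bar> + \<bar>?h\<bar>) \<le> ?e t"
      using C_nonneg by (intro mult_left_mono) auto
    have C: "?b t = (dl t \<theta> \<omega> - d t \<omega>) * ?y t + 2 * \<beta> * ?h - \<beta>\<^sup>2 * (?y t)\<^sup>2 * ?h"
      by (simp add: algebra_simps)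
    from order.trans[OF A B] show "\<bar>?a t - ?b t\<bar> \<le> ?e t"
      by (simp only: score_def C yh)
  qed
  have n0: "real n > 0" using n by simp
  have b: "(\<Sum>t=1..n. ?b t) = real n * (D n \<theta> \<omega> + ?h * (2 * \<beta> - \<beta>\<^sup>2 * \<sigma>\<^sup>2
          - \<beta>\<^sup>2 * ((\<Sum>t=1..n. (?y t)\<^sup>2 - \<sigma>\<^sup>2) / real n)))"
  proof -
    have "(\<Sum>t=1..n. ?b t) = (\<Sum>t=1..n. (dl t \<theta> \<omega> - d t \<omega>) * ?y t) + real n * (2 * \<beta> * ?h - \<beta>\<^sup>2 * ?h * \<sigma>\<^sup>2)
        - \<beta>\<^sup>2 * ?h * (\<Sum>t=1..n. (?y t)\<^sup>2 - \<sigma>\<^sup>2)"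
      by (simp only: sum.distrib sum_subtractf[of _ "\<lambda>t. \<beta>\<^sup>2 * ?h * _ t"] sum_distrib_left[symmetric] sum_constant) (simp add: algebra_simps)
    also have "(\<Sum>t=1..n. (dl t \<theta> \<omega> - d t \<omega>) * ?y t) = real n * D n \<theta> \<omega>" using n0 by (simp add: D_def)
    also have "\<beta>\<^sup>2 * ?h * (\<Sum>t=1..n. (?y t)\<^sup>2 - \<sigma>\<^sup>2) = real n * (\<beta>\<^sup>2 * ?h * ((\<Sum>t=1..n. (?y t)\<^sup>2 - \<sigma>\<^sup>2) / real n))"
      using n0 by simp
    finally show ?thesis by (simp only: algebra_simps)
  qed
  have e: "(\<Sum>t=1..n. ?e t) = real n * (C2 * \<bar>?h\<bar> * (\<beta> * ((\<Sum>t=1..n. \<bar>mbar t \<omega>\<bar>) / real n) + (\<Sum>t=1..n. \<bar>r t \<omega>\<bar>) / real n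
        + (\<Sum>t=1..n. \<bar>d t \<omega> + \<beta>\<bar>) / real n + \<bar>?h\<bar>))"
  proof -
    have "(\<Sum>t=1..n. ?e t) = C2 * \<bar>?h\<bar> * (\<beta> * (\<Sum>t=1..n. \<bar>mbar t \<omega>\<bar>) + (\<Sum>t=1..n. \<bar>r t \<omega>\<bar>)
        + (\<Sum>t=1..n. \<bar>d t \<omega> + \<beta>\<bar>) + real n * \<bar>?h\<bar>)"
      by (simp only: sum.distrib sum_distrib_left[symmetric] sum_constant card_atLeastAtMost) simp
    moreover have "c * (b * x + y + z + m * u) = m * (c * (b * (x / m) + y / m + z / m + u))"
      if "m > 0" for b c m u x y z :: real
      using that by (simp add: field_simps)
    ultimately show ?thesis using n0 by (simp only:)
  qed
  have a: "(\<Sum>t=1..n. ?a t) = (\<Sum>t=1..n. score t \<theta> \<omega>) - (\<Sum>t=1..n. score t \<theta>s \<omega>)"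
    by (rule sum_subtractf)
  show ?thesis using * unfolding a b e .
qed

end

section \<open>Asymptotic normality\<close>

lemma char_normal_density:
  assumes "\<tau> > 0"
  shows "char (density lborel (normal_density 0 \<tau>)) t = exp (- (t\<^sup>2 * \<tau>\<^sup>2 / 2))"
proof -
  interpret N: prob_space std_normal_distribution by (rule prob_space_normal_density) simp
  have "distributed std_normal_distribution lborel (\<lambda>x. x) std_normal_density"
    unfolding distributed_def by (auto simp: distr_id2)
  from N.normal_density_affine[OF this, of \<tau> 0] assms
  have "distr std_normal_distribution lborel (\<lambda>x. \<tau> * x) = density lborel (normal_density 0 \<tau>)"
    by (simp add: distributed_def)
  then have "char (density lborel (normal_density 0 \<tau>)) t = char (distr std_normal_distribution lborel (\<lambda>x. \<tau> * x)) t"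
    by simp
  also have "\<dots> = char std_normal_distribution (t * \<tau>)"
    unfolding char_def by (subst integral_distr) (auto simp: mult.assoc)
  also have "\<dots> = exp (- (t\<^sup>2 * \<tau>\<^sup>2 / 2))"
    by (simp add: char_std_normal_distribution power_mult_distrib)
  finally show ?thesis .
qed

context me_setting begin

definition U :: "nat \<Rightarrow> 'a \<Rightarrow> real" where
  "U n \<omega> = sqrt (real n) * (est n \<omega> - \<theta>s)"

text \<open>The estimator is constrained only for \<open>n \<ge> 1\<close>; the value 0 at
  \<open>n = 0\<close> makes the whole sequence measurable, as \<open>vanishing\<close>
  demands.\<close>

definition dev :: "nat \<Rightarrow> 'a \<Rightarrow> real" where
  "dev n \<omega> = (if n = 0 then 0 else est n \<omega> - \<theta>s)"

lemma est_measurable [measurable]: "n \<ge> 1 \<Longrightarrow> est n \<in> borel_measurable M"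
  using estimator by (auto simp: ME_estimator_def)

lemma U_measurable [measurable]: "U n \<in> borel_measurable M"
proof (cases "n = 0")
  case False
  then have [measurable]: "est n \<in> borel_measurable M" by (intro est_measurable) simp
  show ?thesis unfolding U_def[abs_def] by measurable
qed (simp add: U_def[abs_def])

lemma vanishing_dev: "vanishing dev"
proof (rule vanishingI)
  show "dev n \<in> borel_measurable M" for n
    by (cases "n = 0") (auto simp: dev_def[abs_def] intro!: borel_measurable_diff est_measurable)
  fix \<delta> :: real assume "\<delta> > 0"
  then have "(\<lambda>n. prob {\<omega>\<in>space M. \<bar>est n \<omega> - \<theta>s\<bar> > \<delta>}) \<longlonglongrightarrow> 0"
    using consistent by (auto simp: tendsto_in_prob_def)
  moreover have "\<forall>\<^sub>F n in sequentially. prob {\<omega>\<in>space M. \<bar>est n \<omega> - \<theta>s\<bar> > \<delta>} = prob {\<omega>\<in>space M. \<bar>dev n \<omega>\<bar> > \<delta>}"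
    using eventually_gt_at_top[of 0] by eventually_elim (simp add: dev_def)
  ultimately show "(\<lambda>n. prob {\<omega>\<in>space M. \<bar>dev n \<omega>\<bar> > \<delta>}) \<longlonglongrightarrow> 0"
    by (rule Lim_transform_eventually)
qed

text \<open>The relative error, which multiplies \<open>U\<close>. The average of the residuals is
  written as their sum over \<open>sqrt n\<close> times a further \<open>1 / sqrt n\<close>, to
  match the normalisation of the residual hypothesis.\<close>

definition kap :: "nat \<Rightarrow> 'a \<Rightarrow> real" where
  "kap n \<omega> = (1 / \<beta>) * (\<beta>\<^sup>2 * \<bar>(\<Sum>t=1..n. (X t \<omega> - \<theta>s)\<^sup>2 - \<sigma>\<^sup>2) / real n\<bar>
     + C2 * (\<beta> * ((\<Sum>t=1..n. \<bar>mbar t \<omega>\<bar>) / real n) + ((\<Sum>t=1..n. \<bar>r t \<omega>\<bar>) / sqrt (real n)) * (1 / sqrt (real n))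
        + (\<Sum>t=1..n. \<bar>d t \<omega> + \<beta>\<bar>) / real n + \<bar>dev n \<omega>\<bar>)
     + sqrt \<bar>G n \<omega>\<bar>)"

text \<open>The absolute error: the expansion at the true mean and the cost of moving to the grid,
  where the mesh is multiplied by \<open>sqrt n\<close>.\<close>

definition rho :: "nat \<Rightarrow> 'a \<Rightarrow> real" where
  "rho n \<omega> = (1 / \<beta>) * (rem0 n \<omega> + sqrt \<bar>G n \<omega>\<bar> * (sqrt (real n) * (rad / real (grid n)))
     + K * (sqrt (real n) * (rad / real (grid n))))"

lemma vanishing_kap: "vanishing kap"
proof -
  have "(\<lambda>n. 1 / sqrt (real n)) \<longlonglongrightarrow> 0" by real_asymp
  then show ?thesis
    unfolding kap_def[abs_def]
    by (intro vanishing_cmult vanishing_add vanishing_abs vanishing_const_mult vanishing_sqrt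
        vanishing_V vanishing_A vanishing_R vanishing_B vanishing_dev vanishing_G)
qed

lemma vanishing_rho: "vanishing rho"
  unfolding rho_def[abs_def]
  by (intro vanishing_cmult vanishing_add vanishing_const_mult vanishing_const vanishing_sqrt
      vanishing_rem0 vanishing_G grid_limits(2))

text \<open>At the estimator the sum of scores is 0, so the increment from the true mean equals
  minus the sum there. Dividing by \<open>sqrt n\<close> and by \<open>\<beta>\<close> and
  collecting the bounds gives a linear equation for \<open>U\<close> up to the two errors.\<close>

lemma linearization:
  assumes n: "n \<ge> 1" and g: "\<forall>t\<ge>1. good t \<omega>"
    and min: "is_arg_min (log_wealth X lam n \<omega>) (\<lambda>\<theta>. \<theta> \<in> {0..1}) (est n \<omega>)"
    and dev: "\<bar>dev n \<omega>\<bar> \<le> rad"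
  shows "\<bar>(2 - \<beta> * \<sigma>\<^sup>2) * U n \<omega> - main_term (1 - \<beta> * \<sigma>\<^sup>2) n \<omega>\<bar> \<le> kap n \<omega> * \<bar>U n \<omega>\<bar> + rho n \<omega>"
proof -
  define x where "x = est n \<omega> - \<theta>s"
  define s where "s = sqrt (real n)"
  have s: "s > 0" "real n = s * s" using n by (auto simp: s_def)
  have dx: "dev n \<omega> = x" using n by (simp add: dev_def x_def)
  have \<theta>: "est n \<omega> \<in> nbhd" using dev dx by (simp add: nbhd(4) x_def)
  define V where "V = (\<Sum>t=1..n. (X t \<omega> - \<theta>s)\<^sup>2 - \<sigma>\<^sup>2) / real n"
  define A where "A = \<beta> * ((\<Sum>t=1..n. \<bar>mbar t \<omega>\<bar>) / real n) + (\<Sum>t=1..n. \<bar>r t \<omega>\<bar>) / real n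
        + (\<Sum>t=1..n. \<bar>d t \<omega> + \<beta>\<bar>) / real n + \<bar>x\<bar>"
  define S where "S = (\<Sum>t=1..n. score t \<theta>s \<omega>)"
  define T where "T = main_term (1 - \<beta> * \<sigma>\<^sup>2) n \<omega>"
  define q where "q = sqrt \<bar>G n \<omega>\<bar>"
  define m where "m = rad / real (grid n)"
  define Dn where "Dn = D n (est n \<omega>) \<omega>"
  define u where "u = U n \<omega>"
  have u: "u = s * x" by (simp add: u_def U_def s_def x_def)
  have G: "sqrt (G n \<omega>) = q" by (simp add: q_def G_def sum_nonneg)
  have zero: "(\<Sum>t=1..n. score t (est n \<omega>) \<omega>) = 0"
    by (rule score_sum_zero[OF g _ min]) (use \<theta> nbhd(2) in auto)
  have inc: "\<bar>- S - s * s * (Dn + x * (2 * \<beta> - \<beta>\<^sup>2 * \<sigma>\<^sup>2 - \<beta>\<^sup>2 * V))\<bar> \<le> s * s * (C2 * \<bar>x\<bar> * A)"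
    using score_sum_increment[OF g \<theta> n] unfolding zero by (simp add: S_def s(2)[symmetric] Dn_def V_def A_def x_def)
  have approx: "\<bar>S / s + \<beta> * T\<bar> \<le> rem0 n \<omega>"
    using score_sum_approx[OF g, of n] by (simp add: S_def s_def T_def)
  have Dle: "\<bar>Dn\<bar> \<le> q * \<bar>x\<bar> + (q + K) * m"
    using D_le[OF g \<theta> n] by (simp add: Dn_def G x_def m_def)
  have inc': "\<bar>S / s + s * Dn + u * (2 * \<beta> - \<beta>\<^sup>2 * \<sigma>\<^sup>2 - \<beta>\<^sup>2 * V)\<bar> \<le> C2 * A * \<bar>u\<bar>"
  proof -
    have "S / s + s * Dn + u * (2 * \<beta> - \<beta>\<^sup>2 * \<sigma>\<^sup>2 - \<beta>\<^sup>2 * V)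
        = - (- S - s * s * (Dn + x * (2 * \<beta> - \<beta>\<^sup>2 * \<sigma>\<^sup>2 - \<beta>\<^sup>2 * V))) / s"
      using s(1) by (simp add: u field_simps)
    then have "\<bar>S / s + s * Dn + u * (2 * \<beta> - \<beta>\<^sup>2 * \<sigma>\<^sup>2 - \<beta>\<^sup>2 * V)\<bar>
        = \<bar>- S - s * s * (Dn + x * (2 * \<beta> - \<beta>\<^sup>2 * \<sigma>\<^sup>2 - \<beta>\<^sup>2 * V))\<bar> / s"
      using s(1) by (simp only: abs_divide abs_minus_cancel)
    also have "\<dots> \<le> s * s * (C2 * \<bar>x\<bar> * A) / s" using inc s(1) by (intro divide_right_mono) auto
    also have "\<dots> = C2 * A * \<bar>u\<bar>" using s(1) by (simp add: u abs_mult)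
    finally show ?thesis .
  qed
  have eq: "\<beta> * ((2 - \<beta> * \<sigma>\<^sup>2) * u - T) = (S / s + s * Dn + u * (2 * \<beta> - \<beta>\<^sup>2 * \<sigma>\<^sup>2 - \<beta>\<^sup>2 * V))
      - (S / s + \<beta> * T) - s * Dn + \<beta>\<^sup>2 * V * u"
    by (simp add: algebra_simps power2_eq_square)
  have sD: "\<bar>s * Dn\<bar> \<le> q * \<bar>u\<bar> + (q * (s * m) + K * (s * m))"
    using mult_left_mono[OF Dle, of s] s(1) by (simp add: u abs_mult algebra_simps)
  have "\<bar>\<beta> * ((2 - \<beta> * \<sigma>\<^sup>2) * u - T)\<bar> \<le> C2 * A * \<bar>u\<bar> + rem0 n \<omega> + (q * \<bar>u\<bar> + (q * (s * m) + K * (s * m)))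
      + \<bar>\<beta>\<^sup>2 * V * u\<bar>"
    unfolding eq using inc' approx sD by linarith
  also have "\<dots> = (\<beta>\<^sup>2 * \<bar>V\<bar> + C2 * A + q) * \<bar>u\<bar> + (rem0 n \<omega> + q * (s * m) + K * (s * m))"
    by (simp add: abs_mult algebra_simps)
  finally have "\<beta> * \<bar>(2 - \<beta> * \<sigma>\<^sup>2) * u - T\<bar> \<le> (\<beta>\<^sup>2 * \<bar>V\<bar> + C2 * A + q) * \<bar>u\<bar> + (rem0 n \<omega> + q * (s * m) + K * (s * m))"
    unfolding abs_mult[of \<beta>] abs_of_pos[OF beta_pos] .
  then have "\<bar>(2 - \<beta> * \<sigma>\<^sup>2) * u - T\<bar> \<le> ((\<beta>\<^sup>2 * \<bar>V\<bar> + C2 * A + q) * \<bar>u\<bar> + (rem0 n \<omega> + q * (s * m) + K * (s * m))) / \<beta>"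
    using beta_pos by (simp add: pos_le_divide_eq mult.commute)
  also have "\<dots> = (1 / \<beta>) * (\<beta>\<^sup>2 * \<bar>V\<bar> + C2 * A + q) * \<bar>u\<bar> + (1 / \<beta>) * (rem0 n \<omega> + q * (s * m) + K * (s * m))"
    by (simp add: divide_inverse algebra_simps)
  also have "(1 / \<beta>) * (\<beta>\<^sup>2 * \<bar>V\<bar> + C2 * A + q) = kap n \<omega>"
  proof -
    have "y / real n = y / sqrt (real n) * (1 / sqrt (real n))" for y by simp
    from this[of "\<Sum>t=1..n. \<bar>r t \<omega>\<bar>"] show ?thesis
      unfolding kap_def V_def A_def q_def dx by (simp only:)
  qed
  also have "(1 / \<beta>) * (rem0 n \<omega> + q * (s * m) + K * (s * m)) = rho n \<omega>"
    unfolding rho_def q_def s_def m_def ..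
  finally show ?thesis unfolding u_def T_def .
qed

text \<open>The upper bound on \<open>\<beta>\<close> makes the slope positive, and consistency
  confines the estimator to \<open>nbhd\<close> with probability tending to 1.\<close>

lemma vanishing_difference:
  assumes "\<beta> < 2 / \<sigma>\<^sup>2"
  shows "vanishing (\<lambda>n \<omega>. U n \<omega> - main_term (1 - \<beta> * \<sigma>\<^sup>2) n \<omega> / (2 - \<beta> * \<sigma>\<^sup>2))"
proof (rule vanishing_linearization[OF vanishing_kap vanishing_rho vanishing_dev _ rad(1)])
  show "2 - \<beta> * \<sigma>\<^sup>2 > 0" using assms var_pos by (simp add: field_simps)
  show "\<forall>\<^sub>F n in sequentially. AE \<omega> in M. \<bar>dev n \<omega>\<bar> \<le> rad \<longrightarrow>
      \<bar>(2 - \<beta> * \<sigma>\<^sup>2) * U n \<omega> - main_term (1 - \<beta> * \<sigma>\<^sup>2) n \<omega>\<bar> \<le> \<bar>kap n \<omega>\<bar> * \<bar>U n \<omega>\<bar> + \<bar>rho n \<omega>\<bar>"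
    using eventually_ge_at_top[of 1]
  proof eventually_elim
    case (elim n)
    then have "AE \<omega> in M. is_arg_min (log_wealth X lam n \<omega>) (\<lambda>\<theta>. \<theta> \<in> {0..1}) (est n \<omega>)"
      using estimator by (auto simp: ME_estimator_def)
    with AE_good show ?case
    proof (eventually_elim, intro impI)
      fix \<omega>
      assume "\<forall>t\<ge>1. good t \<omega>" "is_arg_min (log_wealth X lam n \<omega>) (\<lambda>\<theta>. \<theta> \<in> {0..1}) (est n \<omega>)"
        "\<bar>dev n \<omega>\<bar> \<le> rad"
      from linearization[OF elim this] mult_right_mono[OF abs_ge_self abs_ge_zero, of "kap n \<omega>" "U n \<omega>"]
        abs_ge_self[of "rho n \<omega>"]
      show "\<bar>(2 - \<beta> * \<sigma>\<^sup>2) * U n \<omega> - main_term (1 - \<beta> * \<sigma>\<^sup>2) n \<omega>\<bar> \<le> \<bar>kap n \<omega>\<bar> * \<bar>U n \<omega>\<bar> + \<bar>rho n \<omega>\<bar>"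
        by (meson add_mono order.trans)
    qed
  qed
qed (use main_term_second_moment in auto)

lemma asymptotic_normality:
  assumes "\<beta> < 2 / \<sigma>\<^sup>2"
  shows "weak_conv_m (\<lambda>n. distr M borel (U n))
    (density lborel (normal_density 0
       (sqrt (\<sigma>\<^sup>2 * (5 - 6 * \<beta> * \<sigma>\<^sup>2 + 2 * \<beta>\<^sup>2 * \<sigma>^4) / (2 - \<beta> * \<sigma>\<^sup>2)\<^sup>2))))"
proof -
  define c where "c = 1 - \<beta> * \<sigma>\<^sup>2"
  define \<gamma> where "\<gamma> = 2 - \<beta> * \<sigma>\<^sup>2"
  define v where "v = \<sigma>\<^sup>2 * (1 + 2 * c + 2 * c\<^sup>2)"
  have \<gamma>: "\<gamma> > 0" using assms var_pos by (simp add: \<gamma>_def field_simps)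
  \<comment> \<open>The two squares cannot vanish together, so the limiting variance is positive and
    the normal density is non-degenerate.\<close>
  have "1 + 2 * c + 2 * c\<^sup>2 = c\<^sup>2 + (1 + c)\<^sup>2" by (simp add: power2_sum)
  also have "\<dots> > 0" by (cases "c = 0") (auto intro: add_pos_nonneg)
  finally have v: "v > 0" using var_pos by (simp add: v_def)
  have v_eq: "\<sigma>\<^sup>2 * (5 - 6 * \<beta> * \<sigma>\<^sup>2 + 2 * \<beta>\<^sup>2 * \<sigma>^4) = v"
    by (simp add: v_def c_def algebra_simps power2_eq_square power4_eq_xxxx)
  have \<tau>: "sqrt (v / \<gamma>\<^sup>2) > 0" "(sqrt (v / \<gamma>\<^sup>2))\<^sup>2 = v / \<gamma>\<^sup>2" using v \<gamma> by auto
  have "weak_conv_m (\<lambda>n. distr M borel (U n)) (density lborel (normal_density 0 (sqrt (v / \<gamma>\<^sup>2))))"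
  proof (rule levy_continuity)
    show "real_distribution (distr M borel (U n))" for n by (rule real_distribution_distr) simp
    show "real_distribution (density lborel (normal_density 0 (sqrt (v / \<gamma>\<^sup>2))))"
      using prob_space_normal_density[OF \<tau>(1)] by (auto simp: real_distribution_def real_distribution_axioms_def)
    fix t
    have "(\<lambda>n. char (distr M borel (\<lambda>\<omega>. main_term c n \<omega> / \<gamma>)) t) \<longlonglongrightarrow> exp (- ((t / \<gamma>)\<^sup>2 * v / 2))"
    proof -
      have "char (distr M borel (\<lambda>\<omega>. main_term c n \<omega> / \<gamma>)) t = char (distr M borel (main_term c n)) (t / \<gamma>)" for n
        unfolding char_def by (subst (1 2) integral_distr) auto
      then show ?thesis using char_main_term_tendsto[of c "t / \<gamma>"] by (simp add: v_def)
    qed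
    then have "(\<lambda>n. char (distr M borel (U n)) t) \<longlonglongrightarrow> exp (- ((t / \<gamma>)\<^sup>2 * v / 2))"
      by (rule char_tendsto_of_vanishing[OF vanishing_difference[OF assms, folded c_def \<gamma>_def], rotated 2]) simp_all
    then show "(\<lambda>n. char (distr M borel (U n)) t) \<longlonglongrightarrow> char (density lborel (normal_density 0 (sqrt (v / \<gamma>\<^sup>2)))) t"
      unfolding char_normal_density[OF \<tau>(1)] \<tau>(2) by (simp add: power_divide)
  qed
  then show ?thesis unfolding v_eq \<gamma>_def .
qed

end

theorem theorem3p4:
  fixes M :: "'a measure"
    and X :: "nat \<Rightarrow> 'a \<Rightarrow> real"
    and lam :: "nat \<Rightarrow> real \<Rightarrow> 'a \<Rightarrow> real"
    and est :: "nat \<Rightarrow> 'a \<Rightarrow> real"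
    and r :: "nat \<Rightarrow> 'a \<Rightarrow> real"
    and \<Theta>\<^sub>0 :: "real set"
    and \<theta>s \<sigma> \<beta> L \<epsilon> :: real
  assumes prob: "prob_space M"
    and indep: "prob_space.indep_vars M (\<lambda>_. borel) X {1..}"
    and ident: "\<And>t. t \<ge> 1 \<Longrightarrow> distr M borel (X t) = distr M borel (X 1)"
    and range: "\<And>t \<omega>. t \<ge> 1 \<Longrightarrow> \<omega> \<in> space M \<Longrightarrow> X t \<omega> \<in> {0..1}"
    and mean: "prob_space.expectation M (X 1) = \<theta>s"
    and var: "prob_space.variance M (X 1) = \<sigma>\<^sup>2"
    and var_pos: "\<sigma>\<^sup>2 > 0"
    and interior: "\<theta>s \<in> {0<..<1}"
    and strategy: "betting_strategy M X lam"
    and smooth: "\<And>t. t \<ge> 1 \<Longrightarrow> AE \<omega> in M. C2_on (\<lambda>\<theta>. lam t \<theta> \<omega>) {0<..<1}"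
    and estimator: "ME_estimator M X lam est"
    and consistent: "tendsto_in_prob M est \<theta>s"
    and beta_pos: "\<beta> > 0"
    and A1_deriv: "tendsto_L2 M (\<lambda>t \<omega>. deriv (\<lambda>\<theta>. lam t \<theta> \<omega>) \<theta>s) (- \<beta>)"
    and A1_deriv2: "bounded_in_prob M
          (\<lambda>n \<omega>. (\<Sum>t=1..n. \<bar>deriv (deriv (\<lambda>\<theta>. lam t \<theta> \<omega>)) \<theta>s\<bar>) / real n)"
    and A2_expansion: "\<And>t \<omega>. t \<ge> 1 \<Longrightarrow> \<omega> \<in> space M \<Longrightarrow>
          lam t \<theta>s \<omega> = \<beta> * (prev_mean X \<theta>s t \<omega> - \<theta>s) + r t \<omega>"
    and A2_residual: "tendsto_in_prob M (\<lambda>n \<omega>. (\<Sum>t=1..n. \<bar>r t \<omega>\<bar>) / sqrt (real n)) 0"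
    and A3_nbhd: "open \<Theta>\<^sub>0" "\<theta>s \<in> \<Theta>\<^sub>0" "\<Theta>\<^sub>0 \<subseteq> {0<..<1}"
    and A3_bound: "\<And>t. t \<ge> 1 \<Longrightarrow> AE \<omega> in M. \<forall>\<theta>\<in>\<Theta>\<^sub>0.
          \<bar>lam t \<theta> \<omega>\<bar> + \<bar>deriv (\<lambda>\<theta>. lam t \<theta> \<omega>) \<theta>\<bar>
            + \<bar>deriv (deriv (\<lambda>\<theta>. lam t \<theta> \<omega>)) \<theta>\<bar> \<le> L"
    and A3_away: "\<epsilon> > 0"
          "\<And>t. t \<ge> 1 \<Longrightarrow> AE \<omega> in M. \<forall>\<theta>\<in>\<Theta>\<^sub>0. 1 + lam t \<theta> \<omega> * (X t \<omega> - \<theta>) \<ge> \<epsilon>"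
    and beta_less: "\<beta> < 2 / \<sigma>\<^sup>2"
  shows "weak_conv_m
           (\<lambda>n. distr M borel (\<lambda>\<omega>. sqrt (real n) * (est n \<omega> - \<theta>s)))
           (density lborel (normal_density 0
              (sqrt (\<sigma>\<^sup>2 * (5 - 6 * \<beta> * \<sigma>\<^sup>2 + 2 * \<beta>\<^sup>2 * \<sigma>^4) / (2 - \<beta> * \<sigma>\<^sup>2)\<^sup>2))))"
proof -
  interpret P: prob_space M by (rule prob)
  interpret me_setting M X \<theta>s \<sigma> lam est r \<Theta>\<^sub>0 \<beta> L \<epsilon>
    by unfold_locales (fact indep ident range mean var var_pos strategy smooth estimator consistent
      beta_pos A1_deriv A2_expansion A2_residual A3_nbhd A3_bound A3_away)+
  show ?thesis using asymptotic_normality[OF beta_less] by (simp add: U_def[abs_def])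
qed

end
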